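(* Let $p$ and $q$ be two positive real numbers. Then there exists a nonnegative constant $E_{p,q}$ such that for every quaternion window function $g$ and every $f\in L^2(\mathbb{R}^{2d},\mathbb{H})$, $$\big\||(x,w)|^pW(f,g)\big\|_{2,4d}^{\frac{q}{p+q}}\,\big\||(x,w)|^qW(f,g)\big\|_{2,4d}^{\frac{p}{p+q}}\ge4^{-\frac{pq}{p+q}}\sqrt{E_{p,q}}\,\|f\|_{2,2d}\|g\|_{2,2d},$$ where $$E_{p,q}=\bigg[\Big(\frac pq\Big)^{\frac{q}{p+q}}+\Big(\frac qp\Big)^{\frac{p}{p+q}}\bigg]^{-1}\exp\left(\frac{pq\left(2d\ln2+\ln\Big(\frac{2^{2d}\,p\,q\,\Gamma(d)^2}{\Gamma(d/p)\Gamma(d/q)}\Big)\right)}{d(p+q)}-1\right).$$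
   Context: $d\ge 1$ is an integer and $\mathbb{H}$ is the algebra of quaternions with units $i,j,k$. On $\mathbb{R}^n$, $d\mu_n(x)=dx/(2\pi)^{n/2}$, $\|F\|_{2,n}=\big(\int_{\mathbb{R}^n}|F|^2d\mu_n\big)^{1/2}\in[0,\infty]$, and $\mathbb{R}^{2d}\times\mathbb{R}^{2d}$ is identified with $\mathbb{R}^{4d}$; $|(x,w)|$ is the Euclidean norm on $\mathbb{R}^{4d}$. A quaternion window function is a non-zero $g\in L^2(\mathbb{R}^{2d},\mathbb{H})$. The quaternion Wigner transform is $$W(f,g)(x,w)=\int_{\mathbb{R}^{2d}}e^{-i\,w_1\cdot t_1}f\big(x+\tfrac t2\big)\overline{g\big(x-\tfrac t2\big)}e^{-j\,w_2\cdot t_2}\,d\mu_{2d}(t),\quad x\in\mathbb{R}^{2d},\ w=(w_1,w_2),\ t=(t_1,t_2)\in\mathbb{R}^d\times\mathbb{R}^d.$$ $|(x,w)|^pW(f,g)$ denotes the function $(x,w)\mapsto|(x,w)|^pW(f,g)(x,w)$. *)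

theory Defs
  imports "HOL-Analysis.Analysis"
begin

section \<open>Quaternions\<close>

datatype quat = Quat (quat_re: real) (quat_im1: real) (quat_im2: real) (quat_im3: real)

lemma quat_eq_iff:
  "x = y \<longleftrightarrow> quat_re x = quat_re y \<and> quat_im1 x = quat_im1 y \<and>
              quat_im2 x = quat_im2 y \<and> quat_im3 x = quat_im3 y"
  by (cases x; cases y) simp

instantiation quat :: real_vector
begin

definition "0 = Quat 0 0 0 0"
definition "x + y = Quat (quat_re x + quat_re y) (quat_im1 x + quat_im1 y)
                         (quat_im2 x + quat_im2 y) (quat_im3 x + quat_im3 y)"
definition "x - y = Quat (quat_re x - quat_re y) (quat_im1 x - quat_im1 y)
                         (quat_im2 x - quat_im2 y) (quat_im3 x - quat_im3 y)"
definition "- x = Quat (- quat_re x) (- quat_im1 x) (- quat_im2 x) (- quat_im3 x)"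
definition "r *\<^sub>R x = Quat (r * quat_re x) (r * quat_im1 x) (r * quat_im2 x) (r * quat_im3 x)"

instance
  by standard
    (simp_all add: quat_eq_iff zero_quat_def plus_quat_def minus_quat_def uminus_quat_def
      scaleR_quat_def algebra_simps)

end

lemma quat_sel_zero [simp]:
  "quat_re 0 = 0" "quat_im1 0 = 0" "quat_im2 0 = 0" "quat_im3 0 = 0"
  by (simp_all add: zero_quat_def)

lemma quat_sel_add [simp]:
  "quat_re (x + y) = quat_re x + quat_re y" "quat_im1 (x + y) = quat_im1 x + quat_im1 y"
  "quat_im2 (x + y) = quat_im2 x + quat_im2 y" "quat_im3 (x + y) = quat_im3 x + quat_im3 y"
  by (simp_all add: plus_quat_def)

lemma quat_sel_diff [simp]:
  "quat_re (x - y) = quat_re x - quat_re y" "quat_im1 (x - y) = quat_im1 x - quat_im1 y"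
  "quat_im2 (x - y) = quat_im2 x - quat_im2 y" "quat_im3 (x - y) = quat_im3 x - quat_im3 y"
  by (simp_all add: minus_quat_def)

lemma quat_sel_uminus [simp]:
  "quat_re (- x) = - quat_re x" "quat_im1 (- x) = - quat_im1 x"
  "quat_im2 (- x) = - quat_im2 x" "quat_im3 (- x) = - quat_im3 x"
  by (simp_all add: uminus_quat_def)

lemma quat_sel_scaleR [simp]:
  "quat_re (r *\<^sub>R x) = r * quat_re x" "quat_im1 (r *\<^sub>R x) = r * quat_im1 x"
  "quat_im2 (r *\<^sub>R x) = r * quat_im2 x" "quat_im3 (r *\<^sub>R x) = r * quat_im3 x"
  by (simp_all add: scaleR_quat_def)

instantiation quat :: real_algebra_1
begin

definition "1 = Quat 1 0 0 0"
definition "x * y = Quat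
  (quat_re x * quat_re y - quat_im1 x * quat_im1 y - quat_im2 x * quat_im2 y - quat_im3 x * quat_im3 y)
  (quat_re x * quat_im1 y + quat_im1 x * quat_re y + quat_im2 x * quat_im3 y - quat_im3 x * quat_im2 y)
  (quat_re x * quat_im2 y - quat_im1 x * quat_im3 y + quat_im2 x * quat_re y + quat_im3 x * quat_im1 y)
  (quat_re x * quat_im3 y + quat_im1 x * quat_im2 y - quat_im2 x * quat_im1 y + quat_im3 x * quat_re y)"

instance
  by standard (simp_all add: quat_eq_iff one_quat_def times_quat_def algebra_simps)

end

lemma quat_sel_one [simp]:
  "quat_re 1 = 1" "quat_im1 1 = 0" "quat_im2 1 = 0" "quat_im3 1 = 0"
  by (simp_all add: one_quat_def)

lemma quat_sel_mult [simp]: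
  "quat_re (x * y) = quat_re x * quat_re y - quat_im1 x * quat_im1 y
                     - quat_im2 x * quat_im2 y - quat_im3 x * quat_im3 y"
  "quat_im1 (x * y) = quat_re x * quat_im1 y + quat_im1 x * quat_re y
                      + quat_im2 x * quat_im3 y - quat_im3 x * quat_im2 y"
  "quat_im2 (x * y) = quat_re x * quat_im2 y - quat_im1 x * quat_im3 y
                      + quat_im2 x * quat_re y + quat_im3 x * quat_im1 y"
  "quat_im3 (x * y) = quat_re x * quat_im3 y + quat_im1 x * quat_im2 y
                      - quat_im2 x * quat_im1 y + quat_im3 x * quat_re y"
  by (simp_all add: times_quat_def)

definition quat_i :: quat where "quat_i = Quat 0 1 0 0"
definition quat_j :: quat where "quat_j = Quat 0 0 1 0"
definition quat_k :: quat where "quat_k = Quat 0 0 0 1"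

lemma quat_units_mult:
  "quat_i * quat_i = - 1" "quat_j * quat_j = - 1" "quat_k * quat_k = - 1"
  "quat_i * quat_j = quat_k" "quat_j * quat_k = quat_i" "quat_k * quat_i = quat_j"
  "quat_j * quat_i = - quat_k" "quat_k * quat_j = - quat_i" "quat_i * quat_k = - quat_j"
  by (simp_all add: quat_eq_iff quat_i_def quat_j_def quat_k_def)

definition quat_cnj :: "quat \<Rightarrow> quat" where
  "quat_cnj x = Quat (quat_re x) (- quat_im1 x) (- quat_im2 x) (- quat_im3 x)"

instantiation quat :: real_inner
begin

definition "inner x y = quat_re x * quat_re y + quat_im1 x * quat_im1 y
                      + quat_im2 x * quat_im2 y + quat_im3 x * quat_im3 y"
definition "norm (x::quat) = sqrt (inner x x)"
definition "sgn (x::quat) = x /\<^sub>R norm x"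
definition "dist (x::quat) y = norm (x - y)"
definition [code del]:
  "(uniformity :: (quat \<times> quat) filter) = (INF e\<in>{0 <..}. principal {(x, y). dist x y < e})"
definition [code del]:
  "open (U :: quat set) \<longleftrightarrow> (\<forall>x\<in>U. eventually (\<lambda>(x', y). x' = x \<longrightarrow> y \<in> U) uniformity)"

instance
proof
  fix x y z :: quat and r :: real
  show "inner x x = 0 \<longleftrightarrow> x = 0"
    by (auto simp: inner_quat_def quat_eq_iff add_nonneg_eq_0_iff)
qed (simp_all add: inner_quat_def norm_quat_def sgn_quat_def dist_quat_def
      uniformity_quat_def open_quat_def algebra_simps)

end

instantiation quat :: real_normed_div_algebra
begin

definition "inverse (x::quat) = quat_cnj x /\<^sub>R inner x x"
definition "(x::quat) div y = x * inverse y"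

instance
proof
  fix x y :: quat
  show "inverse x * x = 1" "x * inverse x = 1" if "x \<noteq> 0"
  proof -
    have "inner x x \<noteq> 0" using that by simp
    then show "inverse x * x = 1" "x * inverse x = 1"
      unfolding inverse_quat_def inner_quat_def
      by (simp_all add: quat_eq_iff quat_cnj_def field_simps)
  qed
  show "x div y = x * inverse y" by (rule divide_quat_def)
  show "inverse (0::quat) = 0"
    by (simp add: inverse_quat_def)
  have "inner (x * y) (x * y) = inner x x * inner y y"
    by (simp add: inner_quat_def algebra_simps)
  then show "norm (x * y) = norm x * norm y"
    by (simp add: norm_quat_def real_sqrt_mult)
qed

end

instantiation quat :: euclidean_space
begin

definition "Basis = {1, quat_i, quat_j, quat_k}"

instance
proof
  fix x u v :: quat
  show "(Basis :: quat set) \<noteq> {}" "finite (Basis :: quat set)"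
    by (simp_all add: Basis_quat_def)
  show "inner u v = (if u = v then 1 else 0)" if "u \<in> Basis" "v \<in> Basis"
    using that
    by (auto simp: Basis_quat_def inner_quat_def quat_eq_iff quat_i_def quat_j_def quat_k_def)
  show "(\<forall>u\<in>Basis. inner x u = 0) \<longleftrightarrow> x = 0"
    by (auto simp: Basis_quat_def inner_quat_def quat_eq_iff[of x] quat_i_def quat_j_def quat_k_def)
qed

end

section \<open>Square-integrable quaternion-valued functions\<close>

text \<open>The measure \<open>dx / (2\<pi>)\<^bsup>n/2\<^esup>\<close> on an \<open>n\<close>-dimensional Euclidean space.\<close>

definition mu :: "'a::euclidean_space measure" where
  "mu = density lebesgue (\<lambda>_. ennreal (1 / (2 * pi) powr (real DIM('a) / 2)))"

text \<open>Real powers on \<open>[0, \<infinity>]\<close>; only meaningful, and only used, for exponents \<open>r > 0\<close>.\<close>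

definition ennreal_powr :: "ennreal \<Rightarrow> real \<Rightarrow> ennreal" where
  "ennreal_powr x r = (if x = \<infinity> then \<infinity> else ennreal (enn2real x powr r))"

definition norm2 :: "('a::euclidean_space \<Rightarrow> quat) \<Rightarrow> ennreal" where
  "norm2 F = ennreal_powr (\<integral>\<^sup>+ x. ennreal ((norm (F x))\<^sup>2) \<partial>mu) (1 / 2)"

text \<open>Functions, not equivalence classes modulo null sets: the Wigner transform below does not
  depend on the representative, and ``non-zero'' has to be read as ``not almost everywhere zero''.\<close>

definition L2 :: "('a::euclidean_space \<Rightarrow> quat) set" where
  "L2 = {F. F \<in> borel_measurable lebesgue \<and> norm2 F < \<infinity>}"

definition quat_window :: "('a::euclidean_space \<Rightarrow> quat) \<Rightarrow> bool" where
  "quat_window g \<longleftrightarrow> g \<in> L2 \<and> \<not> (AE x in lebesgue. g x = 0)"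

section \<open>The quaternion Wigner transform\<close>

text \<open>The space of dimension \<open>2d\<close> is modelled as the product of two copies of the space of
  dimension \<open>d\<close>; the product norm is the Euclidean one. The two exponentials do not commute
  with the middle factors, so their positions matter.\<close>

definition quat_wigner ::
  "((real^'d) \<times> (real^'d) \<Rightarrow> quat) \<Rightarrow> ((real^'d) \<times> (real^'d) \<Rightarrow> quat) \<Rightarrow>
   ((real^'d) \<times> (real^'d)) \<times> ((real^'d) \<times> (real^'d)) \<Rightarrow> quat" where
  "quat_wigner f g = (\<lambda>(x, w).
     \<integral>t. exp (- (inner (fst w) (fst t) *\<^sub>R quat_i)) * f (x + t /\<^sub>R 2) *
         quat_cnj (g (x - t /\<^sub>R 2)) * exp (- (inner (snd w) (snd t) *\<^sub>R quat_j)) \<partial>mu)"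

end

theory Submission
  imports Defs "HOL-Probability.Characteristic_Functions"
begin

text \<open>
  Put \<open>n = 2 d\<close> and let \<open>\<rho> = |W(f,g)|\<^sup>2\<close>, with \<open>f\<close> and \<open>g\<close> normalised. The only analytic input is the
  sharp Laplace bound \<open>\<integral> exp (- \<tau> |z|\<^sup>2) \<rho> \<le> (2 / (2 + \<tau>))\<^sup>n\<close> together with \<open>\<integral> \<rho> \<ge> 1\<close> (Plancherel).
  Integrating \<open>\<rho>\<close> against a Gaussian in \<open>w\<close> produces a quadratic form with a positive kernel in
  which the quaternion phases have disappeared; after taking absolute values and pairing the four
  factors \<open>f, g, f, g\<close> the other way round, it becomes a form with a Mehler kernel, and the Schur
  test with its ground state \<open>exp (- |c|\<^sup>2)\<close> gives the exact norm.

  From \<open>\<tau> \<rightarrow> 0\<close> and Bernoulli's inequality, \<open>\<integral> |z|\<^bsup>2p\<^esup> \<rho> \<ge> d\<^bsup>p\<^esup>\<close> for \<open>p \<ge> 1\<close>; from \<open>\<tau> = 1\<close>,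
  \<open>\<integral> |z|\<^bsup>2p\<^esup> \<rho> \<ge> 1 - (2/3)\<^sup>n \<ge> 5/9\<close> for \<open>p \<le> 1\<close>. Both exceed
  \<open>exp (-1) (\<Gamma>(1 + d) / \<Gamma>(1 + d/p))\<^bsup>p/d\<^esup>\<close>, and since the bracket in \<open>E\<close> is at least 1, the geometric
  mean of these constants for \<open>p\<close> and \<open>q\<close> dominates \<open>16\<^bsup>-pq/(p+q)\<^esup> E\<close>.
\<close>

section \<open>Affine substitutions and Gaussian integrals\<close>

text \<open>The Laplace bound is attained by \<open>f = g = exp (- |x|^2 / 2)\<close>: there
  \<open>\<rho>\<close> is proportional to \<open>exp (- 2 |z|^2)\<close>, and at each difference
  \<open>y\<close> the regrouped product is a multiple of \<open>exp (- |c|^2)\<close>. So absolute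
  values cost nothing once the phases have been averaged out; taken earlier, under the
  \<open>t\<close>-integral, they would destroy all decay in \<open>w\<close>. The regrouping
  decouples the form: both new factors carry the same difference \<open>y\<close>, so for each
  \<open>y\<close> only a form in \<open>c\<close> and \<open>c'\<close> remains.

  To first order in \<open>\<tau>\<close> the bound says that the integral of
  \<open>|z|^2 \<rho>\<close> is at least \<open>n / 2 = d\<close>, and convexity of the power lifts
  this to exponents above 1. For \<open>p < 1\<close> the power is concave and has no supporting
  line from below, which is why a fixed \<open>\<tau>\<close> is taken; the factor
  \<open>exp (- 1)\<close> pays for that cruder bound.

  The powers of 2 in \<open>E\<close> cancel the prefactor exactly, and
  \<open>\<Gamma>(1 + d/p) / \<Gamma>(1 + d)\<close> is the integral of
  \<open>exp (- |x|^(2p))\<close> over the space of dimension \<open>2 d\<close>, divided by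
  \<open>pi^d\<close>.\<close>

lemma distr_lborel_affine:
  fixes t :: "'a::euclidean_space"
  assumes "c \<noteq> 0"
  shows "density (distr lborel borel (\<lambda>x. t + c *\<^sub>R x)) (\<lambda>_. ennreal (\<bar>c\<bar> ^ DIM('a))) = lborel"
  using lborel_affine[OF assms, of t] by simp

lemma nn_integral_affine:
  fixes f :: "'a::euclidean_space \<Rightarrow> ennreal"
  assumes [measurable]: "f \<in> borel_measurable borel" and "c \<noteq> 0"
  shows "(\<integral>\<^sup>+x. f x \<partial>lborel) = ennreal (\<bar>c\<bar> ^ DIM('a)) * (\<integral>\<^sup>+x. f (t + c *\<^sub>R x) \<partial>lborel)"
  by (subst distr_lborel_affine[OF assms(2), of t, symmetric])
     (simp add: nn_integral_density nn_integral_distr nn_integral_cmult)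

lemma nn_integral_translate:
  fixes f :: "'a::euclidean_space \<Rightarrow> ennreal"
  assumes [measurable]: "f \<in> borel_measurable borel"
  shows "(\<integral>\<^sup>+x. f (x + t) \<partial>lborel) = (\<integral>\<^sup>+x. f x \<partial>lborel)"
  using nn_integral_affine[OF assms, of 1 t] by (simp add: add.commute)

text \<open>An affine bijection pulls null sets back to null sets, because the integral of an
  indicator only changes by a non-zero factor. This allows representatives of \<open>f\<close> and
  \<open>g\<close> to be exchanged at the arguments \<open>x + t/2\<close> and
  \<open>x - t/2\<close>.\<close>

lemma AE_lborel_affine:
  fixes t :: "'a::euclidean_space"
  assumes "AE x in lborel. P x" "c \<noteq> 0"
  shows "AE x in lborel. P (t + c *\<^sub>R x)"
proof -
  obtain N where N: "N \<in> null_sets lborel" "{x. \<not> P x} \<subseteq> N"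
    using assms(1) by (metis (mono_tags, lifting) AE_E null_setsI space_borel space_lborel Collect_cong UNIV_I)
  have [measurable]: "N \<in> sets borel" using N(1) by auto
  have "0 = (\<integral>\<^sup>+x. indicator N x \<partial>(lborel :: 'a measure))"
    using N(1) by auto
  also have "\<dots> = ennreal (\<bar>c\<bar> ^ DIM('a)) * (\<integral>\<^sup>+x. indicator N (t + c *\<^sub>R x) \<partial>lborel)"
    by (rule nn_integral_affine) (use assms(2) in auto)
  finally have "(\<integral>\<^sup>+x. indicator N (t + c *\<^sub>R x) \<partial>(lborel :: 'a measure)) = 0"
    using assms(2) by simp
  then have "AE x in lborel. indicator N (t + c *\<^sub>R x) = (0::ennreal)"
    by (subst (asm) nn_integral_0_iff_AE) auto
  then show ?thesis
    by eventually_elim (use N(2) in \<open>auto simp: indicator_def split: if_splits\<close>)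
qed

lemma integrable_affine:
  fixes f :: "'a::euclidean_space \<Rightarrow> 'b::{banach, second_countable_topology}"
  assumes "integrable lborel f" "c \<noteq> 0"
  shows "integrable lborel (\<lambda>x. f (t + c *\<^sub>R x))"
proof -
  have m [measurable]: "f \<in> borel_measurable borel" using assms by auto
  have "(\<integral>\<^sup>+x. norm (f x) \<partial>lborel) < \<infinity>" using assms by (simp add: integrable_iff_bounded)
  then have "(\<integral>\<^sup>+x. norm (f (t + c *\<^sub>R x)) \<partial>lborel) < \<infinity>"
    using assms(2) by (subst (asm) nn_integral_affine[where c=c and t=t])
      (auto simp: ennreal_mult_less_top)
  then show ?thesis by (simp add: integrable_iff_bounded)
qed

section \<open>The Fourier transform of a Gaussian\<close>

text \<open>This is the characteristic function of the standard normal law, rescaled by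
  \<open>c = sqrt (2 * \<tau>)\<close> so that \<open>(c * w)^2 / 2\<close> becomes
  \<open>\<tau> * w^2\<close>.\<close>

lemma gaussian_fourier_real:
  fixes \<tau> y :: real
  assumes "\<tau> > 0"
  shows "integrable lborel (\<lambda>w. exp (\<i> * of_real (y * w)) * of_real (exp (- \<tau> * w\<^sup>2)))"
    and "(\<integral>w. exp (\<i> * of_real (y * w)) * of_real (exp (- \<tau> * w\<^sup>2)) \<partial>lborel)
      = of_real (sqrt (pi / \<tau>) * exp (- y\<^sup>2 / (4 * \<tau>)))"
proof -
  define c where "c = sqrt (2 * \<tau>)"
  have c: "c > 0" "c\<^sup>2 = 2 * \<tau>" using assms by (auto simp: c_def)
  define F where "F = (\<lambda>x. complex_of_real (sqrt (2 * pi) * std_normal_density x) * iexp (y / c * x))"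
  have F: "F (0 + c * w) = exp (\<i> * of_real (y * w)) * of_real (exp (- \<tau> * w\<^sup>2))" for w
  proof -
    have "y / c * (0 + c * w) = y * w" using c(1) by simp
    moreover have "sqrt (2 * pi) * std_normal_density (0 + c * w) = exp (- \<tau> * w\<^sup>2)"
      by (simp add: std_normal_density_def power_mult_distrib c(2))
    ultimately show ?thesis unfolding F_def by (simp only: mult.commute)
  qed
  have iF: "integrable lborel F"
    by (rule Bochner_Integration.integrable_bound[of _ "\<lambda>x. sqrt (2*pi) * std_normal_density x"])
       (auto simp: F_def norm_mult)
  have "integral\<^sup>L lborel F = of_real (sqrt (2 * pi)) * (\<integral>x. std_normal_density x *\<^sub>R iexp (y / c * x) \<partial>lborel)"
    unfolding F_def by (simp add: scaleR_conv_of_real mult.assoc)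
  also have "\<dots> = of_real (sqrt (2 * pi)) * char std_normal_distribution (y / c)"
    by (simp add: char_def integral_density)
  also have "\<dots> = of_real (sqrt (2 * pi)) * of_real (exp (- (y\<^sup>2 / (4 * \<tau>))))"
    by (subst char_std_normal_distribution) (simp add: power_divide c)
  finally have I: "integral\<^sup>L lborel F = of_real (sqrt (2 * pi)) * of_real (exp (- (y\<^sup>2 / (4 * \<tau>))))" .
  show "integrable lborel (\<lambda>w. exp (\<i> * of_real (y * w)) * of_real (exp (- \<tau> * w\<^sup>2)))"
    using lborel_integrable_real_affine[OF iF, of c 0] c(1) unfolding F by simp
  have "integral\<^sup>L lborel F = \<bar>c\<bar> *\<^sub>R (\<integral>w. F (0 + c * w) \<partial>lborel)"
    using c(1) by (intro lborel_integral_real_affine) auto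
  then have "(\<integral>w. F (0 + c * w) \<partial>lborel) = integral\<^sup>L lborel F /\<^sub>R c"
    using c(1) by simp
  moreover have "sqrt (2 * pi) * inverse c = sqrt (pi / \<tau>)"
  proof -
    have "sqrt (2 * pi) / sqrt (2 * \<tau>) = sqrt ((2 * pi) / (2 * \<tau>))"
      by (rule real_sqrt_divide[symmetric])
    also have "(2 * pi) / (2 * \<tau>) = pi / \<tau>" by simp
    finally show ?thesis unfolding c_def divide_inverse[symmetric] .
  qed
  moreover have "(of_real (sqrt (2 * pi)) * of_real (exp (- (y\<^sup>2 / (4 * \<tau>))))) /\<^sub>R c
    = complex_of_real ((sqrt (2 * pi) * inverse c) * exp (- y\<^sup>2 / (4 * \<tau>)))"
    by (simp add: scaleR_conv_of_real)
  ultimately show "(\<integral>w. exp (\<i> * of_real (y * w)) * of_real (exp (- \<tau> * w\<^sup>2)) \<partial>lborel)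
      = of_real (sqrt (pi / \<tau>) * exp (- y\<^sup>2 / (4 * \<tau>)))"
    unfolding F I by simp
qed

lemma norm_sum_Basis_sq: "(norm (\<Sum>b\<in>Basis. f b *\<^sub>R (b::'a::euclidean_space)))\<^sup>2 = (\<Sum>b\<in>Basis. (f b)\<^sup>2)"
  unfolding power2_norm_eq_inner
  by (simp add: inner_sum_left inner_sum_right inner_Basis if_distrib power2_eq_square cong: if_cong)

text \<open>Phase and Gaussian are both multiplicative over the coordinates, and
  \<open>lborel\<close> is the image of a product measure, so the integral is a product of
  one-dimensional ones.\<close>

lemma gaussian_fourier:
  fixes y :: "'a::euclidean_space" and \<tau> :: real
  assumes "\<tau> > 0"
  shows "integrable lborel (\<lambda>w::'a. exp (\<i> * of_real (inner y w)) * of_real (exp (- \<tau> * (norm w)\<^sup>2)))" (is ?A)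
    and "(\<integral>w. exp (\<i> * of_real (inner y w)) * of_real (exp (- \<tau> * (norm w)\<^sup>2)) \<partial>lborel)
      = of_real (sqrt (pi / \<tau>) ^ DIM('a) * exp (- (norm y)\<^sup>2 / (4 * \<tau>)))" (is ?B)
proof -
  interpret product_sigma_finite "\<lambda>b::'a. lborel :: real measure" ..
  define F where "F = (\<lambda>w::'a. exp (\<i> * of_real (inner y w)) * complex_of_real (exp (- \<tau> * (norm w)\<^sup>2)))"
  define h where "h = (\<lambda>(b::'a) w. exp (\<i> * of_real (inner y b * w)) * complex_of_real (exp (- \<tau> * w\<^sup>2)))"
  have Fh: "F (\<Sum>b\<in>Basis. g b *\<^sub>R b) = (\<Prod>b\<in>Basis. h b (g b))" for g
  proof -
    have "exp (\<i> * of_real (inner y (\<Sum>b\<in>Basis. g b *\<^sub>R b))) = (\<Prod>b\<in>Basis. exp (\<i> * of_real (inner y b * g b)))"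
      by (simp only: exp_sum[OF finite_Basis, symmetric] sum_distrib_left[symmetric] of_real_sum[symmetric]
            inner_sum_right inner_scaleR_right mult.commute)
    moreover have "exp (- \<tau> * (\<Sum>b\<in>(Basis::'a set). (g b)\<^sup>2)) = (\<Prod>b\<in>(Basis::'a set). exp (- \<tau> * (g b)\<^sup>2))"
      by (simp only: exp_sum[OF finite_Basis, symmetric] sum_distrib_left[symmetric])
    ultimately show ?thesis
      unfolding F_def h_def norm_sum_Basis_sq by (simp only: prod.distrib of_real_prod)
  qed
  have ih: "integrable lborel (h b)" for b
    unfolding h_def by (rule gaussian_fourier_real[OF assms])
  have [measurable]: "F \<in> borel_measurable borel" unfolding F_def by measurable
  have "integrable (\<Pi>\<^sub>M b\<in>Basis. lborel) (\<lambda>x. \<Prod>b\<in>(Basis::'a set). h b (x b))"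
    by (rule product_integrable_prod) (auto simp: ih)
  then have "integrable (distr (\<Pi>\<^sub>M b\<in>Basis. lborel) borel (\<lambda>f. \<Sum>b\<in>(Basis::'a set). f b *\<^sub>R b)) F"
    by (subst integrable_distr_eq) (simp_all add: Fh)
  then show ?A
    unfolding F_def[symmetric] lborel_eq[where 'a='a, symmetric] .
  have "integral\<^sup>L lborel F = integral\<^sup>L (distr (\<Pi>\<^sub>M b\<in>Basis. lborel) borel (\<lambda>f. \<Sum>b\<in>(Basis::'a set). f b *\<^sub>R b)) F"
    by (rule arg_cong[OF lborel_eq])
  also have "\<dots> = (\<Prod>b\<in>(Basis::'a set). integral\<^sup>L lborel (h b))"
    by (subst integral_distr) (auto simp: Fh ih intro!: product_integral_prod)
  also have "\<dots> = (\<Prod>b\<in>(Basis::'a set). of_real (sqrt (pi / \<tau>) * exp (- (inner y b)\<^sup>2 / (4 * \<tau>))))"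
    unfolding h_def by (intro prod.cong refl gaussian_fourier_real assms)
  also have "\<dots> = of_real (\<Prod>b\<in>(Basis::'a set). sqrt (pi / \<tau>) * exp (- (inner y b)\<^sup>2 / (4 * \<tau>)))"
    by (rule of_real_prod[symmetric])
  also have "(\<Prod>b\<in>(Basis::'a set). sqrt (pi / \<tau>) * exp (- (inner y b)\<^sup>2 / (4 * \<tau>)))
     = sqrt (pi / \<tau>) ^ DIM('a) * exp (- (norm y)\<^sup>2 / (4 * \<tau>))"
  proof -
    have "(norm y)\<^sup>2 = (\<Sum>b\<in>Basis. (inner y b)\<^sup>2)"
      using norm_sum_Basis_sq[of "inner y"] by (simp add: euclidean_representation)
    then show ?thesis
      by (simp add: prod.distrib exp_sum[symmetric] sum_divide_distrib[symmetric] sum_negf)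
  qed
  finally show ?B unfolding F_def .
qed

lemma nn_integral_gaussian:
  fixes \<tau> :: real and t :: "'a::euclidean_space"
  assumes "\<tau> > 0"
  shows "(\<integral>\<^sup>+w. ennreal (exp (- \<tau> * (norm (w + t))\<^sup>2)) \<partial>(lborel :: 'a measure)) = ennreal (sqrt (pi / \<tau>) ^ DIM('a))"
proof -
  note g = gaussian_fourier[OF assms, of "0::'a", unfolded inner_zero_left of_real_0 mult_zero_right exp_zero mult_1 norm_zero]
  have i: "integrable lborel (\<lambda>w::'a. exp (- \<tau> * (norm w)\<^sup>2))"
    using g(1) unfolding complex_of_real_integrable_eq .
  have "complex_of_real (\<integral>w. exp (- \<tau> * (norm w)\<^sup>2) \<partial>(lborel :: 'a measure)) = of_real (sqrt (pi / \<tau>) ^ DIM('a))"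
    using g(2) unfolding integral_complex_of_real by simp
  then have "(\<integral>w. exp (- \<tau> * (norm w)\<^sup>2) \<partial>(lborel :: 'a measure)) = sqrt (pi / \<tau>) ^ DIM('a)"
    unfolding of_real_eq_iff .
  then have "(\<integral>\<^sup>+w. ennreal (exp (- \<tau> * (norm w)\<^sup>2)) \<partial>(lborel :: 'a measure)) = ennreal (sqrt (pi / \<tau>) ^ DIM('a))"
    using i by (subst nn_integral_eq_integral) auto
  then show ?thesis
    using nn_integral_translate[of "\<lambda>w::'a. ennreal (exp (- \<tau> * (norm w)\<^sup>2))" t] by simp
qed

section \<open>The two-sided quaternion Fourier transform\<close>

lemma measurable_fst_borel: "fst \<in> borel_measurable borel"
  and measurable_snd_borel: "snd \<in> borel_measurable borel"
  by (auto intro!: borel_measurable_continuous_onI continuous_intros)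

text \<open>The map \<open>\<phi>\<close> that sends the complex unit to \<open>u\<close> is a
  bounded algebra homomorphism, so it carries the exponential series, and with it Euler's formula,
  to the quaternions.\<close>

lemma quat_exp_unit:
  fixes u :: quat
  assumes u: "u * u = - 1"
  shows "exp (\<theta> *\<^sub>R u) = cos \<theta> *\<^sub>R 1 + sin \<theta> *\<^sub>R u"
proof -
  define \<phi> where "\<phi> = (\<lambda>z::complex. Re z *\<^sub>R (1::quat) + Im z *\<^sub>R u)"
  have lin: "bounded_linear \<phi>"
    unfolding \<phi>_def
    by (intro bounded_linear_add bounded_linear_compose[OF bounded_linear_scaleR_left]
          bounded_linear_Re bounded_linear_Im)
  have mult: "\<phi> (a * b) = \<phi> a * \<phi> b" for a b
    using u by (simp add: \<phi>_def algebra_simps)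
  have pow: "\<phi> (z ^ n) = \<phi> z ^ n" for z n
    by (induction n) (simp_all add: mult, simp add: \<phi>_def)
  have "(\<lambda>n. \<phi> ((\<i> * \<theta>) ^ n /\<^sub>R fact n)) sums \<phi> (exp (\<i> * \<theta>))"
    by (rule bounded_linear.sums[OF lin exp_converges])
  moreover have "\<phi> ((\<i> * \<theta>) ^ n /\<^sub>R fact n) = (\<theta> *\<^sub>R u) ^ n /\<^sub>R fact n" for n
  proof -
    have "\<phi> ((\<i> * \<theta>) ^ n /\<^sub>R fact n) = \<phi> (\<i> * \<theta>) ^ n /\<^sub>R fact n"
      by (simp only: linear_scale[OF bounded_linear.linear[OF lin]] pow)
    then show ?thesis by (simp add: \<phi>_def)
  qed
  ultimately have "(\<lambda>n. (\<theta> *\<^sub>R u) ^ n /\<^sub>R fact n) sums \<phi> (exp (\<i> * \<theta>))" by simp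
  then have "exp (\<theta> *\<^sub>R u) = \<phi> (exp (\<i> * \<theta>))"
    using exp_converges sums_unique2 by blast
  then show ?thesis by (simp add: \<phi>_def Re_exp Im_exp)
qed

lemma norm_quat_cnj [simp]: "norm (quat_cnj x) = norm x"
  by (simp add: norm_quat_def inner_quat_def quat_cnj_def)

lemma norm_quat_exp_unit:
  fixes u :: quat
  assumes "u * u = - 1" "inner 1 u = 0" "norm u = 1"
  shows "norm (exp (\<theta> *\<^sub>R u)) = 1"
proof -
  have "(norm (exp (\<theta> *\<^sub>R u)))\<^sup>2 = (cos \<theta>)\<^sup>2 + (sin \<theta>)\<^sup>2"
    using assms(2,3) unfolding quat_exp_unit[OF assms(1)] power2_norm_eq_inner
    by (simp add: inner_add_left inner_add_right inner_commute[of u 1] norm_eq_1 power2_eq_square)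
      (simp add: inner_quat_def)
  then show ?thesis using norm_ge_zero[of "exp (\<theta> *\<^sub>R u)"] by (auto simp: power2_eq_1_iff)
qed

lemma norm_exp_quat_i: "norm (exp (\<theta> *\<^sub>R quat_i)) = 1"
  and norm_exp_quat_j: "norm (exp (\<theta> *\<^sub>R quat_j)) = 1"
  by (auto intro!: norm_quat_exp_unit simp: quat_units_mult)
    (simp_all add: norm_quat_def inner_quat_def quat_i_def quat_j_def)

text \<open>The two-sided kernel as an operator on the value \<open>a\<close>, since neither
  exponential can be moved past it. It is a real-linear isometry in \<open>a\<close>.\<close>

definition qft_term :: "'a::euclidean_space \<times> 'b::euclidean_space \<Rightarrow> 'a \<times> 'b \<Rightarrow> quat \<Rightarrow> quat" where
  "qft_term w t a = exp (- (inner (fst w) (fst t) *\<^sub>R quat_i)) * a * exp (- (inner (snd w) (snd t) *\<^sub>R quat_j))"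

lemma qft_term_eq:
  "qft_term w t a =
    (cos (inner (fst w) (fst t)) *\<^sub>R 1 - sin (inner (fst w) (fst t)) *\<^sub>R quat_i) * a *
    (cos (inner (snd w) (snd t)) *\<^sub>R 1 - sin (inner (snd w) (snd t)) *\<^sub>R quat_j)"
  using quat_exp_unit[of quat_i "- inner (fst w) (fst t)"] quat_exp_unit[of quat_j "- inner (snd w) (snd t)"]
  by (simp add: qft_term_def quat_units_mult)

lemma norm_qft_term [simp]: "norm (qft_term w t a) = norm a"
  using norm_exp_quat_i[of "- inner (fst w) (fst t)"] norm_exp_quat_j[of "- inner (snd w) (snd t)"]
  by (simp add: qft_term_def norm_mult)

lemma borel_measurable_qft_term [measurable (raw)]:
  fixes f g :: "'m \<Rightarrow> 'a::euclidean_space \<times> 'b::euclidean_space"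
  assumes [measurable]: "f \<in> borel_measurable M" "g \<in> borel_measurable M" "h \<in> borel_measurable M"
  shows "(\<lambda>x. qft_term (f x) (g x) (h x)) \<in> borel_measurable M"
proof -
  have [measurable]: "(\<lambda>x. fst (f x)) \<in> borel_measurable M" "(\<lambda>x. snd (f x)) \<in> borel_measurable M"
    "(\<lambda>x. fst (g x)) \<in> borel_measurable M" "(\<lambda>x. snd (g x)) \<in> borel_measurable M"
    by (auto intro: measurable_compose[OF _ measurable_fst_borel] measurable_compose[OF _ measurable_snd_borel])
  show ?thesis unfolding qft_term_eq by measurable
qed

text \<open>Only terms oscillating with \<open>t - s\<close> or with its reflection in the second component occur; both
  have the same norm, so the Gaussian average does not see the difference.\<close>

lemma inner_qft_term:
  fixes w t s :: "'a::euclidean_space \<times> 'b::euclidean_space" and a b :: quat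
  defines "y \<equiv> t - s" and "z \<equiv> (fst (t - s), - snd (t - s))"
  shows "inner (qft_term w t a) (qft_term w s b) =
    (inner a b - inner (quat_i * a * quat_j) b) / 2 * cos (inner y w) +
    (inner a b + inner (quat_i * a * quat_j) b) / 2 * cos (inner z w) -
    (inner (quat_i * a) b + inner (a * quat_j) b) / 2 * sin (inner y w) -
    (inner (quat_i * a) b - inner (a * quat_j) b) / 2 * sin (inner z w)"
proof -
  define \<alpha> \<alpha>' \<beta> \<beta>' where ab: "\<alpha> = inner (fst w) (fst t)" "\<alpha>' = inner (fst w) (fst s)"
    "\<beta> = inner (snd w) (snd t)" "\<beta>' = inner (snd w) (snd s)"
  have yz: "inner y w = (\<alpha> - \<alpha>') + (\<beta> - \<beta>')" "inner z w = (\<alpha> - \<alpha>') - (\<beta> - \<beta>')"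
    by (simp_all add: y_def z_def ab inner_prod_def inner_diff_left inner_diff_right inner_commute)
  \<comment> \<open>Left multiplication by \<open>quat_i\<close> and right multiplication by
    \<open>quat_j\<close> commute, are skew-adjoint and square to -1, so only the differences of the
    angles survive. The product-to-sum formulas then produce \<open>y\<close> and
    \<open>z\<close>.\<close>
  have "inner (qft_term w t a) (qft_term w s b) =
      cos (\<alpha> - \<alpha>') * cos (\<beta> - \<beta>') * inner a b + sin (\<alpha> - \<alpha>') * sin (\<beta> - \<beta>') * inner (quat_i * a * quat_j) b
      - sin (\<alpha> - \<alpha>') * cos (\<beta> - \<beta>') * inner (quat_i * a) b - cos (\<alpha> - \<alpha>') * sin (\<beta> - \<beta>') * inner (a * quat_j) b"
    unfolding qft_term_eq ab[symmetric] cos_diff sin_diff inner_quat_def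
    by (simp add: quat_i_def quat_j_def) algebra
  then show ?thesis
    unfolding yz cos_add sin_add cos_diff[of "\<alpha> - \<alpha>'"] sin_diff[of "\<alpha> - \<alpha>'"] by (simp add: field_simps)
qed

lemma gaussian_cos_sin:
  fixes y :: "'a::euclidean_space" and \<tau> :: real
  assumes "\<tau> > 0"
  shows "integrable lborel (\<lambda>w::'a. exp (- \<tau> * (norm w)\<^sup>2) * cos (inner y w))"
    and "(\<integral>w. exp (- \<tau> * (norm w)\<^sup>2) * cos (inner y w) \<partial>lborel) =
      sqrt (pi / \<tau>) ^ DIM('a) * exp (- (norm y)\<^sup>2 / (4 * \<tau>))"
    and "integrable lborel (\<lambda>w::'a. exp (- \<tau> * (norm w)\<^sup>2) * sin (inner y w))"
    and "(\<integral>w. exp (- \<tau> * (norm w)\<^sup>2) * sin (inner y w) \<partial>lborel) = 0"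
proof -
  define F where "F = (\<lambda>w. exp (\<i> * of_real (inner y w)) * complex_of_real (exp (- \<tau> * (norm w)\<^sup>2)))"
  note g = gaussian_fourier[OF assms, of y, folded F_def]
  have R: "Re (F w) = exp (- \<tau> * (norm w)\<^sup>2) * cos (inner y w)"
    and I: "Im (F w) = exp (- \<tau> * (norm w)\<^sup>2) * sin (inner y w)" for w
    unfolding F_def cis_conv_exp[symmetric] by simp_all
  show "integrable lborel (\<lambda>w::'a. exp (- \<tau> * (norm w)\<^sup>2) * cos (inner y w))"
    "integrable lborel (\<lambda>w::'a. exp (- \<tau> * (norm w)\<^sup>2) * sin (inner y w))"
    using integrable_Re[OF g(1)] integrable_Im[OF g(1)] unfolding R I .
  show "(\<integral>w. exp (- \<tau> * (norm w)\<^sup>2) * cos (inner y w) \<partial>lborel) =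
      sqrt (pi / \<tau>) ^ DIM('a) * exp (- (norm y)\<^sup>2 / (4 * \<tau>))"
    "(\<integral>w. exp (- \<tau> * (norm w)\<^sup>2) * sin (inner y w) \<partial>lborel) = 0"
    using integral_Re[OF g(1)] integral_Im[OF g(1)] unfolding R I g(2) Re_complex_of_real Im_complex_of_real .
qed

text \<open>The sine terms integrate to zero. The two cosine terms have equal integrals since
  \<open>z\<close> is a reflection of \<open>y\<close>, so
  \<open>inner (quat_i * a * quat_j) b\<close>, which enters them with opposite signs, cancels and
  the kernel becomes a positive scalar.\<close>

lemma gaussian_inner_qft_term:
  fixes t s :: "'a::euclidean_space \<times> 'b::euclidean_space"
  assumes "\<tau> > 0"
  shows "(\<integral>w. exp (- \<tau> * (norm w)\<^sup>2) * inner (qft_term w t a) (qft_term w s b) \<partial>lborel) =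
      sqrt (pi / \<tau>) ^ DIM('a \<times> 'b) * exp (- (norm (t - s))\<^sup>2 / (4 * \<tau>)) * inner a b"
proof -
  define y where "y = t - s"
  define z where "z = (fst y, - snd y)"
  define c1 c2 c3 c4 where c: "c1 = (inner a b - inner (quat_i * a * quat_j) b) / 2"
    "c2 = (inner a b + inner (quat_i * a * quat_j) b) / 2"
    "c3 = (inner (quat_i * a) b + inner (a * quat_j) b) / 2"
    "c4 = (inner (quat_i * a) b - inner (a * quat_j) b) / 2"
  note gy = gaussian_cos_sin[OF assms, of y] and gz = gaussian_cos_sin[OF assms, of z]
  have "(\<integral>w. exp (- \<tau> * (norm w)\<^sup>2) * inner (qft_term w t a) (qft_term w s b) \<partial>lborel) =
    (\<integral>w. c1 * (exp (- \<tau> * (norm w)\<^sup>2) * cos (inner y w)) + c2 * (exp (- \<tau> * (norm w)\<^sup>2) * cos (inner z w))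
     - c3 * (exp (- \<tau> * (norm w)\<^sup>2) * sin (inner y w)) - c4 * (exp (- \<tau> * (norm w)\<^sup>2) * sin (inner z w)) \<partial>lborel)"
    by (rule Bochner_Integration.integral_cong[OF refl], subst inner_qft_term)
      (simp only: c[symmetric] y_def[symmetric], simp only: z_def[symmetric], simp only: algebra_simps)
  also have "\<dots> = c1 * (sqrt (pi / \<tau>) ^ DIM('a \<times> 'b) * exp (- (norm y)\<^sup>2 / (4 * \<tau>)))
      + c2 * (sqrt (pi / \<tau>) ^ DIM('a \<times> 'b) * exp (- (norm z)\<^sup>2 / (4 * \<tau>)))"
    using gy gz by (simp del: mult_minus_left norm_Pair DIM_prod)
  also have "norm z = norm y"
    by (simp add: z_def norm_prod_def)
  finally show ?thesis
    unfolding y_def c by (simp add: field_simps)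
qed

lemma integrable_pair_mult:
  fixes f g :: "_ \<Rightarrow> real"
  assumes "sigma_finite_measure M1" "sigma_finite_measure M2"
  assumes f: "integrable M1 f" and g: "integrable M2 g"
  shows "integrable (M1 \<Otimes>\<^sub>M M2) (\<lambda>(x, y). f x * g y)"
proof -
  interpret pair_sigma_finite M1 M2 using assms by (simp add: pair_sigma_finite_def)
  note [measurable] = borel_measurable_integrable[OF f] borel_measurable_integrable[OF g]
  show ?thesis
    by (rule Fubini_integrable) (auto simp: abs_mult intro!: integrable_abs f g integrable_mult_left)
qed

lemma integrable_lborel_mult:
  fixes f :: "'a::euclidean_space \<Rightarrow> real" and g :: "'b::euclidean_space \<Rightarrow> real"
  assumes "integrable lborel f" "integrable lborel g"
  shows "integrable lborel (\<lambda>z. f (fst z) * g (snd z))"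
  using integrable_pair_mult[OF sigma_finite_lborel sigma_finite_lborel assms]
  by (simp add: lborel_prod case_prod_beta')

text \<open>Unnormalised and over \<open>lborel\<close>; the powers of \<open>2 * pi\<close> hidden
  in \<open>mu\<close> are accounted for only when the result is transferred to
  \<open>quat_wigner\<close>.\<close>

definition qft :: "('a::euclidean_space \<times> 'b::euclidean_space \<Rightarrow> quat) \<Rightarrow> 'a \<times> 'b \<Rightarrow> quat" where
  "qft h w = (\<integral>t. qft_term w t (h t) \<partial>lborel)"

text \<open>Write the squared norm as a double integral over \<open>t\<close> and \<open>s\<close>,
  and carry out the \<open>w\<close>-integral first.\<close>

lemma gaussian_qft:
  fixes h :: "'a::euclidean_space \<times> 'b::euclidean_space \<Rightarrow> quat"
  assumes \<tau>: "\<tau> > 0" and h: "integrable lborel h"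
  shows "integrable lborel (\<lambda>w. exp (- \<tau> * (norm w)\<^sup>2) * (norm (qft h w))\<^sup>2)" (is ?A)
    and "integrable lborel (\<lambda>(t, s). sqrt (pi / \<tau>) ^ DIM('a \<times> 'b) * exp (- (norm (t - s))\<^sup>2 / (4 * \<tau>)) * inner (h t) (h s))" (is ?C)
    and "(\<integral>w. exp (- \<tau> * (norm w)\<^sup>2) * (norm (qft h w))\<^sup>2 \<partial>lborel) =
      (\<integral>(t, s). sqrt (pi / \<tau>) ^ DIM('a \<times> 'b) * exp (- (norm (t - s))\<^sup>2 / (4 * \<tau>)) * inner (h t) (h s) \<partial>lborel)" (is ?B)
proof -
  have [measurable]: "h \<in> borel_measurable borel" using h by auto
  define \<Phi> where "\<Phi> = (\<lambda>w t. qft_term w t (h t))"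
  have [measurable]: "(\<lambda>(w, t). \<Phi> w t) \<in> borel_measurable (borel \<Otimes>\<^sub>M borel)" unfolding \<Phi>_def by measurable
  have [measurable]: "\<Phi> w \<in> borel_measurable borel" for w unfolding \<Phi>_def by measurable
  have i\<Phi>: "integrable lborel (\<Phi> w)" for w
    by (rule Bochner_Integration.integrable_bound[OF h]) (auto simp: \<Phi>_def)
  have ihh: "integrable lborel (\<lambda>p. norm (h (fst p)) * norm (h (snd p)))"
    by (intro integrable_lborel_mult integrable_norm h)
  define e where "e = (\<lambda>w::'a \<times> 'b. exp (- \<tau> * (norm w)\<^sup>2))"
  have [measurable]: "e \<in> borel_measurable borel" unfolding e_def by measurable
  have e0: "e w \<ge> 0" for w by (simp add: e_def)
  have ie: "integrable lborel e"
    using gaussian_cos_sin(1)[OF \<tau>, of 0] by (simp add: e_def)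
  have [measurable]: "(\<lambda>p. inner (\<Phi> w (fst p)) (\<Phi> w (snd p))) \<in> borel_measurable borel" for w
    by (intro borel_measurable_inner measurable_compose[OF measurable_fst_borel] measurable_compose[OF measurable_snd_borel]) simp_all
  have ip: "integrable lborel (\<lambda>p. inner (\<Phi> w (fst p)) (\<Phi> w (snd p)))" for w
    by (rule Bochner_Integration.integrable_bound[OF ihh], simp)
       (auto simp: \<Phi>_def intro!: order.trans[OF Cauchy_Schwarz_ineq2])
  have sq: "(norm (qft h w))\<^sup>2 = (\<integral>p. inner (\<Phi> w (fst p)) (\<Phi> w (snd p)) \<partial>lborel)" for w
  proof -
    have "(\<integral>p. inner (\<Phi> w (fst p)) (\<Phi> w (snd p)) \<partial>lborel) =
        (\<integral>t. \<integral>s. inner (\<Phi> w t) (\<Phi> w s) \<partial>lborel \<partial>lborel)"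
      using lborel_pair.integral_fst'[of "\<lambda>p. inner (\<Phi> w (fst p)) (\<Phi> w (snd p))"] ip[of w]
      by (simp add: lborel_prod)
    also have "\<dots> = (\<integral>t. inner (\<Phi> w t) (qft h w) \<partial>lborel)"
      using i\<Phi> by (simp add: qft_def \<Phi>_def)
    also have "\<dots> = inner (qft h w) (qft h w)"
      using i\<Phi>[of w] by (simp add: qft_def \<Phi>_def)
    finally show ?thesis by (simp add: power2_norm_eq_inner)
  qed
  \<comment> \<open>Since \<open>qft_term\<close> is isometric, the integrand is dominated by
    \<open>e w * norm (h t) * norm (h s)\<close>. The Gaussian provides integrability in
    \<open>w\<close>, so \<open>h\<close> itself only has to be integrable.\<close>
  have triple: "integrable (lborel \<Otimes>\<^sub>M lborel) (\<lambda>(w, p). e w * inner (\<Phi> w (fst p)) (\<Phi> w (snd p)))"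
    unfolding lborel_prod
  proof (rule Bochner_Integration.integrable_bound[OF integrable_lborel_mult[OF ie ihh]])
    have "(\<lambda>(w, p). e w * inner (\<Phi> w (fst p)) (\<Phi> w (snd p))) \<in> borel_measurable (borel \<Otimes>\<^sub>M (borel \<Otimes>\<^sub>M borel))"
      by measurable
    then show "(\<lambda>(w, p). e w * inner (\<Phi> w (fst p)) (\<Phi> w (snd p))) \<in> borel_measurable lborel"
      by (simp add: borel_prod)
    show "AE z in lborel. norm (case z of (w, p) \<Rightarrow> e w * inner (\<Phi> w (fst p)) (\<Phi> w (snd p)))
        \<le> norm (e (fst z) * (norm (h (fst (snd z))) * norm (h (snd (snd z)))))"
      using e0 by (auto simp: \<Phi>_def abs_mult case_prod_beta
        intro!: mult_left_mono order.trans[OF Cauchy_Schwarz_ineq2])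
  qed
  have ew: "e w * (norm (qft h w))\<^sup>2 = (\<integral>p. e w * inner (\<Phi> w (fst p)) (\<Phi> w (snd p)) \<partial>lborel)" for w
    unfolding sq by simp
  have ker: "(\<integral>w. e w * inner (\<Phi> w (fst p)) (\<Phi> w (snd p)) \<partial>lborel) =
     (case p of (t, s) \<Rightarrow> sqrt (pi / \<tau>) ^ DIM('a \<times> 'b) * exp (- (norm (t - s))\<^sup>2 / (4 * \<tau>)) * inner (h t) (h s))" for p
    unfolding e_def \<Phi>_def gaussian_inner_qft_term[OF \<tau>] by (simp add: case_prod_beta)
  show ?A
    using lborel_pair.integrable_fst'[OF triple] by (simp add: sq e_def)
  show ?C
    using lborel_pair.integrable_snd[OF triple] unfolding ker by simp
  show ?B
    using lborel_pair.Fubini_integral[OF triple] unfolding ew[symmetric] ker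
    by (simp add: e_def)
qed

section \<open>The Mehler kernel\<close>

text \<open>The added \<open>|c|^2 - |c'|^2\<close> is what makes the square complete without a
  remainder in \<open>c\<close>: the coefficients of \<open>|c'|^2\<close>, of the mixed term and of
  \<open>|c|^2\<close> become \<open>\<kappa>\<close>, \<open>2 * \<kappa> * \<delta>\<close> and
  \<open>\<kappa> * \<delta>^2\<close>.\<close>

lemma gaussian_kernel_complete_square:
  fixes c c' :: "'a::real_inner" and \<tau> :: real
  assumes "\<tau> > 0"
  shows "- (\<tau> / 4 * (norm (c + c'))\<^sup>2 + (norm (c - c'))\<^sup>2 / \<tau>) + (norm c)\<^sup>2 - (norm c')\<^sup>2 =
    - ((2 + \<tau>)\<^sup>2 / (4 * \<tau>)) * (norm (c' + ((\<tau> - 2) / (\<tau> + 2)) *\<^sub>R c))\<^sup>2"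
proof -
  define P Q R where "P = inner c c" "Q = inner c c'" "R = inner c' c'"
  define \<kappa> \<delta> where "\<kappa> = (2 + \<tau>)\<^sup>2 / (4 * \<tau>)" "\<delta> = (\<tau> - 2) / (\<tau> + 2)"
  have \<kappa>: "\<kappa> = \<tau> / 4 + 1 / \<tau> + 1"
    using assms by (simp add: \<kappa>_\<delta>_def field_simps power2_eq_square)
  have "\<kappa> * \<delta> = (2 + \<tau>) * (\<tau> - 2) / (4 * \<tau>)"
    using assms by (simp add: \<kappa>_\<delta>_def power2_eq_square divide_simps)
  then have \<kappa>\<delta>: "\<kappa> * \<delta> = \<tau> / 4 - 1 / \<tau>"
    using assms by (simp add: field_simps power2_eq_square)
  have "\<kappa> * \<delta>\<^sup>2 = (\<kappa> * \<delta>) * \<delta>" by (simp add: power2_eq_square)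
  also have "\<dots> = ((2 + \<tau>) * (\<tau> - 2) / (4 * \<tau>)) * \<delta>"
    unfolding \<kappa>\<delta> using assms by (simp add: field_simps power2_eq_square)
  also have "\<dots> = (\<tau> - 2)\<^sup>2 / (4 * \<tau>)"
    using assms by (simp add: \<kappa>_\<delta>_def power2_eq_square divide_simps)
  finally have \<kappa>\<delta>2: "\<kappa> * \<delta>\<^sup>2 = \<tau> / 4 + 1 / \<tau> - 1"
    using assms by (simp add: field_simps power2_eq_square)
  have "- (\<tau> / 4 * (P + 2 * Q + R) + (P - 2 * Q + R) / \<tau>) + P - R =
    - (\<kappa> * R + 2 * (\<kappa> * \<delta>) * Q + (\<kappa> * \<delta>\<^sup>2) * P)"
    unfolding \<kappa> \<kappa>\<delta>[unfolded \<kappa>] \<kappa>\<delta>2[unfolded \<kappa>] by (simp add: algebra_simps add_divide_distrib diff_divide_distrib)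
  also have "\<dots> = - \<kappa> * (norm (c' + \<delta> *\<^sub>R c))\<^sup>2"
    unfolding power2_norm_eq_inner P_Q_R_def
    by (simp add: inner_add_left inner_add_right inner_commute[of c' c] power2_eq_square algebra_simps)
  also have "(P + 2 * Q + R) = (norm (c + c'))\<^sup>2"
    unfolding power2_norm_eq_inner P_Q_R_def by (simp add: inner_add_left inner_add_right inner_commute[of c' c])
  also have "(P - 2 * Q + R) = (norm (c - c'))\<^sup>2"
    unfolding power2_norm_eq_inner P_Q_R_def by (simp add: inner_diff_left inner_diff_right inner_commute[of c' c])
  finally show ?thesis
    unfolding \<kappa>_\<delta>_def P_Q_R_def power2_norm_eq_inner .
qed

text \<open>The eigenvalue equation for \<open>exp (- |c|^2)\<close>, divided by the eigenfunction:
  hence the value does not depend on \<open>c\<close>.\<close>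

lemma nn_integral_gaussian_kernel:
  fixes c :: "'a::euclidean_space" and \<tau> :: real
  assumes "\<tau> > 0"
  shows "(\<integral>\<^sup>+c'. ennreal (exp (- (\<tau> / 4 * (norm (c + c'))\<^sup>2 + (norm (c - c'))\<^sup>2 / \<tau>) + (norm c)\<^sup>2 - (norm c')\<^sup>2)) \<partial>lborel)
    = ennreal ((sqrt (4 * pi * \<tau>) / (2 + \<tau>)) ^ DIM('a))"
proof -
  have "sqrt (pi / ((2 + \<tau>)\<^sup>2 / (4 * \<tau>))) = sqrt (4 * pi * \<tau>) / (2 + \<tau>)"
    using assms by (simp add: real_sqrt_divide real_sqrt_mult)
  then show ?thesis
    unfolding gaussian_kernel_complete_square[OF assms]
    using nn_integral_gaussian[of "(2 + \<tau>)\<^sup>2 / (4 * \<tau>)" "((\<tau> - 2) / (\<tau> + 2)) *\<^sub>R c"] assms by simp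
qed

text \<open>Schur test with the Gaussian \<open>exp (- |c|\<^sup>2)\<close>, the ground state of the kernel.\<close>

lemma gaussian_kernel_schur:
  fixes H :: "'a::euclidean_space \<Rightarrow> real" and \<tau> :: real
  assumes \<tau>: "\<tau> > 0" and [measurable]: "H \<in> borel_measurable borel" and H: "\<And>c. H c \<ge> 0"
  shows "(\<integral>\<^sup>+c'. \<integral>\<^sup>+c. ennreal (exp (- (\<tau> / 4 * (norm (c + c'))\<^sup>2 + (norm (c - c'))\<^sup>2 / \<tau>)) * (H c * H c')) \<partial>lborel \<partial>lborel)
    \<le> ennreal ((sqrt (4 * pi * \<tau>) / (2 + \<tau>)) ^ DIM('a)) * (\<integral>\<^sup>+c. ennreal ((H c)\<^sup>2) \<partial>lborel)" (is "?I \<le> _")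
proof -
  define L where "L = (sqrt (4 * pi * \<tau>) / (2 + \<tau>)) ^ DIM('a)"
  define k where "k = (\<lambda>c c'::'a. exp (- (\<tau> / 4 * (norm (c + c'))\<^sup>2 + (norm (c - c'))\<^sup>2 / \<tau>) + (norm c)\<^sup>2 - (norm c')\<^sup>2))"
  have k0: "k c c' \<ge> 0" for c c' by (simp add: k_def)
  have [measurable]: "(\<lambda>(c, c'). k c c') \<in> borel_measurable (borel \<Otimes>\<^sub>M borel)"
    unfolding k_def by measurable
  have kL: "(\<integral>\<^sup>+c'. ennreal (k c c') \<partial>lborel) = ennreal L" for c
    unfolding k_def L_def by (rule nn_integral_gaussian_kernel[OF \<tau>])
  define h :: real where "h = 1 / 2"
  have h: "h \<ge> 0" "h + h = 1" by (simp_all add: h_def)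
  \<comment> \<open>The arithmetic-geometric mean inequality for \<open>H c * a\<close> and
    \<open>H c' / a\<close>, where \<open>a^2\<close> is the quotient of the ground state at
    \<open>c'\<close> and at \<open>c\<close>. As the kernel is symmetric, the second term is the
    first with \<open>c\<close> and \<open>c'\<close> exchanged, and both integrate to the same
    value.\<close>
  have pt: "exp (- (\<tau> / 4 * (norm (c + c'))\<^sup>2 + (norm (c - c'))\<^sup>2 / \<tau>)) * (H c * H c')
      \<le> h * ((H c)\<^sup>2 * k c c') + h * ((H c')\<^sup>2 * k c' c)" for c c'
  proof -
    define K where "K = exp (- (\<tau> / 4 * (norm (c + c'))\<^sup>2 + (norm (c - c'))\<^sup>2 / \<tau>))"
    define a where "a = exp (((norm c)\<^sup>2 - (norm c')\<^sup>2) / 2)"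
    have a: "a > 0" by (simp add: a_def)
    have "k c c' = K * a\<^sup>2"
      unfolding k_def K_def a_def power2_eq_square exp_add[symmetric] by simp
    moreover have "k c' c = K * (inverse a)\<^sup>2"
      unfolding k_def K_def a_def power2_eq_square exp_add[symmetric] exp_minus[symmetric]
      by (simp add: norm_minus_commute add.commute field_simps)
    moreover have "H c * H c' \<le> 1/2 * ((H c)\<^sup>2 * a\<^sup>2) + 1/2 * ((H c')\<^sup>2 * (inverse a)\<^sup>2)"
      using sum_squares_bound[of "H c * a" "H c' * inverse a"] a
      by (simp add: power_mult_distrib field_simps)
    ultimately show ?thesis
      unfolding K_def[symmetric]
      using mult_left_mono[of "H c * H c'" "1/2 * ((H c)\<^sup>2 * a\<^sup>2) + 1/2 * ((H c')\<^sup>2 * (inverse a)\<^sup>2)" K]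
      by (simp add: K_def h_def algebra_simps)
  qed
  have "(\<integral>\<^sup>+c'. \<integral>\<^sup>+c. ennreal (exp (- (\<tau> / 4 * (norm (c + c'))\<^sup>2 + (norm (c - c'))\<^sup>2 / \<tau>)) * (H c * H c')) \<partial>lborel \<partial>lborel)
    \<le> (\<integral>\<^sup>+c'. \<integral>\<^sup>+c. (ennreal h * (ennreal ((H c)\<^sup>2) * ennreal (k c c')) + ennreal h * (ennreal ((H c')\<^sup>2) * ennreal (k c' c))) \<partial>lborel \<partial>lborel)"
    using k0 h(1)
    by (intro nn_integral_mono order.trans[OF ennreal_leI[OF pt]]) (simp add: ennreal_mult)
  also have "\<dots> = ennreal h * (\<integral>\<^sup>+c'. \<integral>\<^sup>+c. ennreal ((H c)\<^sup>2) * ennreal (k c c') \<partial>lborel \<partial>lborel)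
      + ennreal h * (\<integral>\<^sup>+c'. \<integral>\<^sup>+c. ennreal ((H c')\<^sup>2) * ennreal (k c' c) \<partial>lborel \<partial>lborel)"
    by (simp add: nn_integral_add nn_integral_cmult)
  finally have le: "?I \<le> ennreal h * (\<integral>\<^sup>+c'. \<integral>\<^sup>+c. ennreal ((H c)\<^sup>2) * ennreal (k c c') \<partial>lborel \<partial>lborel)
      + ennreal h * (\<integral>\<^sup>+c'. \<integral>\<^sup>+c. ennreal ((H c')\<^sup>2) * ennreal (k c' c) \<partial>lborel \<partial>lborel)" .
  have "(\<integral>\<^sup>+c'. \<integral>\<^sup>+c. ennreal ((H c)\<^sup>2) * ennreal (k c c') \<partial>lborel \<partial>lborel)
      = (\<integral>\<^sup>+c. \<integral>\<^sup>+c'. ennreal ((H c)\<^sup>2) * ennreal (k c c') \<partial>lborel \<partial>lborel)"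
    by (rule lborel_pair.Fubini') measurable
  also have "\<dots> = ennreal L * (\<integral>\<^sup>+c. ennreal ((H c)\<^sup>2) \<partial>lborel)"
    by (simp add: nn_integral_cmult nn_integral_multc kL mult.commute)
  finally have 1: "(\<integral>\<^sup>+c'. \<integral>\<^sup>+c. ennreal ((H c)\<^sup>2) * ennreal (k c c') \<partial>lborel \<partial>lborel) = ennreal L * (\<integral>\<^sup>+c. ennreal ((H c)\<^sup>2) \<partial>lborel)" .
  have 2: "(\<integral>\<^sup>+c'. \<integral>\<^sup>+c. ennreal ((H c')\<^sup>2) * ennreal (k c' c) \<partial>lborel \<partial>lborel) = ennreal L * (\<integral>\<^sup>+c. ennreal ((H c)\<^sup>2) \<partial>lborel)"
    by (simp add: nn_integral_cmult nn_integral_multc kL mult.commute)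
  have "ennreal h + ennreal h = 1"
    using h by (subst ennreal_plus[symmetric]) simp_all
  then have "ennreal h * (ennreal L * (\<integral>\<^sup>+c. ennreal ((H c)\<^sup>2) \<partial>lborel)) + ennreal h * (ennreal L * (\<integral>\<^sup>+c. ennreal ((H c)\<^sup>2) \<partial>lborel))
      = ennreal L * (\<integral>\<^sup>+c. ennreal ((H c)\<^sup>2) \<partial>lborel)"
    by (simp only: distrib_right[symmetric] mult_1)
  then show ?thesis using le unfolding 1 2 L_def[symmetric] by (simp only:)
qed

text \<open>With \<open>u = x + t/2\<close>, \<open>v = x - t/2\<close>, \<open>u' = x + s/2\<close>, \<open>v' = x - s/2\<close>, the new variables are the midpoints
  \<open>c\<close> of \<open>u, v'\<close> and \<open>c'\<close> of \<open>u', v\<close> and the common difference \<open>y = u - v' = u' - v\<close>.\<close>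

lemma nn_integral_wigner_variables:
  fixes \<Psi> :: "'a::euclidean_space \<times> 'a \<times> 'a \<Rightarrow> ennreal"
  assumes m [measurable]: "\<Psi> \<in> borel_measurable (borel \<Otimes>\<^sub>M (borel \<Otimes>\<^sub>M borel))"
  shows "(\<integral>\<^sup>+x. \<integral>\<^sup>+t. \<integral>\<^sup>+s. \<Psi> (x, t, s) \<partial>lborel \<partial>lborel \<partial>lborel) =
    ennreal (2 ^ DIM('a)) * (\<integral>\<^sup>+y. \<integral>\<^sup>+c'. \<integral>\<^sup>+c. \<Psi> ((c + c') /\<^sub>R 2, y + (c - c'), y - (c - c')) \<partial>lborel \<partial>lborel \<partial>lborel)"
proof -
  \<comment> \<open>Mean and half-difference, \<open>t = y + r\<close> and \<open>s = y - r\<close>.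
    The Jacobian arises in \<open>t = s + 2 r\<close>; every later substitution is a
    translation.\<close>
  have 1: "(\<integral>\<^sup>+t. \<integral>\<^sup>+s. \<Psi> (x, t, s) \<partial>lborel \<partial>lborel) =
    ennreal (2 ^ DIM('a)) * (\<integral>\<^sup>+r. \<integral>\<^sup>+y. \<Psi> (x, y + r, y - r) \<partial>lborel \<partial>lborel)" for x
  proof -
    have "(\<integral>\<^sup>+t. \<integral>\<^sup>+s. \<Psi> (x, t, s) \<partial>lborel \<partial>lborel) = (\<integral>\<^sup>+s. \<integral>\<^sup>+t. \<Psi> (x, t, s) \<partial>lborel \<partial>lborel)"
      by (rule lborel_pair.Fubini'[symmetric]) measurable
    also have "\<dots> = (\<integral>\<^sup>+s. ennreal (2 ^ DIM('a)) * (\<integral>\<^sup>+r. \<Psi> (x, s + 2 *\<^sub>R r, s) \<partial>lborel) \<partial>lborel)"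
      by (intro nn_integral_cong, subst nn_integral_affine[where c=2]) simp_all
    also have "\<dots> = ennreal (2 ^ DIM('a)) * (\<integral>\<^sup>+s. \<integral>\<^sup>+r. \<Psi> (x, s + 2 *\<^sub>R r, s) \<partial>lborel \<partial>lborel)"
      by (rule nn_integral_cmult) measurable
    also have "(\<integral>\<^sup>+s. \<integral>\<^sup>+r. \<Psi> (x, s + 2 *\<^sub>R r, s) \<partial>lborel \<partial>lborel) = (\<integral>\<^sup>+r. \<integral>\<^sup>+s. \<Psi> (x, s + 2 *\<^sub>R r, s) \<partial>lborel \<partial>lborel)"
      by (rule lborel_pair.Fubini'[symmetric]) measurable
    also have "\<dots> = (\<integral>\<^sup>+r. \<integral>\<^sup>+y. \<Psi> (x, y + r, y - r) \<partial>lborel \<partial>lborel)"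
    proof (rule nn_integral_cong)
      fix r :: 'a
      have "(\<integral>\<^sup>+s. \<Psi> (x, s + 2 *\<^sub>R r, s) \<partial>lborel) = (\<integral>\<^sup>+y. \<Psi> (x, (y + - r) + 2 *\<^sub>R r, y + - r) \<partial>lborel)"
        by (rule nn_integral_translate[symmetric]) measurable
      then show "(\<integral>\<^sup>+s. \<Psi> (x, s + 2 *\<^sub>R r, s) \<partial>lborel) = (\<integral>\<^sup>+y. \<Psi> (x, y + r, y - r) \<partial>lborel)"
        by (simp add: scaleR_2 algebra_simps)
    qed
    finally show ?thesis .
  qed
  \<comment> \<open>Shift \<open>x\<close> by \<open>r / 2\<close>, call the shifted variable
    \<open>c'\<close>, and put \<open>r = c - c'\<close>; the original \<open>x\<close> is then
    \<open>c' + (c - c') / 2\<close>, the midpoint of \<open>c\<close> and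
    \<open>c'\<close>.\<close>
  have 2: "(\<integral>\<^sup>+x. \<integral>\<^sup>+r. \<Psi> (x, y + r, y - r) \<partial>lborel \<partial>lborel)
      = (\<integral>\<^sup>+c'. \<integral>\<^sup>+c. \<Psi> ((c + c') /\<^sub>R 2, y + (c - c'), y - (c - c')) \<partial>lborel \<partial>lborel)" for y
  proof -
    have "(\<integral>\<^sup>+x. \<integral>\<^sup>+r. \<Psi> (x, y + r, y - r) \<partial>lborel \<partial>lborel) = (\<integral>\<^sup>+r. \<integral>\<^sup>+x. \<Psi> (x, y + r, y - r) \<partial>lborel \<partial>lborel)"
      by (rule lborel_pair.Fubini'[symmetric]) measurable
    also have "\<dots> = (\<integral>\<^sup>+r. \<integral>\<^sup>+x. \<Psi> (x + r /\<^sub>R 2, y + r, y - r) \<partial>lborel \<partial>lborel)"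
      by (intro nn_integral_cong nn_integral_translate[where f="\<lambda>x. \<Psi> (x, y + r, y - r)" for r, symmetric]) measurable
    also have "\<dots> = (\<integral>\<^sup>+x. \<integral>\<^sup>+r. \<Psi> (x + r /\<^sub>R 2, y + r, y - r) \<partial>lborel \<partial>lborel)"
      by (rule lborel_pair.Fubini') measurable
    also have "\<dots> = (\<integral>\<^sup>+c'. \<integral>\<^sup>+c. \<Psi> ((c + c') /\<^sub>R 2, y + (c - c'), y - (c - c')) \<partial>lborel \<partial>lborel)"
    proof (rule nn_integral_cong)
      fix x :: 'a
      have "(\<integral>\<^sup>+r. \<Psi> (x + r /\<^sub>R 2, y + r, y - r) \<partial>lborel) =
         (\<integral>\<^sup>+c. \<Psi> (x + (c + - x) /\<^sub>R 2, y + (c + - x), y - (c + - x)) \<partial>lborel)"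
        by (rule nn_integral_translate[symmetric]) measurable
      moreover have "x + (c + - x) /\<^sub>R 2 = (c + x) /\<^sub>R 2" for c
        using scaleR_half_double[of x] by (simp add: algebra_simps)
      ultimately show "(\<integral>\<^sup>+r. \<Psi> (x + r /\<^sub>R 2, y + r, y - r) \<partial>lborel) =
        (\<integral>\<^sup>+c. \<Psi> ((c + x) /\<^sub>R 2, y + (c - x), y - (c - x)) \<partial>lborel)"
        by simp
    qed
    finally show ?thesis .
  qed
  have "(\<integral>\<^sup>+x. \<integral>\<^sup>+t. \<integral>\<^sup>+s. \<Psi> (x, t, s) \<partial>lborel \<partial>lborel \<partial>lborel)
     = ennreal (2 ^ DIM('a)) * (\<integral>\<^sup>+x. \<integral>\<^sup>+r. \<integral>\<^sup>+y. \<Psi> (x, y + r, y - r) \<partial>lborel \<partial>lborel \<partial>lborel)"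
    unfolding 1 by (rule nn_integral_cmult) measurable
  also have "(\<integral>\<^sup>+x. \<integral>\<^sup>+r. \<integral>\<^sup>+y. \<Psi> (x, y + r, y - r) \<partial>lborel \<partial>lborel \<partial>lborel)
     = (\<integral>\<^sup>+x. \<integral>\<^sup>+y. \<integral>\<^sup>+r. \<Psi> (x, y + r, y - r) \<partial>lborel \<partial>lborel \<partial>lborel)"
    by (intro nn_integral_cong lborel_pair.Fubini'[symmetric]) measurable
  also have "\<dots> = (\<integral>\<^sup>+y. \<integral>\<^sup>+x. \<integral>\<^sup>+r. \<Psi> (x, y + r, y - r) \<partial>lborel \<partial>lborel \<partial>lborel)"
    by (rule lborel_pair.Fubini'[symmetric]) measurable
  finally show ?thesis unfolding 2 .
qed

text \<open>The map from \<open>(y, c)\<close> to \<open>(c + y/2, c - y/2)\<close> preserves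
  volume; it is realised by two translations and an exchange of integrals.\<close>

lemma nn_integral_sum_difference:
  fixes F G :: "'a::euclidean_space \<Rightarrow> ennreal"
  assumes [measurable]: "F \<in> borel_measurable borel" "G \<in> borel_measurable borel"
  shows "(\<integral>\<^sup>+y. \<integral>\<^sup>+c. F (c + y /\<^sub>R 2) * G (c - y /\<^sub>R 2) \<partial>lborel \<partial>lborel) =
    (\<integral>\<^sup>+x. F x \<partial>lborel) * (\<integral>\<^sup>+x. G x \<partial>lborel)"
proof -
  have "(\<integral>\<^sup>+c. F (c + y /\<^sub>R 2) * G (c - y /\<^sub>R 2) \<partial>lborel) = (\<integral>\<^sup>+c. F (y + c) * G c \<partial>lborel)" for y
  proof -
    have "(\<integral>\<^sup>+c. F (c + y /\<^sub>R 2) * G (c - y /\<^sub>R 2) \<partial>lborel) =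
        (\<integral>\<^sup>+c. F ((c + y /\<^sub>R 2) + y /\<^sub>R 2) * G ((c + y /\<^sub>R 2) - y /\<^sub>R 2) \<partial>lborel)"
      by (rule nn_integral_translate[symmetric]) measurable
    moreover have "(c + y /\<^sub>R 2) + y /\<^sub>R 2 = y + c" "(c + y /\<^sub>R 2) - y /\<^sub>R 2 = c" for c
      by (simp_all add: add.assoc flip: scaleR_left_distrib)
    ultimately show ?thesis by (simp only:)
  qed
  then have "(\<integral>\<^sup>+y. \<integral>\<^sup>+c. F (c + y /\<^sub>R 2) * G (c - y /\<^sub>R 2) \<partial>lborel \<partial>lborel) =
      (\<integral>\<^sup>+y. \<integral>\<^sup>+c. F (y + c) * G c \<partial>lborel \<partial>lborel)" by simp
  also have "\<dots> = (\<integral>\<^sup>+c. \<integral>\<^sup>+y. F (y + c) * G c \<partial>lborel \<partial>lborel)"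
    by (rule lborel_pair.Fubini') measurable
  also have "\<dots> = (\<integral>\<^sup>+x. F x \<partial>lborel) * (\<integral>\<^sup>+x. G x \<partial>lborel)"
    by (simp add: nn_integral_multc nn_integral_translate nn_integral_cmult)
  finally show ?thesis .
qed

text \<open>In the new variables the four factors regroup as \<open>H y c * H y c'\<close>, with
  \<open>F\<close> and \<open>G\<close> at \<open>u\<close> and \<open>v'\<close> in the first and
  at \<open>u'\<close> and \<open>v\<close> in the second. The Schur bound applies for each fixed
  \<open>y\<close>, and the integral of \<open>(H y c)^2\<close> over \<open>y\<close> and
  \<open>c\<close> is again the product of the two squared norms.\<close>

lemma gaussian_wigner_form_le:
  fixes F G :: "'a::euclidean_space \<Rightarrow> real" and \<tau> :: real
  assumes \<tau>: "\<tau> > 0" and [measurable]: "F \<in> borel_measurable borel" "G \<in> borel_measurable borel"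
    and F: "\<And>x. F x \<ge> 0" and G: "\<And>x. G x \<ge> 0"
  shows "(\<integral>\<^sup>+x. \<integral>\<^sup>+t. \<integral>\<^sup>+s. ennreal (exp (- \<tau> * (norm x)\<^sup>2) * (exp (- (norm (t - s))\<^sup>2 / (4 * \<tau>)) *
       ((F (x + t /\<^sub>R 2) * G (x - t /\<^sub>R 2)) * (F (x + s /\<^sub>R 2) * G (x - s /\<^sub>R 2))))) \<partial>lborel \<partial>lborel \<partial>lborel)
    \<le> ennreal (2 ^ DIM('a) * (sqrt (4 * pi * \<tau>) / (2 + \<tau>)) ^ DIM('a)) *
      ((\<integral>\<^sup>+x. ennreal ((F x)\<^sup>2) \<partial>lborel) * (\<integral>\<^sup>+x. ennreal ((G x)\<^sup>2) \<partial>lborel))" (is "?L \<le> _")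
proof -
  define L where "L = (sqrt (4 * pi * \<tau>) / (2 + \<tau>)) ^ DIM('a)"
  have L: "L \<ge> 0" using \<tau> by (simp add: L_def)
  define H where "H = (\<lambda>y c. F (c + y /\<^sub>R 2) * G (c - y /\<^sub>R 2))"
  have [measurable]: "H y \<in> borel_measurable borel" for y unfolding H_def by measurable
  have [measurable]: "(\<lambda>(y, c). H y c) \<in> borel_measurable (borel \<Otimes>\<^sub>M borel)" unfolding H_def by measurable
  have H: "H y c \<ge> 0" for y c using F G by (simp add: H_def)
  have eq: "exp (- \<tau> * (norm ((c + c') /\<^sub>R 2))\<^sup>2) * (exp (- (norm ((y + (c - c')) - (y - (c - c'))))\<^sup>2 / (4 * \<tau>)) *
       ((F ((c + c') /\<^sub>R 2 + (y + (c - c')) /\<^sub>R 2) * G ((c + c') /\<^sub>R 2 - (y + (c - c')) /\<^sub>R 2)) *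
        (F ((c + c') /\<^sub>R 2 + (y - (c - c')) /\<^sub>R 2) * G ((c + c') /\<^sub>R 2 - (y - (c - c')) /\<^sub>R 2))))
     = exp (- (\<tau> / 4 * (norm (c + c'))\<^sup>2 + (norm (c - c'))\<^sup>2 / \<tau>)) * (H y c * H y c')" for y c c'
  proof -
    have half: "u /\<^sub>R 2 + u /\<^sub>R 2 = u" for u :: 'a
      by (simp flip: scaleR_left_distrib)
    have a: "(c + c') /\<^sub>R 2 + (y + (c - c')) /\<^sub>R 2 = c + y /\<^sub>R 2"
        "(c + c') /\<^sub>R 2 - (y + (c - c')) /\<^sub>R 2 = c' - y /\<^sub>R 2"
        "(c + c') /\<^sub>R 2 + (y - (c - c')) /\<^sub>R 2 = c' + y /\<^sub>R 2"
        "(c + c') /\<^sub>R 2 - (y - (c - c')) /\<^sub>R 2 = c - y /\<^sub>R 2"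
      using half[of c] half[of c'] by (simp_all add: scaleR_add_right scaleR_diff_right algebra_simps)
    have b: "(y + (c - c')) - (y - (c - c')) = 2 *\<^sub>R (c - c')"
      by (simp add: scaleR_2)
    have "exp (- \<tau> * (norm ((c + c') /\<^sub>R 2))\<^sup>2) * exp (- (norm (2 *\<^sub>R (c - c')))\<^sup>2 / (4 * \<tau>)) =
      exp (- (\<tau> / 4 * (norm (c + c'))\<^sup>2 + (norm (c - c'))\<^sup>2 / \<tau>))"
      by (simp add: power_mult_distrib power_divide exp_add[symmetric] power2_eq_square)
    then show ?thesis unfolding a b H_def by (simp add: mult_ac)
  qed
  have "?L = ennreal (2 ^ DIM('a)) * (\<integral>\<^sup>+y. \<integral>\<^sup>+c'. \<integral>\<^sup>+c.
      ennreal (exp (- (\<tau> / 4 * (norm (c + c'))\<^sup>2 + (norm (c - c'))\<^sup>2 / \<tau>)) * (H y c * H y c')) \<partial>lborel \<partial>lborel \<partial>lborel)"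
    
    by (subst nn_integral_wigner_variables[where \<Psi>="\<lambda>(x, t, s). ennreal (exp (- \<tau> * (norm x)\<^sup>2) * (exp (- (norm (t - s))\<^sup>2 / (4 * \<tau>)) *
       ((F (x + t /\<^sub>R 2) * G (x - t /\<^sub>R 2)) * (F (x + s /\<^sub>R 2) * G (x - s /\<^sub>R 2)))))", unfolded case_prod_conv])
      (measurable, simp only: eq)
  also have "\<dots> \<le> ennreal (2 ^ DIM('a)) * (\<integral>\<^sup>+y. ennreal L * (\<integral>\<^sup>+c. ennreal ((H y c)\<^sup>2) \<partial>lborel) \<partial>lborel)"
    unfolding L_def by (intro mult_left_mono nn_integral_mono gaussian_kernel_schur \<tau> H) simp_all
  also have "\<dots> = ennreal (2 ^ DIM('a)) * (ennreal L * (\<integral>\<^sup>+y. \<integral>\<^sup>+c. ennreal ((H y c)\<^sup>2) \<partial>lborel \<partial>lborel))"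
    by (subst nn_integral_cmult) simp_all
  finally have le: "?L \<le> ennreal (2 ^ DIM('a)) * (ennreal L * (\<integral>\<^sup>+y. \<integral>\<^sup>+c. ennreal ((H y c)\<^sup>2) \<partial>lborel \<partial>lborel))" .
  have "(\<integral>\<^sup>+y. \<integral>\<^sup>+c. ennreal ((H y c)\<^sup>2) \<partial>lborel \<partial>lborel) =
     (\<integral>\<^sup>+x. ennreal ((F x)\<^sup>2) \<partial>lborel) * (\<integral>\<^sup>+x. ennreal ((G x)\<^sup>2) \<partial>lborel)"
    using nn_integral_sum_difference[of "\<lambda>x. ennreal ((F x)\<^sup>2)" "\<lambda>x. ennreal ((G x)\<^sup>2)"]
    by (simp add: H_def power_mult_distrib ennreal_mult)
  moreover have "ennreal (2 ^ DIM('a) * L) = ennreal (2 ^ DIM('a)) * ennreal L"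
    using L by (simp add: ennreal_mult)
  ultimately show ?thesis using le unfolding L_def[symmetric] by (simp only: mult.assoc)
qed

section \<open>Continuity of translations\<close>

text \<open>Continuity of translation in the L1 norm, stated for sequences because the limits come
  from dominated convergence.\<close>

definition translation_continuous :: "('a::euclidean_space \<Rightarrow> 'b::{banach, second_countable_topology}) \<Rightarrow> bool" where
  "translation_continuous f \<longleftrightarrow> integrable lborel f \<and>
    (\<forall>Y. Y \<longlonglongrightarrow> 0 \<longrightarrow> (\<lambda>n. \<integral>t. norm (f (Y n + t) - f t) \<partial>lborel) \<longlonglongrightarrow> 0)"

lemma integrable_translate:
  fixes f :: "'a::euclidean_space \<Rightarrow> 'b::{banach, second_countable_topology}"
  assumes "integrable lborel f"
  shows "integrable lborel (\<lambda>t. f (y + t))"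
  using integrable_affine[OF assms, of 1 y] by simp

lemma integral_affine:
  fixes f :: "'a::euclidean_space \<Rightarrow> 'b::{banach, second_countable_topology}"
  assumes [measurable]: "f \<in> borel_measurable borel" and "c \<noteq> 0"
  shows "(\<integral>x. f x \<partial>lborel) = \<bar>c\<bar> ^ DIM('a) *\<^sub>R (\<integral>x. f (t + c *\<^sub>R x) \<partial>lborel)"
  by (subst distr_lborel_affine[OF assms(2), of t, symmetric])
     (simp add: integral_density integral_distr)

lemma integral_translate:
  fixes f :: "'a::euclidean_space \<Rightarrow> 'b::{banach, second_countable_topology}"
  assumes "f \<in> borel_measurable borel"
  shows "(\<integral>t. f (y + t) \<partial>lborel) = (\<integral>t. f t \<partial>lborel)"
  using integral_affine[OF assms, of 1 y] by simp

text \<open>A three-epsilon argument: translation is an isometry of L1, so the approximation error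
  is paid twice.\<close>

lemma translation_continuous_closure:
  fixes f :: "'a::euclidean_space \<Rightarrow> 'b::{banach, second_countable_topology}"
  assumes f: "integrable lborel f"
    and approx: "\<And>e. e > 0 \<Longrightarrow> \<exists>g. translation_continuous g \<and> (\<integral>t. norm (f t - g t) \<partial>lborel) < e"
  shows "translation_continuous f"
  unfolding translation_continuous_def
proof (intro conjI f allI impI LIMSEQ_I)
  fix Y :: "nat \<Rightarrow> 'a" and r :: real
  assume Y: "Y \<longlonglongrightarrow> 0" and r: "r > 0"
  then obtain g where g: "translation_continuous g" and fg: "(\<integral>t. norm (f t - g t) \<partial>lborel) < r / 3"
    using approx[of "r / 3"] by auto
  from g have ig: "integrable lborel g" and tg: "(\<lambda>n. \<integral>t. norm (g (Y n + t) - g t) \<partial>lborel) \<longlonglongrightarrow> 0"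
    using Y by (auto simp: translation_continuous_def)
  from r have "r / 3 > 0" by simp
  from LIMSEQ_D[OF tg this] obtain N
    where N: "\<And>n. n \<ge> N \<Longrightarrow> norm ((\<integral>t. norm (g (Y n + t) - g t) \<partial>lborel) - 0) < r / 3" by auto
  have "norm ((\<integral>t. norm (f (Y n + t) - f t) \<partial>lborel) - 0) < r" if "n \<ge> N" for n
  proof -
    have [measurable]: "f \<in> borel_measurable borel" "g \<in> borel_measurable borel" using f ig by auto
    have i1: "integrable lborel (\<lambda>t. norm (f t - g t))" using f ig by auto
    have i2: "integrable lborel (\<lambda>t. norm (f (Y n + t) - g (Y n + t)))"
      using integrable_translate[OF i1] .
    have i3: "integrable lborel (\<lambda>t. norm (g (Y n + t) - g t))"
      using integrable_translate[OF ig] ig by auto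
    have i4: "integrable lborel (\<lambda>t. norm (f (Y n + t) - f t))"
      using integrable_translate[OF f] f by auto
    have "(\<integral>t. norm (f (Y n + t) - f t) \<partial>lborel) \<le>
      (\<integral>t. norm (f (Y n + t) - g (Y n + t)) + norm (g (Y n + t) - g t) + norm (f t - g t) \<partial>lborel)"
    proof (rule integral_mono[OF i4])
      show "norm (f (Y n + t) - f t) \<le> norm (f (Y n + t) - g (Y n + t)) + norm (g (Y n + t) - g t) + norm (f t - g t)" for t
        using norm_triangle_ineq[of "f (Y n + t) - g (Y n + t)" "g (Y n + t) - g t"]
          norm_triangle_ineq4[of "f (Y n + t) - g t" "f t - g t"] by simp
    qed (use i1 i2 i3 in auto)
    also have "\<dots> = (\<integral>t. norm (f t - g t) \<partial>lborel) + (\<integral>t. norm (g (Y n + t) - g t) \<partial>lborel) + (\<integral>t. norm (f t - g t) \<partial>lborel)"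
      using i1 i2 i3 integral_translate[of "\<lambda>t. norm (f t - g t)" "Y n"] by simp
    also have "\<dots> < r" using fg N[OF that] by simp
    finally show ?thesis by simp
  qed
  then show "\<exists>N. \<forall>n\<ge>N. norm ((\<integral>t. norm (f (Y n + t) - f t) \<partial>lborel) - 0) < r" by blast
qed

text \<open>Openness controls only one side: a point of \<open>U\<close> stays in \<open>U\<close>
  under small shifts. This handles the positive part \<open>g\<close>, dominated by the indicator of
  \<open>U\<close>. The other half of the symmetric difference has the same measure because
  \<open>U\<close> and its translates do.\<close>

lemma translation_continuous_open:
  fixes U :: "'a::euclidean_space set"
  assumes "open U" "emeasure lborel U < \<infinity>"
  shows "translation_continuous (indicator U :: 'a \<Rightarrow> real)"
  unfolding translation_continuous_def
proof (intro conjI allI impI)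
  have [measurable]: "U \<in> sets borel" using assms by auto
  show i: "integrable lborel (indicator U :: 'a \<Rightarrow> real)"
    using assms by simp
  fix Y :: "nat \<Rightarrow> 'a" assume Y: "Y \<longlonglongrightarrow> 0"
  define g where "g = (\<lambda>n t. max (indicator U t - indicator U (Y n + t)) (0::real))"
  have [measurable]: "g n \<in> borel_measurable borel" for n unfolding g_def by measurable
  have i': "integrable lborel (\<lambda>t. indicator U (Y n + t) :: real)" for n
    by (rule integrable_translate[OF i])
  have gi: "integrable lborel (g n)" for n
    by (rule Bochner_Integration.integrable_bound[OF i]) (auto simp: g_def indicator_def)
  have "(\<lambda>n. \<integral>t. g n t \<partial>lborel) \<longlonglongrightarrow> (\<integral>t. 0 \<partial>(lborel :: 'a measure))"
  proof (rule integral_dominated_convergence[OF _ _ i])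
    show "AE t in lborel. (\<lambda>n. g n t) \<longlonglongrightarrow> 0"
    proof (rule AE_I2)
      fix t :: 'a
      show "(\<lambda>n. g n t) \<longlonglongrightarrow> 0"
      proof (cases "t \<in> U")
        case True
        have "(\<lambda>n. Y n + t) \<longlonglongrightarrow> 0 + t" by (intro tendsto_intros Y)
        then have "eventually (\<lambda>n. Y n + t \<in> U) sequentially"
          using topological_tendstoD[OF _ \<open>open U\<close>] True by auto
        then show ?thesis
          by (intro tendsto_eventually) (auto elim!: eventually_mono simp: g_def)
      qed (auto simp: g_def max_def)
    qed
  qed (auto simp: g_def indicator_def)
  then have "(\<lambda>n. 2 * (\<integral>t. g n t \<partial>lborel)) \<longlonglongrightarrow> 2 * 0" by (intro tendsto_intros) simp
  moreover have "(\<integral>t. norm (indicator U (Y n + t) - indicator U t :: real) \<partial>lborel) = 2 * (\<integral>t. g n t \<partial>lborel)" for n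
  proof -
    have "(\<integral>t. norm (indicator U (Y n + t) - indicator U t :: real) \<partial>lborel)
        = (\<integral>t. 2 * g n t + (indicator U (Y n + t) - indicator U t) \<partial>lborel)"
      by (intro Bochner_Integration.integral_cong) (auto simp: g_def indicator_def)
    also have "\<dots> = 2 * (\<integral>t. g n t \<partial>lborel) + ((\<integral>t. indicator U (Y n + t) \<partial>lborel) - (\<integral>t. indicator U t \<partial>lborel))"
      using gi i i' by simp
    also have "(\<integral>t. indicator U (Y n + t) \<partial>lborel) = (\<integral>t. indicator U t \<partial>lborel :: real)"
      by (rule integral_translate) measurable
    finally show ?thesis by simp
  qed
  ultimately show "(\<lambda>n. \<integral>t. norm (indicator U (Y n + t) - indicator U t :: real) \<partial>lborel) \<longlonglongrightarrow> 0" by simp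
qed

text \<open>Outer regularity supplies open sets that are close to \<open>A\<close> in
  measure.\<close>

lemma translation_continuous_indicator:
  fixes A :: "'a::euclidean_space set"
  assumes A [measurable]: "A \<in> sets borel" and fin: "emeasure lborel A < \<infinity>"
  shows "translation_continuous (indicator A :: 'a \<Rightarrow> real)"
proof (rule translation_continuous_closure)
  show "integrable lborel (indicator A :: 'a \<Rightarrow> real)" using assms by simp
  fix e :: real assume "e > 0"
  then obtain U where U: "open U" "A \<subseteq> U" "(U - A) \<in> lmeasurable" "emeasure lebesgue (U - A) < ennreal e"
    using sets_lebesgue_outer_open[of A e] A by auto
  have [measurable]: "U \<in> sets borel" using U by auto
  have m: "emeasure lborel (U - A) < ennreal e" using U(4) by simp
  have "emeasure lborel U \<le> emeasure lborel A + emeasure lborel (U - A)"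
    using emeasure_subadditive[of A lborel "U - A"] U(2) by (simp add: Un_absorb1)
  also have "\<dots> < \<infinity>" using fin m using less_top by (auto simp: less_top[symmetric])
  finally have "translation_continuous (indicator U :: 'a \<Rightarrow> real)"
    using U by (intro translation_continuous_open)
  moreover have "(\<integral>t. norm (indicator A t - indicator U t :: real) \<partial>lborel) = measure lborel (U - A)"
  proof -
    have "(\<integral>t. norm (indicator A t - indicator U t :: real) \<partial>lborel) = (\<integral>t. indicator (U - A) t \<partial>lborel)"
      using U(2) by (intro Bochner_Integration.integral_cong) (auto simp: indicator_def)
    then show ?thesis by simp
  qed
  moreover have "measure lborel (U - A) < e"
  proof -
    have "emeasure lborel (U - A) = ennreal (measure lborel (U - A))"
      using m by (intro emeasure_eq_ennreal_measure) auto
    then show ?thesis using m by (simp add: ennreal_less_iff)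
  qed
  ultimately show "\<exists>g. translation_continuous g \<and> (\<integral>t. norm (indicator A t - g t :: real) \<partial>lborel) < e"
    by auto
qed

lemma translation_continuous_integrable:
  fixes f :: "'a::euclidean_space \<Rightarrow> 'b::{banach, second_countable_topology}"
  assumes "integrable lborel f"
  shows "translation_continuous f"
  using assms
proof (induction rule: integrable_induct)
  case (base A c)
  then have A: "translation_continuous (indicator A :: 'a \<Rightarrow> real)"
    by (intro translation_continuous_indicator) auto
  have "norm (indicator A (y + t) *\<^sub>R c - indicator A t *\<^sub>R c) = norm (indicator A (y + t) - indicator A t :: real) * norm c" for y t
    by (simp flip: scaleR_diff_left)
  moreover have "(\<lambda>n. (\<integral>t. norm (indicator A (Y n + t) - indicator A t :: real) \<partial>lborel) * norm c) \<longlonglongrightarrow> 0 * norm c"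
    if "Y \<longlonglongrightarrow> 0" for Y
    using A that unfolding translation_continuous_def by (intro tendsto_intros) auto
  ultimately show ?case
    using base unfolding translation_continuous_def by auto
next
  case (add f g)
  show ?case unfolding translation_continuous_def
  proof (intro conjI allI impI)
    show "integrable lborel (\<lambda>x. f x + g x)" using add by auto
    fix Y :: "nat \<Rightarrow> 'a" assume "Y \<longlonglongrightarrow> 0"
    then have "(\<lambda>n. (\<integral>t. norm (f (Y n + t) - f t) \<partial>lborel) + (\<integral>t. norm (g (Y n + t) - g t) \<partial>lborel)) \<longlonglongrightarrow> 0 + 0"
      using add.IH unfolding translation_continuous_def by (intro tendsto_intros) auto
    then have lim0: "(\<lambda>n. (\<integral>t. norm (f (Y n + t) - f t) \<partial>lborel) + (\<integral>t. norm (g (Y n + t) - g t) \<partial>lborel)) \<longlonglongrightarrow> 0"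
      by simp
    have le: "(\<integral>t. norm (f (Y n + t) + g (Y n + t) - (f t + g t)) \<partial>lborel)
        \<le> (\<integral>t. norm (f (Y n + t) - f t) \<partial>lborel) + (\<integral>t. norm (g (Y n + t) - g t) \<partial>lborel)" for n
    proof -
      have i: "integrable lborel (\<lambda>t. norm (f (Y n + t) - f t))" "integrable lborel (\<lambda>t. norm (g (Y n + t) - g t))"
        using integrable_translate[of f "Y n"] integrable_translate[of g "Y n"] add by auto
      have "(\<integral>t. norm (f (Y n + t) + g (Y n + t) - (f t + g t)) \<partial>lborel)
        \<le> (\<integral>t. norm (f (Y n + t) - f t) + norm (g (Y n + t) - g t) \<partial>lborel)"
      proof (rule integral_mono)
        show "integrable lborel (\<lambda>t. norm (f (Y n + t) + g (Y n + t) - (f t + g t)))"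
          using integrable_translate[of f "Y n"] integrable_translate[of g "Y n"] add by auto
        show "norm (f (Y n + t) + g (Y n + t) - (f t + g t)) \<le> norm (f (Y n + t) - f t) + norm (g (Y n + t) - g t)" for t
          by (rule norm_diff_triangle_ineq)
      qed (use i in auto)
      then show ?thesis using i by simp
    qed
    show "(\<lambda>n. \<integral>t. norm (f (Y n + t) + g (Y n + t) - (f t + g t)) \<partial>lborel) \<longlonglongrightarrow> 0"
      by (rule tendsto_sandwich[OF _ _ tendsto_const lim0]) (auto intro!: always_eventually le)
  qed
next
  case (lim f s)
  show ?case
  proof (rule translation_continuous_closure)
    show f: "integrable lborel f" by fact
    fix e :: real assume "e > 0"
    have [measurable]: "s i \<in> borel_measurable borel" "f \<in> borel_measurable borel" for i
      using lim by auto
    have "(\<lambda>i. \<integral>t. norm (f t - s i t) \<partial>lborel) \<longlonglongrightarrow> (\<integral>t. 0 \<partial>(lborel :: 'a measure))"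
    proof (rule integral_dominated_convergence[where w="\<lambda>t. 3 * norm (f t)"])
      show "AE t in lborel. (\<lambda>i. norm (f t - s i t)) \<longlonglongrightarrow> 0"
      proof (rule AE_I2)
        fix t
        have "(\<lambda>i. norm (f t - s i t)) \<longlonglongrightarrow> norm (f t - f t)"
          using lim(2)[of t] by (intro tendsto_intros) auto
        then show "(\<lambda>i. norm (f t - s i t)) \<longlonglongrightarrow> 0" by simp
      qed
      show "AE t in lborel. norm (norm (f t - s i t)) \<le> 3 * norm (f t)" for i
      proof (rule AE_I2)
        fix t
        show "norm (norm (f t - s i t)) \<le> 3 * norm (f t)"
          using lim(3)[of t i] norm_triangle_ineq4[of "f t" "s i t"] by simp
      qed
    qed (use f in auto)
    then have "eventually (\<lambda>i. (\<integral>t. norm (f t - s i t) \<partial>lborel) < e) sequentially"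
      using \<open>e > 0\<close> by (intro order_tendstoD(2)) auto
    then obtain i where "(\<integral>t. norm (f t - s i t) \<partial>lborel) < e"
      using eventually_happens'[OF sequentially_bot] by blast
    then show "\<exists>g. translation_continuous g \<and> (\<integral>t. norm (f t - g t) \<partial>lborel) < e"
      using lim by blast
  qed
qed

section \<open>Plancherel's inequality\<close>

lemma autocorrelation_bounds:
  fixes h :: "'a::euclidean_space \<Rightarrow> quat"
  assumes [measurable]: "h \<in> borel_measurable borel" and h2: "integrable lborel (\<lambda>t. (norm (h t))\<^sup>2)"
  shows "integrable lborel (\<lambda>t. inner (h t) (h (y + t)))"
    and "(\<integral>t. \<bar>inner (h t) (h (y + t))\<bar> \<partial>lborel) \<le> (\<integral>t. (norm (h t))\<^sup>2 \<partial>lborel)"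
proof -
  have b: "\<bar>inner (h t) (h (y + t))\<bar> \<le> 1/2 * (norm (h t))\<^sup>2 + 1/2 * (norm (h (y + t)))\<^sup>2" for t
    using Cauchy_Schwarz_ineq2[of "h t" "h (y + t)"] sum_squares_bound[of "norm (h t)" "norm (h (y + t))"]
    by simp
  have i: "integrable lborel (\<lambda>t. (norm (h (y + t)))\<^sup>2)"
    using integrable_translate[OF h2] .
  have I: "integrable lborel (\<lambda>t. 1/2 * (norm (h t))\<^sup>2 + 1/2 * (norm (h (y + t)))\<^sup>2)"
    using h2 i by auto
  show 1: "integrable lborel (\<lambda>t. inner (h t) (h (y + t)))"
    by (rule Bochner_Integration.integrable_bound[OF I]) (use b in \<open>auto intro!: order.trans[OF b]\<close>)
  have "(\<integral>t. \<bar>inner (h t) (h (y + t))\<bar> \<partial>lborel) \<le> (\<integral>t. 1/2 * (norm (h t))\<^sup>2 + 1/2 * (norm (h (y + t)))\<^sup>2 \<partial>lborel)"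
    by (rule integral_mono[OF _ I b]) (use 1 in auto)
  also have "\<dots> = (\<integral>t. (norm (h t))\<^sup>2 \<partial>lborel)"
    using h2 i integral_translate[of "\<lambda>t. (norm (h t))\<^sup>2" y] by simp
  finally show "(\<integral>t. \<bar>inner (h t) (h (y + t))\<bar> \<partial>lborel) \<le> (\<integral>t. (norm (h t))\<^sup>2 \<partial>lborel)" .
qed

text \<open>Continuity of translation is known in L1, while the pairing is of L2 type. So
  \<open>h\<close> is cut off at height \<open>M\<close>: the bounded part is paired with the small
  L1 norm of the difference \<open>d\<close>, and the rest is small in L2 uniformly in the
  shift.\<close>

lemma autocorrelation_tendsto:
  fixes h :: "'a::euclidean_space \<Rightarrow> quat"
  assumes h1: "integrable lborel h" and h2: "integrable lborel (\<lambda>t. (norm (h t))\<^sup>2)"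
    and Y: "Y \<longlonglongrightarrow> 0"
  shows "(\<lambda>n. \<integral>t. inner (h t) (h (Y n + t)) \<partial>lborel) \<longlonglongrightarrow> (\<integral>t. (norm (h t))\<^sup>2 \<partial>lborel)"
proof (rule LIMSEQ_I)
  fix r :: real assume r: "r > 0"
  have [measurable]: "h \<in> borel_measurable borel" using h1 by auto
  define S where "S = (\<integral>t. (norm (h t))\<^sup>2 \<partial>lborel)"
  have S: "S \<ge> 0" by (simp add: S_def)
  \<comment> \<open>Error budget for the three terms of \<open>pt\<close>: \<open>r/4\<close> for
    the bounded part, \<open>\<epsilon>/2 * 4 S \<le> r/2\<close> for the square of
    \<open>d\<close>, and \<open>r/4\<close> for the cut-off tail. The summand 1 covers
    \<open>S = 0\<close>.\<close>
  define \<epsilon> where "\<epsilon> = r / (4 * (S + 1))"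
  have \<epsilon>: "\<epsilon> > 0" using r S by (simp add: \<epsilon>_def)
  define k where "k = (\<lambda>(M::nat) t. if norm (h t) \<le> real M then h t else 0)"
  have [measurable]: "k M \<in> borel_measurable borel" for M unfolding k_def by measurable
  have i_hk: "integrable lborel (\<lambda>t. (norm (h t - k M t))\<^sup>2)" for M
    by (rule Bochner_Integration.integrable_bound[OF h2]) (auto simp: k_def)
  have "(\<lambda>M. \<integral>t. (norm (h t - k M t))\<^sup>2 \<partial>lborel) \<longlonglongrightarrow> (\<integral>t. 0 \<partial>(lborel :: 'a measure))"
  proof (rule integral_dominated_convergence[OF _ _ h2])
    show "AE t in lborel. (\<lambda>M. (norm (h t - k M t))\<^sup>2) \<longlonglongrightarrow> 0"
    proof (rule AE_I2)
      fix t
      obtain N where "norm (h t) \<le> real N" using real_arch_simple by blast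
      then have "\<forall>M\<ge>N. (norm (h t - k M t))\<^sup>2 = 0" by (auto simp: k_def)
      then show "(\<lambda>M. (norm (h t - k M t))\<^sup>2) \<longlonglongrightarrow> 0"
        by (intro tendsto_eventually) (auto simp: eventually_sequentially)
    qed
  qed (auto simp: k_def)
  then have "eventually (\<lambda>M. (\<integral>t. (norm (h t - k M t))\<^sup>2 \<partial>lborel) < \<epsilon> * r / 2) sequentially"
    using \<epsilon> r by (intro order_tendstoD(2)) auto
  then obtain M where M: "(\<integral>t. (norm (h t - k M t))\<^sup>2 \<partial>lborel) < \<epsilon> * r / 2"
    using eventually_happens'[OF sequentially_bot] by blast
  have tc: "(\<lambda>n. \<integral>t. norm (h (Y n + t) - h t) \<partial>lborel) \<longlonglongrightarrow> 0"
    using translation_continuous_integrable[OF h1] Y by (auto simp: translation_continuous_def)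
  have "r / (4 * (real M + 1)) > 0" using r by simp
  from LIMSEQ_D[OF tc this] obtain N
    where N: "\<And>n. n \<ge> N \<Longrightarrow> norm ((\<integral>t. norm (h (Y n + t) - h t) \<partial>lborel) - 0) < r / (4 * (real M + 1))" by auto
  have "norm ((\<integral>t. inner (h t) (h (Y n + t)) \<partial>lborel) - S) < r" if "n \<ge> N" for n
  proof -
    define d where "d = (\<lambda>t. h (Y n + t) - h t)"
    have [measurable]: "d \<in> borel_measurable borel" unfolding d_def by measurable
    have id1: "integrable lborel (\<lambda>t. norm (d t))"
      unfolding d_def using integrable_translate[OF h1] h1 by auto
    have d2: "(norm (d t))\<^sup>2 \<le> 2 * (norm (h (Y n + t)))\<^sup>2 + 2 * (norm (h t))\<^sup>2" for t
    proof -
      have "(norm (d t))\<^sup>2 \<le> (norm (h (Y n + t)) + norm (h t))\<^sup>2"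
        unfolding d_def by (intro power_mono norm_triangle_ineq4) simp
      also have "\<dots> \<le> 2 * (norm (h (Y n + t)))\<^sup>2 + 2 * (norm (h t))\<^sup>2"
        using sum_squares_bound[of "norm (h (Y n + t))" "norm (h t)"] by (simp add: power2_sum)
      finally show ?thesis .
    qed
    have ih2: "integrable lborel (\<lambda>t. (norm (h (Y n + t)))\<^sup>2)" using integrable_translate[OF h2] .
    have I2: "integrable lborel (\<lambda>t. 2 * (norm (h (Y n + t)))\<^sup>2 + 2 * (norm (h t))\<^sup>2)" using ih2 h2 by auto
    have id2: "integrable lborel (\<lambda>t. (norm (d t))\<^sup>2)"
      by (rule Bochner_Integration.integrable_bound[OF I2]) (use d2 in auto)
    have dS: "(\<integral>t. (norm (d t))\<^sup>2 \<partial>lborel) \<le> 4 * S"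
    proof -
      have "(\<integral>t. (norm (d t))\<^sup>2 \<partial>lborel) \<le> (\<integral>t. 2 * (norm (h (Y n + t)))\<^sup>2 + 2 * (norm (h t))\<^sup>2 \<partial>lborel)"
        by (rule integral_mono[OF id2 I2 d2])
      also have "\<dots> = 4 * S"
        using ih2 h2 integral_translate[of "\<lambda>t. (norm (h t))\<^sup>2" "Y n"] by (simp add: S_def)
      finally show ?thesis .
    qed
    have pt: "\<bar>inner (h t) (d t)\<bar> \<le> real M * norm (d t) + (\<epsilon> / 2 * (norm (d t))\<^sup>2 + 1 / (2 * \<epsilon>) * (norm (h t - k M t))\<^sup>2)" for t
    proof -
      have "inner (h t) (d t) = inner (k M t) (d t) + inner (h t - k M t) (d t)"
        by (simp add: inner_diff_left)
      then have "\<bar>inner (h t) (d t)\<bar> \<le> \<bar>inner (k M t) (d t)\<bar> + \<bar>inner (h t - k M t) (d t)\<bar>" by simp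
      moreover have "\<bar>inner (k M t) (d t)\<bar> \<le> real M * norm (d t)"
        by (rule order.trans[OF Cauchy_Schwarz_ineq2 mult_right_mono]) (auto simp: k_def)
      moreover have "\<bar>inner (h t - k M t) (d t)\<bar> \<le> norm (h t - k M t) * norm (d t)"
        by (rule Cauchy_Schwarz_ineq2)
      moreover have "norm (h t - k M t) * norm (d t) \<le> \<epsilon> / 2 * (norm (d t))\<^sup>2 + 1 / (2 * \<epsilon>) * (norm (h t - k M t))\<^sup>2"
        using zero_le_power2[of "\<epsilon> * norm (d t) - norm (h t - k M t)"] \<epsilon>
        by (simp add: power2_diff field_simps power2_eq_square)
      ultimately show ?thesis by linarith
    qed
    have I3: "integrable lborel (\<lambda>t. real M * norm (d t) + (\<epsilon> / 2 * (norm (d t))\<^sup>2 + 1 / (2 * \<epsilon>) * (norm (h t - k M t))\<^sup>2))"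
      using id1 id2 i_hk by auto
    have ihd: "integrable lborel (\<lambda>t. inner (h t) (d t))"
      by (rule Bochner_Integration.integrable_bound[OF I3]) (auto intro!: order.trans[OF pt])
    have "(\<integral>t. inner (h t) (h (Y n + t)) \<partial>lborel) - S = (\<integral>t. inner (h t) (d t) \<partial>lborel)"
    proof -
      have "(\<integral>t. inner (h t) (d t) \<partial>lborel) = (\<integral>t. inner (h t) (h (Y n + t)) - (norm (h t))\<^sup>2 \<partial>lborel)"
        by (simp add: d_def inner_diff_right power2_norm_eq_inner)
      then show ?thesis
        using autocorrelation_bounds(1)[of h "Y n"] h2 by (simp add: S_def)
    qed
    also have "norm \<dots> \<le> (\<integral>t. \<bar>inner (h t) (d t)\<bar> \<partial>lborel)"
      using integral_abs_bound by simp
    also have "\<dots> \<le> (\<integral>t. real M * norm (d t) + (\<epsilon> / 2 * (norm (d t))\<^sup>2 + 1 / (2 * \<epsilon>) * (norm (h t - k M t))\<^sup>2) \<partial>lborel)"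
      by (rule integral_mono[OF _ I3 pt]) (use ihd in auto)
    also have "\<dots> = real M * (\<integral>t. norm (d t) \<partial>lborel) + (\<epsilon> / 2 * (\<integral>t. (norm (d t))\<^sup>2 \<partial>lborel) + 1 / (2 * \<epsilon>) * (\<integral>t. (norm (h t - k M t))\<^sup>2 \<partial>lborel))"
      using id1 id2 i_hk by simp
    also have "\<dots> < r"
    proof -
      have "(\<integral>t. norm (d t) \<partial>lborel) \<le> r / (4 * (real M + 1))" using N[OF that] by (simp add: d_def)
      then have "real M * (\<integral>t. norm (d t) \<partial>lborel) \<le> real M * (r / (4 * (real M + 1)))"
        by (rule mult_left_mono) simp
      also have "\<dots> \<le> r / 4" using r by (simp add: field_simps)
      finally have a: "real M * (\<integral>t. norm (d t) \<partial>lborel) \<le> r / 4" .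
      have "\<epsilon> / 2 * (\<integral>t. (norm (d t))\<^sup>2 \<partial>lborel) \<le> \<epsilon> / 2 * (4 * S)"
        using dS \<epsilon> by (intro mult_left_mono) auto
      also have "\<dots> = (r / 2) * (S / (S + 1))"
        using S by (simp add: \<epsilon>_def field_simps)
      also have "\<dots> \<le> (r / 2) * 1" using r S by (intro mult_left_mono) auto
      finally have b: "\<epsilon> / 2 * (\<integral>t. (norm (d t))\<^sup>2 \<partial>lborel) \<le> r / 2" by simp
      have "1 / (2 * \<epsilon>) * (\<integral>t. (norm (h t - k M t))\<^sup>2 \<partial>lborel) < 1 / (2 * \<epsilon>) * (\<epsilon> * r / 2)"
        using M \<epsilon> by (intro mult_strict_left_mono) auto
      also have "\<dots> = r / 4" using \<epsilon> by simp
      finally show ?thesis using a b by linarith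
    qed
    finally show ?thesis .
  qed
  then show "\<exists>N. \<forall>n\<ge>N. norm ((\<integral>t. inner (h t) (h (Y n + t)) \<partial>lborel) - (\<integral>t. (norm (h t))\<^sup>2 \<partial>lborel)) < r"
    unfolding S_def by blast
qed

text \<open>With \<open>\<tau> = a^2 / 4\<close> the substitution \<open>s = t + a u\<close> turns
  the kernel into \<open>exp (- |u|^2)\<close>, and its Jacobian cancels the dependence of
  \<open>sqrt (pi / \<tau>)^n\<close> on \<open>a\<close>. The right side therefore has a limit as
  \<open>a\<close> tends to 0.\<close>

lemma gaussian_qft_autocorrelation:
  fixes h :: "'a::euclidean_space \<times> 'b::euclidean_space \<Rightarrow> quat"
  assumes a: "a > 0" and h1: "integrable lborel h" and h2: "integrable lborel (\<lambda>t. (norm (h t))\<^sup>2)"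
  shows "(\<integral>w. exp (- (a\<^sup>2 / 4) * (norm w)\<^sup>2) * (norm (qft h w))\<^sup>2 \<partial>lborel) =
     (2 * sqrt pi) ^ DIM('a \<times> 'b) * (\<integral>u. exp (- (norm u)\<^sup>2) * (\<integral>t. inner (h t) (h (a *\<^sub>R u + t)) \<partial>lborel) \<partial>lborel)"
proof -
  define \<tau> where "\<tau> = a\<^sup>2 / 4"
  have \<tau>: "\<tau> > 0" using a by (simp add: \<tau>_def)
  define C where "C = sqrt (pi / \<tau>) ^ DIM('a \<times> 'b)"
  have aC: "a ^ DIM('a \<times> 'b) * C = (2 * sqrt pi) ^ DIM('a \<times> 'b)"
  proof -
    have "sqrt (pi / \<tau>) = 2 * sqrt pi / a"
      using a by (intro real_sqrt_unique) (simp_all add: \<tau>_def power_divide power_mult_distrib)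
    then have "a * sqrt (pi / \<tau>) = 2 * sqrt pi" using a by simp
    then show ?thesis by (simp only: C_def power_mult_distrib[symmetric])
  qed
  have [measurable]: "h \<in> borel_measurable borel" using h1 by auto
  define S where "S = (\<integral>t. (norm (h t))\<^sup>2 \<partial>lborel)"
  note g = gaussian_qft[OF \<tau> h1]
  have "(\<integral>w. exp (- \<tau> * (norm w)\<^sup>2) * (norm (qft h w))\<^sup>2 \<partial>lborel)
     = (\<integral>t. \<integral>s. C * exp (- (norm (t - s))\<^sup>2 / (4 * \<tau>)) * inner (h t) (h s) \<partial>lborel \<partial>lborel)"
    using lborel_pair.integral_fst'[of "\<lambda>(t, s). C * exp (- (norm (t - s))\<^sup>2 / (4 * \<tau>)) * inner (h t) (h s)"]
      g(2) unfolding g(3) C_def[symmetric] lborel_prod by (simp add: case_prod_beta)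
  also have "\<dots> = (\<integral>t. a ^ DIM('a \<times> 'b) * (\<integral>u. C * exp (- (norm u)\<^sup>2) * inner (h t) (h (a *\<^sub>R u + t)) \<partial>lborel) \<partial>lborel)"
  proof (rule Bochner_Integration.integral_cong[OF refl])
    fix t :: "'a \<times> 'b"
    have "(\<integral>s. C * exp (- (norm (t - s))\<^sup>2 / (4 * \<tau>)) * inner (h t) (h s) \<partial>lborel)
      = a ^ DIM('a \<times> 'b) * (\<integral>u. C * exp (- (norm (t - (t + a *\<^sub>R u)))\<^sup>2 / (4 * \<tau>)) * inner (h t) (h (t + a *\<^sub>R u)) \<partial>lborel)"
      using a by (subst integral_affine[where c=a and t=t]) simp_all
    also have "\<dots> = a ^ DIM('a \<times> 'b) * (\<integral>u. C * exp (- (norm u)\<^sup>2) * inner (h t) (h (a *\<^sub>R u + t)) \<partial>lborel)"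
      using a by (simp add: \<tau>_def power_mult_distrib add.commute del: norm_Pair DIM_prod)
    finally show "(\<integral>s. C * exp (- (norm (t - s))\<^sup>2 / (4 * \<tau>)) * inner (h t) (h s) \<partial>lborel) =
        a ^ DIM('a \<times> 'b) * (\<integral>u. C * exp (- (norm u)\<^sup>2) * inner (h t) (h (a *\<^sub>R u + t)) \<partial>lborel)" .
  qed
  also have "\<dots> = (2 * sqrt pi) ^ DIM('a \<times> 'b) * (\<integral>t. \<integral>u. exp (- (norm u)\<^sup>2) * inner (h t) (h (a *\<^sub>R u + t)) \<partial>lborel \<partial>lborel)"
    unfolding aC[symmetric] by (simp add: mult.assoc del: DIM_prod)
  also have "(\<integral>t. \<integral>u. exp (- (norm u)\<^sup>2) * inner (h t) (h (a *\<^sub>R u + t)) \<partial>lborel \<partial>lborel)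
     = (\<integral>u. \<integral>t. exp (- (norm u)\<^sup>2) * inner (h t) (h (a *\<^sub>R u + t)) \<partial>lborel \<partial>lborel)"
  proof (rule lborel_pair.Fubini_integral)
    show "integrable (lborel \<Otimes>\<^sub>M lborel) (\<lambda>(u, t). exp (- (norm u)\<^sup>2) * inner (h t) (h (a *\<^sub>R u + t)))"
    proof (rule lborel_pair.Fubini_integrable)
      show "(\<lambda>(u, t). exp (- (norm u)\<^sup>2) * inner (h t) (h (a *\<^sub>R u + t))) \<in> borel_measurable (lborel \<Otimes>\<^sub>M lborel)"
        by measurable
      show "AE u in lborel. integrable lborel (\<lambda>t. case (u, t) of (u, t) \<Rightarrow> exp (- (norm u)\<^sup>2) * inner (h t) (h (a *\<^sub>R u + t)))"
        using autocorrelation_bounds(1)[OF _ h2] by simp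
      have e: "integrable lborel (\<lambda>u::'a \<times> 'b. exp (- (norm u)\<^sup>2) * S)"
        using gaussian_cos_sin(1)[of 1 "0 :: 'a \<times> 'b"] by (simp del: norm_Pair)
      have "integrable lborel (\<lambda>u. \<integral>t. norm (exp (- (norm u)\<^sup>2) * inner (h t) (h (a *\<^sub>R u + t))) \<partial>lborel)"
      proof (rule Bochner_Integration.integrable_bound[OF e])
        show "AE u in lborel. norm (\<integral>t. norm (exp (- (norm u)\<^sup>2) * inner (h t) (h (a *\<^sub>R u + t))) \<partial>lborel) \<le> norm (exp (- (norm u)\<^sup>2) * S)"
        proof (rule AE_I2)
          fix u :: "'a \<times> 'b"
          have "(\<integral>t. norm (exp (- (norm u)\<^sup>2) * inner (h t) (h (a *\<^sub>R u + t))) \<partial>lborel) =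
             exp (- (norm u)\<^sup>2) * (\<integral>t. \<bar>inner (h t) (h (a *\<^sub>R u + t))\<bar> \<partial>lborel)"
            by (simp add: abs_mult)
          also have "\<dots> \<le> exp (- (norm u)\<^sup>2) * S"
            unfolding S_def by (intro mult_left_mono autocorrelation_bounds h2) simp_all
          finally show "norm (\<integral>t. norm (exp (- (norm u)\<^sup>2) * inner (h t) (h (a *\<^sub>R u + t))) \<partial>lborel) \<le> norm (exp (- (norm u)\<^sup>2) * S)"
            by (simp add: S_def)
        qed
      qed measurable
      then show "integrable lborel (\<lambda>u. \<integral>t. norm (case (u, t) of (u, t) \<Rightarrow> exp (- (norm u)\<^sup>2) * inner (h t) (h (a *\<^sub>R u + t))) \<partial>lborel)"
        by simp
    qed
  qed
  finally show ?thesis by (simp add: \<tau>_def)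
qed

text \<open>The Gaussian means converge to the left side: the autocorrelation tends to its value at
  shift 0, dominated by the Gaussian times \<open>S\<close>, and
  \<open>2 sqrt pi * sqrt pi = 2 pi\<close> per dimension. Each mean is at most the right side since
  its weight is at most 1.\<close>

lemma plancherel_qft_le:
  fixes h :: "'a::euclidean_space \<times> 'b::euclidean_space \<Rightarrow> quat"
  assumes h1: "integrable lborel h" and h2: "integrable lborel (\<lambda>t. (norm (h t))\<^sup>2)"
  shows "ennreal ((2 * pi) ^ DIM('a \<times> 'b)) * (\<integral>\<^sup>+t. ennreal ((norm (h t))\<^sup>2) \<partial>lborel)
    \<le> (\<integral>\<^sup>+w. ennreal ((norm (qft h w))\<^sup>2) \<partial>lborel)"
proof -
  have [measurable]: "h \<in> borel_measurable borel" using h1 by auto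
  define S where "S = (\<integral>t. (norm (h t))\<^sup>2 \<partial>lborel)"
  define a where "a = (\<lambda>n. 1 / real (Suc n))"
  have a: "a n > 0" for n by (simp add: a_def)
  have a0: "a \<longlonglongrightarrow> 0" unfolding a_def using LIMSEQ_inverse_real_of_nat by (simp add: inverse_eq_divide)
  define J where "J = (\<lambda>n u. exp (- (norm (u :: 'a \<times> 'b))\<^sup>2) * (\<integral>t. inner (h t) (h (a n *\<^sub>R u + t)) \<partial>lborel))"
  define I where "I = (\<lambda>n. \<integral>w. exp (- ((a n)\<^sup>2 / 4) * (norm w)\<^sup>2) * (norm (qft h w))\<^sup>2 \<partial>lborel)"
  have I: "I n = (2 * sqrt pi) ^ DIM('a \<times> 'b) * (\<integral>u. J n u \<partial>lborel)" for n
    unfolding I_def J_def by (rule gaussian_qft_autocorrelation[OF a h1 h2])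
  have e: "integrable lborel (\<lambda>u::'a \<times> 'b. exp (- (norm u)\<^sup>2) * S)"
    using gaussian_cos_sin(1)[of 1 "0 :: 'a \<times> 'b"] by (simp del: norm_Pair)
  have "(\<lambda>n. \<integral>u. J n u \<partial>lborel) \<longlonglongrightarrow> (\<integral>u. exp (- (norm (u :: 'a \<times> 'b))\<^sup>2) * S \<partial>lborel)"
  proof (rule integral_dominated_convergence[OF _ _ e])
    show "(\<lambda>u. exp (- (norm (u :: 'a \<times> 'b))\<^sup>2) * S) \<in> borel_measurable lborel" by measurable
    show "J n \<in> borel_measurable lborel" for n unfolding J_def by measurable
    show "AE u in lborel. (\<lambda>n. J n u) \<longlonglongrightarrow> exp (- (norm u)\<^sup>2) * S"
    proof (rule AE_I2)
      fix u :: "'a \<times> 'b"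
      have "(\<lambda>n. a n *\<^sub>R u) \<longlonglongrightarrow> 0 *\<^sub>R u" by (intro tendsto_intros a0)
      then show "(\<lambda>n. J n u) \<longlonglongrightarrow> exp (- (norm u)\<^sup>2) * S"
        unfolding J_def S_def by (intro tendsto_intros autocorrelation_tendsto[OF h1 h2]) simp
    qed
    show "AE u in lborel. norm (J n u) \<le> exp (- (norm u)\<^sup>2) * S" for n
    proof (rule AE_I2)
      fix u :: "'a \<times> 'b"
      have "norm (J n u) = exp (- (norm u)\<^sup>2) * \<bar>\<integral>t. inner (h t) (h (a n *\<^sub>R u + t)) \<partial>lborel\<bar>"
        by (simp add: J_def abs_mult)
      also have "\<dots> \<le> exp (- (norm u)\<^sup>2) * S"
        unfolding S_def
        by (intro mult_left_mono order.trans[OF integral_abs_bound] autocorrelation_bounds(2) h2) simp_all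
      finally show "norm (J n u) \<le> exp (- (norm u)\<^sup>2) * S" .
    qed
  qed
  then have "I \<longlonglongrightarrow> (2 * sqrt pi) ^ DIM('a \<times> 'b) * (\<integral>u. exp (- (norm (u :: 'a \<times> 'b))\<^sup>2) * S \<partial>lborel)"
    unfolding I by (intro tendsto_intros)
  also have "(\<integral>u. exp (- (norm (u :: 'a \<times> 'b))\<^sup>2) * S \<partial>lborel) = sqrt pi ^ DIM('a \<times> 'b) * S"
    using gaussian_cos_sin(2)[of 1 "0 :: 'a \<times> 'b"] by (simp del: norm_Pair DIM_prod)
  also have "(2 * sqrt pi) ^ DIM('a \<times> 'b) * (sqrt pi ^ DIM('a \<times> 'b) * S) = (2 * pi) ^ DIM('a \<times> 'b) * S"
  proof -
    have "2 * pi = 2 * sqrt pi * sqrt pi" by simp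
    then show ?thesis by (simp only: power_mult_distrib mult.assoc)
  qed
  finally have lim: "(\<lambda>n. ennreal (I n)) \<longlonglongrightarrow> ennreal ((2 * pi) ^ DIM('a \<times> 'b) * S)"
    by (rule tendsto_ennrealI)
  have "ennreal (I n) \<le> (\<integral>\<^sup>+w. ennreal ((norm (qft h w))\<^sup>2) \<partial>lborel)" for n
  proof -
    have "(a n)\<^sup>2 / 4 > 0" using a[of n] by simp
    from gaussian_qft(1)[OF this h1]
    have "ennreal (I n) = (\<integral>\<^sup>+w. ennreal (exp (- ((a n)\<^sup>2 / 4) * (norm w)\<^sup>2) * (norm (qft h w))\<^sup>2) \<partial>lborel)"
      unfolding I_def by (intro nn_integral_eq_integral[symmetric]) auto
    also have "\<dots> \<le> (\<integral>\<^sup>+w. ennreal ((norm (qft h w))\<^sup>2) \<partial>lborel)"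
      by (intro nn_integral_mono ennreal_leI mult_left_le_one_le) auto
    finally show ?thesis .
  qed
  then have "ennreal ((2 * pi) ^ DIM('a \<times> 'b) * S) \<le> (\<integral>\<^sup>+w. ennreal ((norm (qft h w))\<^sup>2) \<partial>lborel)"
    by (intro LIMSEQ_le_const2[OF lim]) auto
  moreover have "(\<integral>\<^sup>+t. ennreal ((norm (h t))\<^sup>2) \<partial>lborel) = ennreal S"
    unfolding S_def by (rule nn_integral_eq_integral[OF h2]) auto
  ultimately show ?thesis
    by (simp add: ennreal_mult S_def del: DIM_prod)
qed

section \<open>Laplace bound and mass of the Wigner transform\<close>

text \<open>The slice at \<open>x\<close>: its two-sided transform in \<open>t\<close> is the Wigner
  transform at \<open>x\<close>, with the product kept between the two exponentials.\<close>

definition wigner_product :: "('a::real_vector \<Rightarrow> quat) \<Rightarrow> ('a \<Rightarrow> quat) \<Rightarrow> 'a \<Rightarrow> 'a \<Rightarrow> quat" where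
  "wigner_product f g x t = f (x + t /\<^sub>R 2) * quat_cnj (g (x - t /\<^sub>R 2))"

lemma norm_wigner_product: "norm (wigner_product f g x t) = norm (f (x + t /\<^sub>R 2)) * norm (g (x - t /\<^sub>R 2))"
  by (simp add: wigner_product_def norm_mult)

lemma borel_measurable_quat_cnj [measurable]: "quat_cnj \<in> borel_measurable borel"
proof -
  have "bounded_linear quat_cnj"
    by (rule bounded_linear_intro[where K=1])
      (simp_all add: quat_cnj_def quat_eq_iff norm_quat_def inner_quat_def)
  then show ?thesis
    by (intro borel_measurable_continuous_onI linear_continuous_on)
qed

lemma borel_measurable_wigner_product [measurable (raw)]:
  fixes f g :: "'a::euclidean_space \<Rightarrow> quat"
  assumes [measurable]: "f \<in> borel_measurable borel" "g \<in> borel_measurable borel"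
    and [measurable]: "u \<in> borel_measurable M" "v \<in> borel_measurable M"
  shows "(\<lambda>z. wigner_product f g (u z) (v z)) \<in> borel_measurable M"
  unfolding wigner_product_def by measurable

lemma integrable_norm_sq:
  fixes f :: "'a::euclidean_space \<Rightarrow> quat"
  assumes [measurable]: "f \<in> borel_measurable borel" and "(\<integral>\<^sup>+x. ennreal ((norm (f x))\<^sup>2) \<partial>lborel) < \<infinity>"
  shows "integrable lborel (\<lambda>x. (norm (f x))\<^sup>2)"
  by (rule integrableI_bounded) (use assms(2) in auto)

text \<open>A product of two L2 functions is integrable, so this holds at every \<open>x\<close>.
  Square integrability of the slice, in contrast, is obtained only for almost every
  \<open>x\<close>.\<close>

lemma integrable_wigner_product:
  fixes f g :: "'a::euclidean_space \<Rightarrow> quat"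
  assumes [measurable]: "f \<in> borel_measurable borel" "g \<in> borel_measurable borel"
    and f: "integrable lborel (\<lambda>x. (norm (f x))\<^sup>2)" and g: "integrable lborel (\<lambda>x. (norm (g x))\<^sup>2)"
  shows "integrable lborel (wigner_product f g x)"
proof -
  have "integrable lborel (\<lambda>t. (norm (f (x + (1/2) *\<^sub>R t)))\<^sup>2)" "integrable lborel (\<lambda>t. (norm (g (x + (-1/2) *\<^sub>R t)))\<^sup>2)"
    using integrable_affine[OF f, of "1/2" x] integrable_affine[OF g, of "-1/2" x] by simp_all
  then have i: "integrable lborel (\<lambda>t. (norm (f (x + (1/2) *\<^sub>R t)))\<^sup>2 + (norm (g (x + (-1/2) *\<^sub>R t)))\<^sup>2)"
    by auto
  show ?thesis
  proof (rule Bochner_Integration.integrable_bound[OF i])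
    show "wigner_product f g x \<in> borel_measurable lborel" by measurable
    have "norm (wigner_product f g x t) \<le> (norm (f (x + (1/2) *\<^sub>R t)))\<^sup>2 + (norm (g (x + (-1/2) *\<^sub>R t)))\<^sup>2" for t
    proof -
      have eq: "f (x + t /\<^sub>R 2) = f (x + (1/2) *\<^sub>R t)" "g (x - t /\<^sub>R 2) = g (x + (-1/2) *\<^sub>R t)"
        by (simp_all add: inverse_eq_divide)
      have *: "a * b \<le> a\<^sup>2 + b\<^sup>2" if "0 \<le> a" "0 \<le> b" for a b :: real
        using sum_squares_bound[of a b] mult_nonneg_nonneg[OF that] by linarith
      show ?thesis unfolding norm_wigner_product eq by (rule *) simp_all
    qed
    then show "AE t in lborel. norm (wigner_product f g x t) \<le> norm ((norm (f (x + (1/2) *\<^sub>R t)))\<^sup>2 + (norm (g (x + (-1/2) *\<^sub>R t)))\<^sup>2)"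
      by simp
  qed
qed

lemma nn_integral_wigner_product:
  fixes f g :: "'a::euclidean_space \<Rightarrow> quat"
  assumes [measurable]: "f \<in> borel_measurable borel" "g \<in> borel_measurable borel"
  shows "(\<integral>\<^sup>+x. \<integral>\<^sup>+t. ennreal ((norm (wigner_product f g x t))\<^sup>2) \<partial>lborel \<partial>lborel) =
    (\<integral>\<^sup>+x. ennreal ((norm (f x))\<^sup>2) \<partial>lborel) * (\<integral>\<^sup>+x. ennreal ((norm (g x))\<^sup>2) \<partial>lborel)"
proof -
  have "(\<integral>\<^sup>+x. \<integral>\<^sup>+t. ennreal ((norm (wigner_product f g x t))\<^sup>2) \<partial>lborel \<partial>lborel)
    = (\<integral>\<^sup>+t. \<integral>\<^sup>+x. ennreal ((norm (wigner_product f g x t))\<^sup>2) \<partial>lborel \<partial>lborel)"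
    by (rule lborel_pair.Fubini'[symmetric]) measurable
  also have "\<dots> = (\<integral>\<^sup>+x. ennreal ((norm (f x))\<^sup>2) \<partial>lborel) * (\<integral>\<^sup>+x. ennreal ((norm (g x))\<^sup>2) \<partial>lborel)"
    using nn_integral_sum_difference[of "\<lambda>x. ennreal ((norm (f x))\<^sup>2)" "\<lambda>x. ennreal ((norm (g x))\<^sup>2)"]
    by (simp add: norm_wigner_product power_mult_distrib ennreal_mult)
  finally show ?thesis .
qed

lemma nn_integral_lborel_pair:
  fixes \<Psi> :: "'a::euclidean_space \<times> 'b::euclidean_space \<Rightarrow> ennreal"
  assumes "\<Psi> \<in> borel_measurable borel"
  shows "(\<integral>\<^sup>+z. \<Psi> z \<partial>lborel) = (\<integral>\<^sup>+x. \<integral>\<^sup>+y. \<Psi> (x, y) \<partial>lborel \<partial>lborel)"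
  using lborel.nn_integral_fst[of \<Psi> lborel] assms by (simp add: lborel_prod)

definition wigner_lborel :: "('a::euclidean_space \<times> 'b::euclidean_space \<Rightarrow> quat) \<Rightarrow> ('a \<times> 'b \<Rightarrow> quat) \<Rightarrow>
    ('a \<times> 'b) \<times> ('a \<times> 'b) \<Rightarrow> quat" where
  "wigner_lborel f g = (\<lambda>(x, w). qft (wigner_product f g x) w)"

lemma borel_measurable_wigner_lborel:
  fixes f g :: "'a::euclidean_space \<times> 'b::euclidean_space \<Rightarrow> quat"
  assumes [measurable]: "f \<in> borel_measurable borel" "g \<in> borel_measurable borel"
  shows "wigner_lborel f g \<in> borel_measurable borel"
proof -
  have "(\<lambda>z. \<integral>t. qft_term (snd z) t (wigner_product f g (fst z) t) \<partial>lborel) \<in> borel_measurable (borel \<Otimes>\<^sub>M borel)"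
    by measurable
  then show ?thesis
    by (simp add: wigner_lborel_def qft_def borel_prod case_prod_beta')
qed

text \<open>The Gaussian splits into an \<open>x\<close>-factor and a \<open>w\<close>-factor, and
  \<open>gaussian_qft\<close> removes the phases at fixed \<open>x\<close>. Only then is the inner
  product replaced by norms. The constants combine as \<open>sqrt (pi / \<tau>) * 2 * sqrt (4 * pi *
  \<tau>) / (2 + \<tau>) = 4 * pi / (2 + \<tau>)\<close> per dimension.\<close>

lemma gaussian_wigner_le:
  fixes f g :: "'a::euclidean_space \<times> 'b::euclidean_space \<Rightarrow> quat"
  assumes \<tau>: "\<tau> > 0" and [measurable]: "f \<in> borel_measurable borel" "g \<in> borel_measurable borel"
    and f: "integrable lborel (\<lambda>x. (norm (f x))\<^sup>2)" and g: "integrable lborel (\<lambda>x. (norm (g x))\<^sup>2)"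
  shows "(\<integral>\<^sup>+z. ennreal (exp (- \<tau> * (norm z)\<^sup>2) * (norm (wigner_lborel f g z))\<^sup>2) \<partial>lborel)
    \<le> ennreal ((4 * pi / (2 + \<tau>)) ^ DIM('a \<times> 'b)) *
      ((\<integral>\<^sup>+x. ennreal ((norm (f x))\<^sup>2) \<partial>lborel) * (\<integral>\<^sup>+x. ennreal ((norm (g x))\<^sup>2) \<partial>lborel))"
proof -
  note [measurable] = borel_measurable_wigner_lborel[of f g]
  define C where "C = sqrt (pi / \<tau>) ^ DIM('a \<times> 'b)"
  have C: "C \<ge> 0" using \<tau> by (simp add: C_def)
  have sl: "(\<integral>\<^sup>+w. ennreal (exp (- \<tau> * (norm (x, w))\<^sup>2) * (norm (wigner_lborel f g (x, w)))\<^sup>2) \<partial>lborel) \<le>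
    ennreal C * (\<integral>\<^sup>+t. \<integral>\<^sup>+s. ennreal (exp (- \<tau> * (norm x)\<^sup>2) * (exp (- (norm (t - s))\<^sup>2 / (4 * \<tau>)) *
       ((norm (f (x + t /\<^sub>R 2)) * norm (g (x - t /\<^sub>R 2))) * (norm (f (x + s /\<^sub>R 2)) * norm (g (x - s /\<^sub>R 2)))))) \<partial>lborel \<partial>lborel)" for x
  proof -
    define h where "h = wigner_product f g x"
    have h: "integrable lborel h" unfolding h_def by (rule integrable_wigner_product[OF _ _ f g]) simp_all
    have [measurable]: "h \<in> borel_measurable borel" using h by auto
    note q = gaussian_qft[OF \<tau> h]
    define k where "k = (\<lambda>p. C * exp (- (norm (fst p - snd p))\<^sup>2 / (4 * \<tau>)) * inner (h (fst p)) (h (snd p)))"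
    define E where "E = exp (- \<tau> * (norm x)\<^sup>2)"
    have [measurable]: "(\<lambda>p::('a \<times> 'b) \<times> ('a \<times> 'b). E * (exp (- (norm (fst p - snd p))\<^sup>2 / (4 * \<tau>)) * (norm (h (fst p)) * norm (h (snd p))))) \<in> borel_measurable borel"
      (is "?k \<in> _")
      unfolding borel_prod[where 'a="'a \<times> 'b" and 'b="'a \<times> 'b", symmetric] by measurable
    have "(\<integral>\<^sup>+w. ennreal (exp (- \<tau> * (norm (x, w))\<^sup>2) * (norm (wigner_lborel f g (x, w)))\<^sup>2) \<partial>lborel)
      = (\<integral>\<^sup>+w. ennreal (E * (exp (- \<tau> * (norm w)\<^sup>2) * (norm (qft h w))\<^sup>2)) \<partial>lborel)"
    proof (rule nn_integral_cong)
      fix w :: "'a \<times> 'b"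
      have "exp (- \<tau> * (norm (x, w))\<^sup>2) = E * exp (- \<tau> * (norm w)\<^sup>2)"
        by (simp add: E_def norm_Pair exp_add[symmetric] distrib_left)
      then show "ennreal (exp (- \<tau> * (norm (x, w))\<^sup>2) * (norm (wigner_lborel f g (x, w)))\<^sup>2) =
          ennreal (E * (exp (- \<tau> * (norm w)\<^sup>2) * (norm (qft h w))\<^sup>2))"
        by (simp only: wigner_lborel_def h_def case_prod_conv mult.assoc)
    qed
    also have "\<dots> = ennreal (\<integral>w. E * (exp (- \<tau> * (norm w)\<^sup>2) * (norm (qft h w))\<^sup>2) \<partial>lborel)"
      using q(1) by (intro nn_integral_eq_integral) (auto simp: E_def simp del: norm_Pair)
    also have "(\<integral>w. E * (exp (- \<tau> * (norm w)\<^sup>2) * (norm (qft h w))\<^sup>2) \<partial>lborel) = (\<integral>p. E * k p \<partial>lborel)"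
      unfolding integral_mult_right_zero q(3) by (simp add: k_def C_def case_prod_beta' del: DIM_prod)
    also have "ennreal (\<integral>p. E * k p \<partial>lborel) \<le> (\<integral>\<^sup>+p. ennreal (norm (E * k p)) \<partial>lborel)"
    proof -
      have ik: "integrable lborel k" using q(2) by (simp add: k_def C_def case_prod_beta')
      have "(\<integral>p. E * k p \<partial>lborel) \<le> (\<integral>p. norm (E * k p) \<partial>lborel)"
        using ik by (intro integral_mono) auto
      then have "ennreal (\<integral>p. E * k p \<partial>lborel) \<le> ennreal (\<integral>p. norm (E * k p) \<partial>lborel)" by (rule ennreal_leI)
      also have "\<dots> = (\<integral>\<^sup>+p. ennreal (norm (E * k p)) \<partial>lborel)"
        using ik by (intro nn_integral_eq_integral[symmetric]) auto
      finally show ?thesis .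
    qed
    also have "\<dots> \<le> (\<integral>\<^sup>+p. ennreal C * ennreal (E * (exp (- (norm (fst p - snd p))\<^sup>2 / (4 * \<tau>)) * (norm (h (fst p)) * norm (h (snd p))))) \<partial>lborel)"
    proof (rule nn_integral_mono)
      fix p :: "('a \<times> 'b) \<times> ('a \<times> 'b)"
      have "norm (E * k p) = C * (E * (exp (- (norm (fst p - snd p))\<^sup>2 / (4 * \<tau>)) * \<bar>inner (h (fst p)) (h (snd p))\<bar>))"
        using C by (simp add: k_def E_def abs_mult)
      also have "\<dots> \<le> C * (E * (exp (- (norm (fst p - snd p))\<^sup>2 / (4 * \<tau>)) * (norm (h (fst p)) * norm (h (snd p)))))"
        using C by (intro mult_left_mono Cauchy_Schwarz_ineq2) (auto simp: E_def)
      finally show "ennreal (norm (E * k p)) \<le> ennreal C * ennreal (E * (exp (- (norm (fst p - snd p))\<^sup>2 / (4 * \<tau>)) * (norm (h (fst p)) * norm (h (snd p)))))"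
        using C by (subst ennreal_mult[symmetric]) (auto simp: E_def intro!: ennreal_leI)
    qed
    also have "\<dots> = ennreal C * (\<integral>\<^sup>+p. ennreal (E * (exp (- (norm (fst p - snd p))\<^sup>2 / (4 * \<tau>)) * (norm (h (fst p)) * norm (h (snd p))))) \<partial>lborel)"
      by (rule nn_integral_cmult) measurable
    also have "(\<integral>\<^sup>+p. ennreal (E * (exp (- (norm (fst p - snd p))\<^sup>2 / (4 * \<tau>)) * (norm (h (fst p)) * norm (h (snd p))))) \<partial>lborel)
      = (\<integral>\<^sup>+t. \<integral>\<^sup>+s. ennreal (E * (exp (- (norm (t - s))\<^sup>2 / (4 * \<tau>)) * (norm (h t) * norm (h s)))) \<partial>lborel \<partial>lborel)"
    proof -
      have "(\<lambda>p. ennreal (?k p)) \<in> borel_measurable borel" by measurable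
      from nn_integral_lborel_pair[OF this] show ?thesis by (simp only: fst_conv snd_conv)
    qed
    finally show ?thesis
      unfolding h_def E_def norm_wigner_product .
  qed
  have "(\<integral>\<^sup>+z. ennreal (exp (- \<tau> * (norm z)\<^sup>2) * (norm (wigner_lborel f g z))\<^sup>2) \<partial>lborel)
     = (\<integral>\<^sup>+x. \<integral>\<^sup>+w. ennreal (exp (- \<tau> * (norm (x, w))\<^sup>2) * (norm (wigner_lborel f g (x, w)))\<^sup>2) \<partial>lborel \<partial>lborel)"
    by (rule nn_integral_lborel_pair) measurable
  also have "\<dots> \<le> (\<integral>\<^sup>+x. ennreal C * (\<integral>\<^sup>+t. \<integral>\<^sup>+s. ennreal (exp (- \<tau> * (norm x)\<^sup>2) * (exp (- (norm (t - s))\<^sup>2 / (4 * \<tau>)) *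
       ((norm (f (x + t /\<^sub>R 2)) * norm (g (x - t /\<^sub>R 2))) * (norm (f (x + s /\<^sub>R 2)) * norm (g (x - s /\<^sub>R 2)))))) \<partial>lborel \<partial>lborel) \<partial>lborel)"
    by (intro nn_integral_mono sl)
  also have "\<dots> = ennreal C * (\<integral>\<^sup>+x. \<integral>\<^sup>+t. \<integral>\<^sup>+s. ennreal (exp (- \<tau> * (norm x)\<^sup>2) * (exp (- (norm (t - s))\<^sup>2 / (4 * \<tau>)) *
       ((norm (f (x + t /\<^sub>R 2)) * norm (g (x - t /\<^sub>R 2))) * (norm (f (x + s /\<^sub>R 2)) * norm (g (x - s /\<^sub>R 2)))))) \<partial>lborel \<partial>lborel \<partial>lborel)"
    by (rule nn_integral_cmult) measurable
  also have "\<dots> \<le> ennreal C * (ennreal (2 ^ DIM('a \<times> 'b) * (sqrt (4 * pi * \<tau>) / (2 + \<tau>)) ^ DIM('a \<times> 'b)) *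
      ((\<integral>\<^sup>+x. ennreal ((norm (f x))\<^sup>2) \<partial>lborel) * (\<integral>\<^sup>+x. ennreal ((norm (g x))\<^sup>2) \<partial>lborel)))"
    by (intro mult_left_mono gaussian_wigner_form_le[OF \<tau>]) simp_all
  also have "\<dots> = ennreal (C * (2 ^ DIM('a \<times> 'b) * (sqrt (4 * pi * \<tau>) / (2 + \<tau>)) ^ DIM('a \<times> 'b))) *
      ((\<integral>\<^sup>+x. ennreal ((norm (f x))\<^sup>2) \<partial>lborel) * (\<integral>\<^sup>+x. ennreal ((norm (g x))\<^sup>2) \<partial>lborel))"
    by (simp only: mult.assoc ennreal_mult'[OF C])
  also have "C * (2 ^ DIM('a \<times> 'b) * (sqrt (4 * pi * \<tau>) / (2 + \<tau>)) ^ DIM('a \<times> 'b)) = (4 * pi / (2 + \<tau>)) ^ DIM('a \<times> 'b)"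
  proof -
    have "sqrt (pi / \<tau>) * sqrt (4 * pi * \<tau>) = sqrt ((2 * pi)\<^sup>2)"
      unfolding real_sqrt_mult[symmetric] using \<tau> by (simp add: power2_eq_square field_simps)
    also have "\<dots> = 2 * pi" by (rule real_sqrt_unique) simp_all
    finally have "sqrt (pi / \<tau>) * (2 * (sqrt (4 * pi * \<tau>) / (2 + \<tau>))) = 4 * pi / (2 + \<tau>)"
      by (simp add: field_simps)
    then show ?thesis unfolding C_def by (simp only: power_mult_distrib[symmetric])
  qed
  finally show ?thesis .
qed

text \<open>Plancherel's inequality is applied slice by slice. By Tonelli almost every slice is
  square integrable, and the squared norms of the slices add up to the product of those of
  \<open>f\<close> and \<open>g\<close>.\<close>

lemma wigner_mass_ge:
  fixes f g :: "'a::euclidean_space \<times> 'b::euclidean_space \<Rightarrow> quat"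
  assumes [measurable]: "f \<in> borel_measurable borel" "g \<in> borel_measurable borel"
    and f: "integrable lborel (\<lambda>x. (norm (f x))\<^sup>2)" and g: "integrable lborel (\<lambda>x. (norm (g x))\<^sup>2)"
  shows "ennreal ((2 * pi) ^ DIM('a \<times> 'b)) *
      ((\<integral>\<^sup>+x. ennreal ((norm (f x))\<^sup>2) \<partial>lborel) * (\<integral>\<^sup>+x. ennreal ((norm (g x))\<^sup>2) \<partial>lborel))
    \<le> (\<integral>\<^sup>+z. ennreal ((norm (wigner_lborel f g z))\<^sup>2) \<partial>lborel)"
proof -
  note [measurable] = borel_measurable_wigner_lborel[of f g]
  have fin: "(\<integral>\<^sup>+x. \<integral>\<^sup>+t. ennreal ((norm (wigner_product f g x t))\<^sup>2) \<partial>lborel \<partial>lborel) \<noteq> \<infinity>"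
    unfolding nn_integral_wigner_product[OF assms(1,2)]
    using f g by (simp add: nn_integral_eq_integral ennreal_mult_eq_top_iff)
  have "AE x in lborel. (\<integral>\<^sup>+t. ennreal ((norm (wigner_product f g x t))\<^sup>2) \<partial>lborel) \<noteq> \<infinity>"
    by (rule nn_integral_noteq_infinite[OF _ fin]) measurable
  then have ae: "AE x in lborel. ennreal ((2 * pi) ^ DIM('a \<times> 'b)) * (\<integral>\<^sup>+t. ennreal ((norm (wigner_product f g x t))\<^sup>2) \<partial>lborel)
     \<le> (\<integral>\<^sup>+w. ennreal ((norm (wigner_lborel f g (x, w)))\<^sup>2) \<partial>lborel)"
  proof eventually_elim
    case (elim x)
    have "integrable lborel (\<lambda>t. (norm (wigner_product f g x t))\<^sup>2)"
      by (rule integrable_norm_sq) (use elim in \<open>auto simp: less_top[symmetric]\<close>)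
    then show ?case
      using plancherel_qft_le[OF integrable_wigner_product[OF _ _ f g, of x]]
      unfolding wigner_lborel_def case_prod_conv by simp
  qed
  have "ennreal ((2 * pi) ^ DIM('a \<times> 'b)) *
      ((\<integral>\<^sup>+x. ennreal ((norm (f x))\<^sup>2) \<partial>lborel) * (\<integral>\<^sup>+x. ennreal ((norm (g x))\<^sup>2) \<partial>lborel))
    = (\<integral>\<^sup>+x. ennreal ((2 * pi) ^ DIM('a \<times> 'b)) * (\<integral>\<^sup>+t. ennreal ((norm (wigner_product f g x t))\<^sup>2) \<partial>lborel) \<partial>lborel)"
    unfolding nn_integral_wigner_product[OF assms(1,2), symmetric]
    by (rule nn_integral_cmult[symmetric]) measurable
  also have "\<dots> \<le> (\<integral>\<^sup>+x. \<integral>\<^sup>+w. ennreal ((norm (wigner_lborel f g (x, w)))\<^sup>2) \<partial>lborel \<partial>lborel)"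
    by (rule nn_integral_mono_AE[OF ae])
  also have "\<dots> = (\<integral>\<^sup>+z. ennreal ((norm (wigner_lborel f g z))\<^sup>2) \<partial>lborel)"
    by (rule nn_integral_lborel_pair[symmetric]) measurable
  finally show ?thesis .
qed

section \<open>Moments and constants\<close>

text \<open>The tangent at \<open>m\<close> to a convex function. With \<open>y = x / m\<close> it
  follows from \<open>y^p = y * exp ((p - 1) * ln y) \<ge> y + (p - 1) * y * ln y\<close> and
  \<open>y * ln y \<ge> y - 1\<close>.\<close>

lemma powr_above_tangent:
  fixes p m x :: real
  assumes p: "p \<ge> 1" and m: "m > 0" and x: "x \<ge> 0"
  shows "p * m powr (p - 1) * x - (p - 1) * m powr p \<le> x powr p"
proof (cases "x = 0")
  case True
  then show ?thesis using p by simp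
next
  case False
  define y where "y = x / m"
  have y: "y > 0" and xy: "x = m * y" using x m False by (simp_all add: y_def)
  have "1 - 1 / y \<le> ln y"
    using ln_le_minus_one[of "1 / y"] y by (simp add: ln_div)
  then have "y * (1 - 1 / y) \<le> y * ln y" using y by (intro mult_left_mono) auto
  then have yl: "y - 1 \<le> y * ln y" using y by (simp add: algebra_simps)
  have "1 + (p - 1) * ln y \<le> y powr (p - 1)"
    using y by (simp add: powr_def exp_ge_add_one_self)
  then have "y * (1 + (p - 1) * ln y) \<le> y * y powr (p - 1)" using y by (intro mult_left_mono) auto
  also have "y * y powr (p - 1) = y powr p" using y by (simp add: powr_mult_base)
  finally have "y + (p - 1) * (y * ln y) \<le> y powr p" by (simp add: algebra_simps)
  moreover have "(p - 1) * (y - 1) \<le> (p - 1) * (y * ln y)" using p yl by (intro mult_left_mono) auto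
  ultimately have "p * y - (p - 1) \<le> y powr p" by (simp add: algebra_simps)
  then have "m powr p * (p * y - (p - 1)) \<le> m powr p * y powr p" by (intro mult_left_mono) auto
  moreover have "m powr p = m powr (p - 1) * m" using m by (simp add: powr_mult_base mult.commute)
  ultimately show ?thesis using m y by (simp add: xy powr_mult algebra_simps)
qed

text \<open>In the limit formula for \<open>ln_Gamma\<close>, every \<open>ln (1 + u/k)\<close> is
  at most \<open>u/k\<close>, and the harmonic number exceeds \<open>ln n\<close> by at most
  1.\<close>

lemma Gamma_plus1_ge_exp_minus:
  fixes u :: real
  assumes u: "u > 0"
  shows "exp (- u) \<le> Gamma (1 + u)"
proof -
  have "- ln u - u \<le> ln_Gamma_series u n" if n: "n \<ge> 1" for n
  proof -
    have "(\<Sum>k=1..n. ln (u / real k + 1)) \<le> (\<Sum>k=1..n. u * inverse (real k))"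
    proof (rule sum_mono)
      fix k assume "k \<in> {1..n}"
      then have "u / real k + 1 > 0" using u by (simp add: add_pos_pos)
      from ln_le_minus_one[OF this] show "ln (u / real k + 1) \<le> u * inverse (real k)"
        by (simp add: divide_inverse)
    qed
    also have "\<dots> = u * harm n" by (simp add: harm_def sum_distrib_left)
    finally have 1: "(\<Sum>k=1..n. ln (u / real k + 1)) \<le> u * harm n" .
    have "harm n - ln (real n) \<le> (1::real)"
      using euler_mascheroni_sequence_decreasing[of 1 n] n by (simp add: harm_def)
    then have "u * (harm n - ln (real n)) \<le> u * 1" using u by (intro mult_left_mono) auto
    with 1 show ?thesis by (simp add: ln_Gamma_series_def algebra_simps)
  qed
  then have "- ln u - u \<le> ln_Gamma u"
    by (intro LIMSEQ_le_const[OF ln_Gamma_real_LIMSEQ[OF u]]) blast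
  then have "u * exp (- ln u - u) \<le> u * exp (ln_Gamma u)" using u by (intro mult_left_mono) auto
  also have "u * exp (ln_Gamma u) = Gamma (1 + u)"
    using u Gamma_plus1[of u] Gamma_real_pos_exp[of u] by (simp add: nonpos_Ints_def add.commute)
  finally show ?thesis using u by (simp add: exp_diff exp_minus field_simps)
qed

text \<open>Jensen's inequality in tangent form. The linear function is replaced by
  \<open>(1 - exp (- \<tau> * x)) / \<tau>\<close>, which lies below it and is controlled by the
  Laplace bound; the loss vanishes as \<open>\<tau>\<close> tends to 0.\<close>

lemma moment_ge_of_laplace_ge_1:
  fixes X \<rho> :: "'a \<Rightarrow> real"
  assumes [measurable]: "X \<in> borel_measurable M" "\<rho> \<in> borel_measurable M"
    and X: "\<And>z. X z \<ge> 0" and \<rho>: "\<And>z. \<rho> z \<ge> 0" and N: "N \<ge> 0" and n: "n > 0" and p: "p \<ge> 1"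
    and mass: "ennreal N \<le> (\<integral>\<^sup>+z. ennreal (\<rho> z) \<partial>M)"
    and laplace: "\<And>\<tau>. \<tau> > 0 \<Longrightarrow> (\<integral>\<^sup>+z. ennreal (exp (- \<tau> * X z) * \<rho> z) \<partial>M) \<le> ennreal ((2 / (2 + \<tau>)) ^ n * N)"
  shows "ennreal ((real n / 2) powr p * N) \<le> (\<integral>\<^sup>+z. ennreal (X z powr p * \<rho> z) \<partial>M)"
proof (cases "(\<integral>\<^sup>+z. ennreal (X z powr p * \<rho> z) \<partial>M)")
  case (real a)
  \<comment> \<open>The mean suggested by the Laplace bound, whose expansion is
    \<open>1 - (n/2) * \<tau>\<close> to first order; the tangent is taken there.\<close>
  define m where "m = real n / 2"
  have m: "m > 0" using n by (simp add: m_def)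
  have bound: "N * (p * m powr p / (1 + m * \<tau>) - (p - 1) * m powr p) \<le> a"
    if \<tau>: "\<tau> > 0" and small: "(p - 1) * m powr p * \<tau> \<le> p * m powr (p - 1)" for \<tau>
  proof -
    \<comment> \<open>\<open>k * \<tau>\<close> is the slope of the tangent and \<open>c\<close>
      collects the constant terms. The lower bound on the mass can be multiplied by \<open>c\<close>
      only if \<open>c \<ge> 0\<close>, which is what \<open>small\<close> guarantees.\<close>
    define k where "k = p * m powr (p - 1) / \<tau>"
    define c where "c = k - (p - 1) * m powr p"
    have k: "k \<ge> 0" using p \<tau> by (simp add: k_def)
    have c: "c \<ge> 0" using small \<tau> by (simp add: c_def k_def field_simps)
    have pt: "c * \<rho> z \<le> X z powr p * \<rho> z + k * (exp (- \<tau> * X z) * \<rho> z)" for z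
    proof -
      have "1 - exp (- \<tau> * X z) \<le> \<tau> * X z"
        using exp_ge_add_one_self[of "- \<tau> * X z"] by simp
      then have "k * (1 - exp (- \<tau> * X z)) \<le> k * (\<tau> * X z)" using k by (rule mult_left_mono)
      also have "\<dots> = p * m powr (p - 1) * X z" using \<tau> by (simp add: k_def)
      finally have "c \<le> X z powr p + k * exp (- \<tau> * X z)"
        using powr_above_tangent[OF p m X, of z] by (simp add: c_def algebra_simps)
      then show ?thesis using mult_right_mono[OF _ \<rho>] by (fastforce simp: algebra_simps)
    qed
    have "ennreal (c * N) = ennreal c * ennreal N" using c by (simp add: ennreal_mult')
    also have "\<dots> \<le> ennreal c * (\<integral>\<^sup>+z. ennreal (\<rho> z) \<partial>M)" using mass by (intro mult_left_mono) auto
    also have "\<dots> = (\<integral>\<^sup>+z. ennreal (c * \<rho> z) \<partial>M)"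
      using c by (simp add: ennreal_mult' nn_integral_cmult)
    also have "\<dots> \<le> (\<integral>\<^sup>+z. ennreal (X z powr p * \<rho> z) + ennreal k * ennreal (exp (- \<tau> * X z) * \<rho> z) \<partial>M)"
      using k \<rho> by (intro nn_integral_mono order.trans[OF ennreal_leI[OF pt]])
        (simp add: ennreal_mult'[symmetric])
    also have "\<dots> = (\<integral>\<^sup>+z. ennreal (X z powr p * \<rho> z) \<partial>M) + ennreal k * (\<integral>\<^sup>+z. ennreal (exp (- \<tau> * X z) * \<rho> z) \<partial>M)"
      by (simp add: nn_integral_add nn_integral_cmult)
    also have "\<dots> \<le> ennreal a + ennreal k * ennreal ((2 / (2 + \<tau>)) ^ n * N)"
      unfolding real using laplace[OF \<tau>] by (intro add_left_mono mult_left_mono) auto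
    also have "\<dots> = ennreal (a + k * ((2 / (2 + \<tau>)) ^ n * N))"
      using real k N \<tau> by (simp add: ennreal_mult'[symmetric] ennreal_plus[symmetric] del: ennreal_plus)
    finally have le: "c * N \<le> a + k * ((2 / (2 + \<tau>)) ^ n * N)"
      using real k N \<tau> by (subst (asm) ennreal_le_iff) auto
    have "1 + real n * (\<tau> / 2) \<le> (1 + \<tau> / 2) ^ n"
      using \<tau> by (intro Bernoulli_inequality) auto
    then have b: "1 + m * \<tau> \<le> (1 + \<tau> / 2) ^ n" by (simp add: m_def)
    have "(2 / (2 + \<tau>)) ^ n = 1 / (1 + \<tau> / 2) ^ n"
      using \<tau> by (simp add: power_one_over[symmetric] field_simps)
    also have "\<dots> \<le> 1 / (1 + m * \<tau>)"
      using b m \<tau> by (intro divide_left_mono) (auto intro!: mult_pos_pos add_pos_pos)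
    finally have "k * (2 / (2 + \<tau>)) ^ n \<le> k * (1 / (1 + m * \<tau>))"
      using k by (rule mult_left_mono)
    then have "N * (k * (2 / (2 + \<tau>)) ^ n) \<le> N * (k * (1 / (1 + m * \<tau>)))"
      using N by (rule mult_left_mono)
    with le have "N * (c - k / (1 + m * \<tau>)) \<le> a" by (simp add: algebra_simps)
    moreover have "c - k / (1 + m * \<tau>) = p * m powr p / (1 + m * \<tau>) - (p - 1) * m powr p"
    proof -
      have pos: "1 + m * \<tau> > 0" using m \<tau> by (simp add: add_pos_pos)
      have "k - k / (1 + m * \<tau>) = k * (m * \<tau>) / (1 + m * \<tau>)"
        using pos by (simp add: field_simps)
      also have "k * (m * \<tau>) = p * (m * m powr (p - 1))" using \<tau> by (simp add: k_def)
      also have "m * m powr (p - 1) = m powr p" using m by (simp add: powr_mult_base)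
      finally show ?thesis by (simp add: c_def)
    qed
    ultimately show ?thesis by simp
  qed
  have "((\<lambda>\<tau>. N * (p * m powr p / (1 + m * \<tau>) - (p - 1) * m powr p)) \<longlongrightarrow>
      N * (p * m powr p / (1 + m * 0) - (p - 1) * m powr p)) (at_right 0)"
    by (intro tendsto_intros) auto
  moreover have "eventually (\<lambda>\<tau>. N * (p * m powr p / (1 + m * \<tau>) - (p - 1) * m powr p) \<le> a) (at_right 0)"
  proof -
    have "((\<lambda>\<tau>. (p - 1) * m powr p * \<tau>) \<longlongrightarrow> (p - 1) * m powr p * 0) (at_right 0)"
      by (intro tendsto_intros)
    then have "eventually (\<lambda>\<tau>. (p - 1) * m powr p * \<tau> < p * m powr (p - 1)) (at_right 0)"
      by (rule order_tendstoD(2)) (use p m in simp)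
    moreover have "eventually (\<lambda>\<tau>. \<tau> > (0::real)) (at_right 0)"
      by (simp add: eventually_at_right_less)
    ultimately show ?thesis
      by eventually_elim (intro bound, simp_all)
  qed
  ultimately have "N * (p * m powr p / (1 + m * 0) - (p - 1) * m powr p) \<le> a"
    by (intro tendsto_upperbound[of _ _ "at_right (0::real)"]) auto
  then have "m powr p * N \<le> a" by (simp add: algebra_simps)
  then show ?thesis unfolding real m_def by (rule ennreal_leI)
qed simp

text \<open>Rests on \<open>1 \<le> x^p + exp (- x)\<close>: for \<open>x \<le> 1\<close> one has
  \<open>x^p \<ge> x \<ge> 1 - exp (- x)\<close>, and beyond 1 the power alone is at least
  1.\<close>

lemma moment_ge_of_laplace_le_1:
  fixes X \<rho> :: "'a \<Rightarrow> real"
  assumes [measurable]: "X \<in> borel_measurable M" "\<rho> \<in> borel_measurable M"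
    and X: "\<And>z. X z \<ge> 0" and \<rho>: "\<And>z. \<rho> z \<ge> 0" and N: "N \<ge> 0" and p: "0 < p" "p \<le> 1"
    and mass: "ennreal N \<le> (\<integral>\<^sup>+z. ennreal (\<rho> z) \<partial>M)"
    and laplace: "(\<integral>\<^sup>+z. ennreal (exp (- X z) * \<rho> z) \<partial>M) \<le> ennreal (l * N)" and l: "l \<ge> 0"
  shows "ennreal ((1 - l) * N) \<le> (\<integral>\<^sup>+z. ennreal (X z powr p * \<rho> z) \<partial>M)"
proof (cases "(\<integral>\<^sup>+z. ennreal (X z powr p * \<rho> z) \<partial>M)")
  case (real a)
  have pt: "\<rho> z \<le> X z powr p * \<rho> z + exp (- X z) * \<rho> z" for z
  proof -
    have "1 \<le> X z powr p + exp (- X z)"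
    proof (cases "X z \<le> 1")
      case True
      have "X z \<le> X z powr p"
        using powr_mono'[of p 1 "X z"] X[of z] True p by (cases "X z = 0") auto
      then show ?thesis using exp_ge_add_one_self[of "- X z"] by simp
    next
      case False
      then have "1 \<le> X z powr p" using p by (intro ge_one_powr_ge_zero) auto
      then show ?thesis using exp_ge_zero[of "- X z"] by linarith
    qed
    from mult_right_mono[OF this \<rho>[of z]] show ?thesis by (simp add: algebra_simps)
  qed
  have "ennreal N \<le> (\<integral>\<^sup>+z. ennreal (\<rho> z) \<partial>M)" by (rule mass)
  also have "\<dots> \<le> (\<integral>\<^sup>+z. ennreal (X z powr p * \<rho> z) + ennreal (exp (- X z) * \<rho> z) \<partial>M)"
    using \<rho> by (intro nn_integral_mono order.trans[OF ennreal_leI[OF pt]]) simp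
  also have "\<dots> = (\<integral>\<^sup>+z. ennreal (X z powr p * \<rho> z) \<partial>M) + (\<integral>\<^sup>+z. ennreal (exp (- X z) * \<rho> z) \<partial>M)"
    by (rule nn_integral_add) measurable
  also have "\<dots> \<le> ennreal a + ennreal (l * N)"
    unfolding real using laplace by (intro add_left_mono) auto
  also have "\<dots> = ennreal (a + l * N)" using real l N by simp
  finally have "N \<le> a + l * N" using real l N by (subst (asm) ennreal_le_iff) auto
  then have "(1 - l) * N \<le> a" by (simp add: algebra_simps)
  then show ?thesis unfolding real by (rule ennreal_leI)
qed simp

section \<open>Comparison with the constant of the theorem\<close>

text \<open>The share of the exponent \<open>p\<close> in \<open>E\<close>, so that the weighted
  geometric mean over \<open>p\<close> and \<open>q\<close> rebuilds \<open>E\<close> up to its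
  bracket and the powers of 2.\<close>

definition moment_const :: "real \<Rightarrow> real \<Rightarrow> real" where
  "moment_const d p = exp (- 1) * (Gamma (1 + d) / Gamma (1 + d / p)) powr (p / d)"

lemma moment_const_pos: "d > 0 \<Longrightarrow> p > 0 \<Longrightarrow> moment_const d p > 0"
  by (simp add: moment_const_def Gamma_real_pos add_pos_pos less_imp_neq[symmetric])

text \<open>Numerator \<open>k! \<le> k^k\<close>, denominator at least \<open>exp (- k/p)\<close>.
  Under the power \<open>p/k\<close> the latter contributes a factor \<open>exp 1\<close>, which
  cancels the \<open>exp (- 1)\<close>.\<close>

lemma moment_const_le_ge_1:
  assumes "k > 0" and p: "p \<ge> 1"
  shows "moment_const (real k) p \<le> real k powr p"
proof -
  define d where "d = real k"
  have d: "d \<ge> 1" using assms by (simp add: d_def)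
  have G: "Gamma (1 + d / p) > 0" using d p by (intro Gamma_real_pos add_pos_nonneg) auto
  have "Gamma (1 + d) = fact k" by (simp add: d_def Gamma_fact)
  also have "\<dots> \<le> d ^ k" using fact_le_power[of k, where 'a=real] by (simp add: d_def)
  also have "\<dots> = d powr d" using d by (simp add: d_def powr_realpow)
  finally have "Gamma (1 + d) / Gamma (1 + d / p) \<le> d powr d / exp (- (d / p))"
    using Gamma_plus1_ge_exp_minus[of "d / p"] d p G by (intro frac_le) auto
  then have "(Gamma (1 + d) / Gamma (1 + d / p)) powr (p / d) \<le> (d powr d / exp (- (d / p))) powr (p / d)"
    using d p G Gamma_real_pos[of "1 + d"] by (intro powr_mono2) auto
  also have "\<dots> = d powr p * exp 1"
  proof -
    have "d powr d / exp (- (d / p)) = d powr d * exp (d / p)"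
      by (simp add: exp_minus divide_inverse)
    then have "(d powr d / exp (- (d / p))) powr (p / d) = d powr (d * (p / d)) * exp (d / p * (p / d))"
      by (simp only: powr_mult powr_powr exp_powr_real)
    then show ?thesis using d p by simp
  qed
  finally have "moment_const d p \<le> exp (- 1) * (d powr p * exp 1)"
    unfolding moment_const_def by (intro mult_left_mono) auto
  also have "\<dots> = d powr p" by (simp add: exp_minus)
  finally show ?thesis by (simp add: d_def)
qed

text \<open>Here \<open>d / p \<ge> d \<ge> 1\<close>, where Gamma increases, so the quotient is at
  most 1 and \<open>exp (- 1) \<le> 1/2\<close> suffices. The number \<open>5/9\<close> is
  \<open>1 - (2/3)^2\<close>, the smallest value of \<open>1 - (2/3)^n\<close> for
  \<open>n \<ge> 2\<close>.\<close>

lemma moment_const_le_le_1: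
  assumes "k > 0" and p: "0 < p" "p \<le> 1"
  shows "moment_const (real k) p \<le> 5 / 9"
proof -
  define d where "d = real k"
  have d: "d \<ge> 1" using assms by (simp add: d_def)
  have "d \<le> d / p" using d p by (simp add: field_simps)
  then have "Gamma (1 + d) \<le> Gamma (1 + d / p)"
    using Gamma_real_strict_mono[of "1 + d" "1 + d / p"] d by (cases "d = d / p") auto
  moreover have G: "Gamma (1 + d) > 0" using d by (intro Gamma_real_pos) auto
  ultimately have "(Gamma (1 + d) / Gamma (1 + d / p)) powr (p / d) \<le> 1"
    using d p by (intro powr_le1) (auto simp: divide_le_eq)
  then have "moment_const d p \<le> exp (- 1) * 1"
    unfolding moment_const_def by (intro mult_left_mono) auto
  also have "\<dots> \<le> 5 / 9"
    using exp_ge_add_one_self[of 1] by (simp add: exp_minus field_simps)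
  finally show ?thesis by (simp add: d_def)
qed

text \<open>An identity except for the bracket \<open>B\<close>. Both weights turn the exponents
  \<open>p / d\<close> and \<open>q / d\<close> into \<open>s / d\<close> with
  \<open>s = p * q / (p + q)\<close>, and the factors \<open>p\<close>, \<open>q\<close> in the
  logarithm are absorbed by \<open>\<Gamma>(1 + x) = x * \<Gamma>(x)\<close>.\<close>

lemma constant_bound:
  fixes p q d :: real
  assumes p: "p > 0" and q: "q > 0" and d: "d > 0"
  shows "(4 powr (- (p * q / (p + q))))\<^sup>2 * (inverse ((p / q) powr (q / (p + q)) + (q / p) powr (p / (p + q))) *
        exp (p * q * (2 * d * ln 2 +
               ln (2 powr (2 * d) * p * q * (Gamma d)\<^sup>2 / (Gamma (d / p) * Gamma (d / q)))) /
             (d * (p + q)) - 1))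
    \<le> moment_const d p powr (q / (p + q)) * moment_const d q powr (p / (p + q))"
proof -
  define G where "G = Gamma (1 + d)"
  define Gp where "Gp = Gamma (1 + d / p)"
  define Gq where "Gq = Gamma (1 + d / q)"
  have pos: "G > 0" "Gp > 0" "Gq > 0"
    using p q d by (auto simp: G_def Gp_def Gq_def intro!: Gamma_real_pos add_pos_pos)
  have not0: "x \<notin> \<int>\<^sub>\<le>\<^sub>0" if "x > 0" for x :: real
    using that by (auto elim!: nonpos_Ints_cases)
  have gp: "G = d * Gamma d" "Gp = d / p * Gamma (d / p)" "Gq = d / q * Gamma (d / q)"
    using p q d Gamma_plus1[of d] Gamma_plus1[of "d / p"] Gamma_plus1[of "d / q"]
    by (simp_all add: G_def Gp_def Gq_def not0 add.commute)
  have pos': "Gamma d > 0" "Gamma (d / p) > 0" "Gamma (d / q) > 0"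
    using p q d by (auto intro!: Gamma_real_pos)
  have "2 powr (2 * d) * p * q * (Gamma d)\<^sup>2 / (Gamma (d / p) * Gamma (d / q)) = 2 powr (2 * d) * (G\<^sup>2 / (Gp * Gq))"
    unfolding gp using p q d pos' by (simp add: field_simps power2_eq_square)
  then have K: "ln (2 powr (2 * d) * p * q * (Gamma d)\<^sup>2 / (Gamma (d / p) * Gamma (d / q)))
      = 2 * d * ln 2 + (2 * ln G - ln Gp - ln Gq)"
    using pos by (simp add: ln_mult ln_div ln_powr ln_realpow)
  define B where "B = (p / q) powr (q / (p + q)) + (q / p) powr (p / (p + q))"
  \<comment> \<open>One of \<open>p / q\<close> and \<open>q / p\<close> is at least 1, and so is
    its power.\<close>
  have B: "B \<ge> 1"
  proof (cases "p \<ge> q")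
    case True
    then have "(p / q) powr (q / (p + q)) \<ge> 1" using p q by (intro ge_one_powr_ge_zero) auto
    then show ?thesis unfolding B_def using powr_ge_zero[of "q / p" "p / (p + q)"] by linarith
  next
    case False
    then have "(q / p) powr (p / (p + q)) \<ge> 1" using p q by (intro ge_one_powr_ge_zero) auto
    then show ?thesis unfolding B_def using powr_ge_zero[of "p / q" "q / (p + q)"] by linarith
  qed
  define s where "s = p * q / (p + q)"
  define L where "L = 2 * ln G - ln Gp - ln Gq"
  have ln4: "ln (4::real) = 2 * ln 2" using ln_realpow[of 2 2] by simp
  have "(4 powr (- s))\<^sup>2 = exp (- 4 * s * ln 2)"
    by (simp add: powr_def power2_eq_square exp_add[symmetric] ln4)
  \<comment> \<open>The explicit \<open>2 * d * ln 2\<close> and the one from the logarithm add up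
    to \<open>4 * s * ln 2\<close>, which cancels the squared prefactor.\<close>
  moreover have "p * q * (2 * d * ln 2 + (2 * d * ln 2 + L)) / (d * (p + q)) - 1 = 4 * s * ln 2 + (s / d * L - 1)"
  proof -
    have "p * q * (2 * d * ln 2 + (2 * d * ln 2 + L)) / (d * (p + q)) = s / d * (d * (4 * ln 2) + L)"
      by (simp add: s_def mult_ac)
    also have "\<dots> = s / d * (d * (4 * ln 2)) + s / d * L"
      by (rule distrib_left)
    finally have "p * q * (2 * d * ln 2 + (2 * d * ln 2 + L)) / (d * (p + q)) = s / d * (d * (4 * ln 2)) + s / d * L" .
    then show ?thesis using d by simp
  qed
  ultimately have lhs: "(4 powr (- s))\<^sup>2 * exp (p * q * (2 * d * ln 2 + (2 * d * ln 2 + L)) / (d * (p + q)) - 1)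
      = exp (s / d * L - 1)"
    by (simp add: exp_add[symmetric])
  have mc: "moment_const d p = exp (- 1 + p / d * (ln G - ln Gp))" "moment_const d q = exp (- 1 + q / d * (ln G - ln Gq))"
    unfolding moment_const_def G_def[symmetric] Gp_def[symmetric] Gq_def[symmetric]
    using pos by (simp_all add: powr_def ln_div exp_add[symmetric])
  have "moment_const d p powr (q / (p + q)) * moment_const d q powr (p / (p + q))
     = exp (q / (p + q) * (- 1 + p / d * (ln G - ln Gp)) + p / (p + q) * (- 1 + q / d * (ln G - ln Gq)))"
    unfolding mc by (simp add: powr_def exp_add)
  also have "q / (p + q) * (- 1 + p / d * (ln G - ln Gp)) + p / (p + q) * (- 1 + q / d * (ln G - ln Gq)) = s / d * L - 1"
  proof -
    have "p + q \<noteq> 0" using p q by simp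
    then have "q / (p + q) + p / (p + q) = 1" by (simp add: add_divide_distrib[symmetric] add.commute)
    moreover have "q / (p + q) * (p / d * (ln G - ln Gp)) = s / d * (ln G - ln Gp)"
      "p / (p + q) * (q / d * (ln G - ln Gq)) = s / d * (ln G - ln Gq)"
      by (simp_all add: s_def)
    moreover have "s / d * L = s / d * (ln G - ln Gp) + s / d * (ln G - ln Gq)"
      unfolding distrib_left[symmetric] by (simp add: L_def)
    ultimately show ?thesis unfolding distrib_left by linarith
  qed
  finally have rhs: "moment_const d p powr (q / (p + q)) * moment_const d q powr (p / (p + q)) = exp (s / d * L - 1)" .
  have "(4 powr (- s))\<^sup>2 * (inverse B * exp (p * q * (2 * d * ln 2 + (2 * d * ln 2 + L)) / (d * (p + q)) - 1))
     = inverse B * exp (s / d * L - 1)"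
    using lhs by (metis mult.left_commute)
  also have "\<dots> \<le> 1 * exp (s / d * L - 1)"
    using B by (intro mult_right_mono inverse_le_1_iff[THEN iffD2]) auto
  finally show ?thesis
    unfolding K rhs B_def s_def L_def by simp
qed

section \<open>The uncertainty inequality\<close>

text \<open>Substitution and Fubini above are stated for Borel functions, whereas members of
  \<open>L2\<close> are only Lebesgue measurable. The real-valued case is applied in each
  coordinate.\<close>

lemma lebesgue_measurable_ex_borel:
  fixes f :: "'a::euclidean_space \<Rightarrow> 'b::euclidean_space"
  assumes f: "f \<in> borel_measurable lebesgue"
  obtains f' where "f' \<in> borel_measurable borel" "AE x in lborel. f x = f' x"
proof -
  have "\<exists>k\<in>borel_measurable lborel. AE x in lborel. inner (f x) b = k x" for b
    using f by (intro completion_ex_borel_measurable_real) simp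
  then obtain k where k: "\<And>b. k b \<in> borel_measurable lborel" "\<And>b. AE x in lborel. inner (f x) b = k b x"
    by metis
  define f' where "f' = (\<lambda>x. \<Sum>b\<in>Basis. k b x *\<^sub>R b)"
  have "AE x in lborel. \<forall>b\<in>Basis. inner (f x) b = k b x"
    using k(2) by (subst AE_ball_countable) (auto intro: countable_finite)
  then have "AE x in lborel. f x = f' x"
  proof eventually_elim
    case (elim x)
    have "f x = (\<Sum>b\<in>Basis. inner (f x) b *\<^sub>R b)" by (rule euclidean_representation[symmetric])
    also have "\<dots> = f' x" unfolding f'_def using elim by (intro sum.cong) auto
    finally show ?case .
  qed
  moreover have "f' \<in> borel_measurable borel"
    using k(1) by (auto simp: f'_def)
  ultimately show thesis by (rule that[rotated])
qed

lemma nn_integral_mu: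
  fixes F :: "'a::euclidean_space \<Rightarrow> ennreal"
  assumes "F \<in> borel_measurable borel"
  shows "(\<integral>\<^sup>+x. F x \<partial>mu) = ennreal (1 / (2 * pi) powr (real DIM('a) / 2)) * (\<integral>\<^sup>+x. F x \<partial>lborel)"
  using assms unfolding mu_def
  by (simp add: nn_integral_density nn_integral_cmult measurable_completion nn_integral_completion)

lemma AE_mu: "(AE x in lborel. P x) \<Longrightarrow> AE x in mu. P x"
  unfolding mu_def by (subst AE_density) (auto intro: AE_completion elim: eventually_mono)

lemma measurable_mu [simp]: "borel_measurable mu = borel_measurable lebesgue"
  by (simp add: mu_def cong: measurable_cong_sets)

lemma integral_mu_AE:
  fixes F F' :: "'a::euclidean_space \<Rightarrow> quat"
  assumes F': "F' \<in> borel_measurable borel" and ae: "AE x in lborel. F x = F' x"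
  shows "(\<integral>x. F x \<partial>mu) = (1 / (2 * pi) powr (real DIM('a) / 2)) *\<^sub>R (\<integral>x. F' x \<partial>lborel)"
proof -
  have L: "F' \<in> borel_measurable lebesgue" using F' by (simp add: measurable_completion)
  have "AE x in lebesgue. F' x = F x" using ae by (intro AE_completion) (auto elim: eventually_mono)
  then have "F \<in> borel_measurable lebesgue" using borel_measurable_AE[OF L] by blast
  then have "(\<integral>x. F x \<partial>mu) = (\<integral>x. F' x \<partial>mu)"
    using L AE_mu[OF ae] by (intro integral_cong_AE) simp_all
  also have "\<dots> = (1 / (2 * pi) powr (real DIM('a) / 2)) *\<^sub>R (\<integral>x. F' x \<partial>lborel)"
    using L F' unfolding mu_def by (subst integral_density) (simp_all add: integral_completion)
  finally show ?thesis .
qed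

text \<open>Equality holds at every \<open>z\<close>, not just almost everywhere: for fixed
  \<open>x\<close> the exceptional sets of \<open>f\<close> and \<open>g\<close> give a null set of
  \<open>t\<close>, which the integral ignores.\<close>

lemma quat_wigner_eq:
  fixes f g f' g' :: "(real^'d) \<times> (real^'d) \<Rightarrow> quat"
  assumes [measurable]: "f' \<in> borel_measurable borel" "g' \<in> borel_measurable borel"
    and f: "AE x in lborel. f x = f' x" and g: "AE x in lborel. g x = g' x"
  shows "quat_wigner f g z = (1 / (2 * pi) ^ CARD('d)) *\<^sub>R wigner_lborel f' g' z"
proof -
  obtain x w where z: "z = (x, w)" by (cases z)
  have "AE t in lborel. f (x + (1/2) *\<^sub>R t) = f' (x + (1/2) *\<^sub>R t)" "AE t in lborel. g (x + (-1/2) *\<^sub>R t) = g' (x + (-1/2) *\<^sub>R t)"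
    using AE_lborel_affine[OF f, of "1/2" x] AE_lborel_affine[OF g, of "-1/2" x] by simp_all
  then have ae: "AE t in lborel. exp (- (inner (fst w) (fst t) *\<^sub>R quat_i)) * f (x + t /\<^sub>R 2) *
         quat_cnj (g (x - t /\<^sub>R 2)) * exp (- (inner (snd w) (snd t) *\<^sub>R quat_j))
      = qft_term w t (wigner_product f' g' x t)"
    by eventually_elim (simp add: qft_term_def wigner_product_def mult.assoc inverse_eq_divide)
  have "real DIM((real^'d) \<times> (real^'d)) / 2 = real CARD('d)" by simp
  then have c: "(2 * pi) powr (real DIM((real^'d) \<times> (real^'d)) / 2) = (2 * pi) ^ CARD('d)"
    by (simp only:) (simp add: powr_realpow)
  have "quat_wigner f g z = (1 / (2 * pi) powr (real DIM((real^'d) \<times> (real^'d)) / 2)) *\<^sub>R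
     (\<integral>t. qft_term w t (wigner_product f' g' x t) \<partial>lborel)"
    unfolding z quat_wigner_def case_prod_conv by (rule integral_mu_AE[OF _ ae]) measurable
  then show ?thesis unfolding c by (simp add: z wigner_lborel_def qft_def)
qed

lemma norm2_L2:
  fixes f f' :: "(real^'d) \<times> (real^'d) \<Rightarrow> quat"
  assumes [measurable]: "f' \<in> borel_measurable borel" and ae: "AE x in lborel. f x = f' x"
    and L2: "f \<in> L2"
  obtains F where "F \<ge> 0" "norm2 f = ennreal (sqrt F)"
    "(\<integral>\<^sup>+x. ennreal ((norm (f' x))\<^sup>2) \<partial>lborel) = ennreal ((2 * pi) ^ CARD('d) * F)"
proof -
  define I where "I = (\<integral>\<^sup>+x. ennreal ((norm (f x))\<^sup>2) \<partial>mu)"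
  have "norm2 f = ennreal_powr I (1/2)" by (simp add: norm2_def I_def)
  moreover have "norm2 f < \<infinity>" using L2 by (simp add: L2_def)
  ultimately have "I \<noteq> \<infinity>" by (auto simp: ennreal_powr_def)
  then obtain F where F: "F \<ge> 0" "I = ennreal F" by (cases I) auto
  have "norm2 f = ennreal (sqrt F)"
    using F by (simp add: \<open>norm2 f = ennreal_powr I (1/2)\<close> ennreal_powr_def powr_half_sqrt)
  moreover have "(\<integral>\<^sup>+x. ennreal ((norm (f' x))\<^sup>2) \<partial>lborel) = ennreal ((2 * pi) ^ CARD('d) * F)"
  proof -
    define c where "c = (2 * pi) ^ CARD('d)"
    have c: "c > 0" by (simp add: c_def)
    have "real DIM((real^'d) \<times> (real^'d)) / 2 = real CARD('d)" by simp
    then have c': "(2 * pi) powr (real DIM((real^'d) \<times> (real^'d)) / 2) = c"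
      unfolding c_def by (simp only:) (simp add: powr_realpow)
    have "I = (\<integral>\<^sup>+x. ennreal ((norm (f' x))\<^sup>2) \<partial>mu)"
      unfolding I_def using AE_mu[OF ae] by (intro nn_integral_cong_AE) (auto elim: eventually_mono)
    also have "\<dots> = ennreal (1 / c) * (\<integral>\<^sup>+x. ennreal ((norm (f' x))\<^sup>2) \<partial>lborel)"
      unfolding c'[symmetric] by (rule nn_integral_mu) measurable
    finally have "ennreal c * ennreal F = (ennreal c * ennreal (1 / c)) * (\<integral>\<^sup>+x. ennreal ((norm (f' x))\<^sup>2) \<partial>lborel)"
      unfolding F(2) by (simp only: mult.assoc)
    also have "ennreal c * ennreal (1 / c) = 1"
      using c by (simp add: ennreal_mult'[symmetric])
    finally show ?thesis using c F(1) by (simp add: c_def ennreal_mult')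
  qed
  ultimately show thesis using F(1) that by blast
qed

section \<open>Moments of the Wigner transform\<close>

lemma wigner_lborel_moment_ge:
  fixes f g :: "(real^'d) \<times> (real^'d) \<Rightarrow> quat"
  assumes [measurable]: "f \<in> borel_measurable borel" "g \<in> borel_measurable borel"
    and A: "(\<integral>\<^sup>+x. ennreal ((norm (f x))\<^sup>2) \<partial>lborel) = ennreal A" "A \<ge> 0"
    and B: "(\<integral>\<^sup>+x. ennreal ((norm (g x))\<^sup>2) \<partial>lborel) = ennreal B" "B \<ge> 0"
    and p: "p > 0"
  shows "ennreal (moment_const (real CARD('d)) p * ((2 * pi) ^ (2 * CARD('d)) * (A * B)))
    \<le> (\<integral>\<^sup>+z. ennreal (((norm z)\<^sup>2) powr p * (norm (wigner_lborel f g z))\<^sup>2) \<partial>lborel)"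
proof -
  note [measurable] = borel_measurable_wigner_lborel[of f g]
  define n where "n = 2 * CARD('d)"
  have n: "n \<ge> 2" unfolding n_def using zero_less_card_finite[where 'a='d] by linarith
  define N where "N = (2 * pi) ^ n * (A * B)"
  have N: "N \<ge> 0" using A B by (simp add: N_def)
  have dim: "DIM((real^'d) \<times> (real^'d)) = n" by (simp add: n_def)
  have f: "integrable lborel (\<lambda>x. (norm (f x))\<^sup>2)" and g: "integrable lborel (\<lambda>x. (norm (g x))\<^sup>2)"
    by (rule integrable_norm_sq; simp add: A B)+
  have mass: "ennreal N \<le> (\<integral>\<^sup>+z. ennreal ((norm (wigner_lborel f g z))\<^sup>2) \<partial>lborel)"
    using wigner_mass_ge[OF assms(1,2) f g] A(2) B(2)
    unfolding A(1) B(1) dim N_def by (simp add: ennreal_mult)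
  have laplace: "(\<integral>\<^sup>+z. ennreal (exp (- \<tau> * (norm z)\<^sup>2) * (norm (wigner_lborel f g z))\<^sup>2) \<partial>lborel)
      \<le> ennreal ((2 / (2 + \<tau>)) ^ n * N)" if "\<tau> > 0" for \<tau>
  proof -
    \<comment> \<open>Splits off the \<open>2 * pi\<close> per dimension that belongs to the mass
      \<open>N\<close>, leaving the normalised Laplace factor.\<close>
    have "4 * pi / (2 + \<tau>) = 2 / (2 + \<tau>) * (2 * pi)" by simp
    then have "(4 * pi / (2 + \<tau>)) ^ n = (2 / (2 + \<tau>)) ^ n * (2 * pi) ^ n"
      by (simp only: power_mult_distrib)
    then have "ennreal ((4 * pi / (2 + \<tau>)) ^ n) * (ennreal A * ennreal B) = ennreal ((2 / (2 + \<tau>)) ^ n * N)"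
      using A(2) B(2) that by (simp add: N_def ennreal_mult'[symmetric] mult.assoc)
    then show ?thesis
      using gaussian_wigner_le[OF that assms(1,2) f g] unfolding A(1) B(1) dim by simp
  qed
  have "ennreal (moment_const (real CARD('d)) p * N)
    \<le> (\<integral>\<^sup>+z. ennreal (((norm z)\<^sup>2) powr p * (norm (wigner_lborel f g z))\<^sup>2) \<partial>lborel)"
  proof (cases "p \<ge> 1")
    case True
    have "moment_const (real CARD('d)) p * N \<le> (real n / 2) powr p * N"
      using moment_const_le_ge_1[OF _ True, of "CARD('d)"] N by (intro mult_right_mono) (simp_all add: n_def)
    then show ?thesis
      using n N by (intro order.trans[OF ennreal_leI moment_ge_of_laplace_ge_1[OF _ _ _ _ N _ True mass laplace]]) auto
  next
    case False
    then have p1: "p \<le> 1" by simp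
    \<comment> \<open>The Laplace factor at \<open>\<tau> = 1\<close> is \<open>(2/3)^n\<close>; as
      the dimension \<open>n\<close> is even and positive, \<open>n = 2\<close> is the worst
      case.\<close>
    have "(2/3) ^ n \<le> (2/3 :: real) ^ 2" using n by (intro power_decreasing) auto
    then have l: "5 / 9 \<le> 1 - (2/3 :: real) ^ n" by (simp add: power2_eq_square)
    have "moment_const (real CARD('d)) p * N \<le> (1 - (2/3) ^ n) * N"
      using moment_const_le_le_1[OF _ p p1, of "CARD('d)"] l N by (intro mult_right_mono) simp_all
    moreover have "(\<integral>\<^sup>+z. ennreal (exp (- ((norm (z :: ((real^'d) \<times> (real^'d)) \<times> ((real^'d) \<times> (real^'d))))\<^sup>2)) * (norm (wigner_lborel f g z))\<^sup>2) \<partial>lborel)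
        \<le> ennreal ((2/3) ^ n * N)"
      using laplace[of 1] by simp
    ultimately show ?thesis
      using N by (intro order.trans[OF ennreal_leI moment_ge_of_laplace_le_1[where l="(2/3) ^ n", OF _ _ _ _ N p p1 mass]]) auto
  qed
  then show ?thesis by (simp add: N_def n_def)
qed

lemma ennreal_powr_ge:
  assumes "ennreal x \<le> I" "x \<ge> 0" "r > 0"
  shows "ennreal (x powr r) \<le> ennreal_powr I r"
proof (cases I)
  case (real y)
  then have "x \<le> y" using assms by (simp add: ennreal_le_iff)
  then show ?thesis using real assms by (simp add: ennreal_powr_def powr_mono2 ennreal_leI)
qed (simp add: ennreal_powr_def)

lemma norm2_wigner_moment_ge:
  fixes f g :: "(real^'d) \<times> (real^'d) \<Rightarrow> quat"
  assumes [measurable]: "f' \<in> borel_measurable borel" "g' \<in> borel_measurable borel"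
    and f: "AE x in lborel. f x = f' x" and g: "AE x in lborel. g x = g' x"
    and F: "(\<integral>\<^sup>+x. ennreal ((norm (f' x))\<^sup>2) \<partial>lborel) = ennreal ((2 * pi) ^ CARD('d) * F)" "F \<ge> 0"
    and G: "(\<integral>\<^sup>+x. ennreal ((norm (g' x))\<^sup>2) \<partial>lborel) = ennreal ((2 * pi) ^ CARD('d) * G)" "G \<ge> 0"
    and p: "p > 0" and r: "r > 0"
  shows "ennreal ((moment_const (real CARD('d)) p * (F * G)) powr (r / 2))
    \<le> ennreal_powr (norm2 (\<lambda>z. norm z powr p *\<^sub>R quat_wigner f g z)) r"
proof -
  note [measurable] = borel_measurable_wigner_lborel[of f' g']
  define c where "c = (2 * pi) ^ CARD('d)"
  have c: "c > 0" by (simp add: c_def)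
  have dim: "real DIM(((real^'d) \<times> (real^'d)) \<times> ((real^'d) \<times> (real^'d))) / 2 = real (CARD('d) * 2)" by simp
  have c2: "(2 * pi) powr (real DIM(((real^'d) \<times> (real^'d)) \<times> ((real^'d) \<times> (real^'d))) / 2) = c\<^sup>2"
    unfolding c_def power_mult[symmetric] dim by (rule powr_realpow) simp
  define \<rho> where "\<rho> = (\<lambda>z. ((norm z)\<^sup>2) powr p * (norm (wigner_lborel f' g' z))\<^sup>2)"
  have [measurable]: "\<rho> \<in> borel_measurable borel" unfolding \<rho>_def by measurable
  have \<rho>0: "\<rho> z \<ge> 0" for z by (simp add: \<rho>_def)
  have pt: "(norm (norm z powr p *\<^sub>R quat_wigner f g z))\<^sup>2 = 1 / c\<^sup>2 * \<rho> z" for z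
  proof -
    have "((norm z)\<^sup>2) powr p = (norm z powr p)\<^sup>2"
      by (simp add: power2_eq_square powr_mult)
    then show ?thesis
      unfolding quat_wigner_eq[OF assms(1,2) f g] \<rho>_def c_def[symmetric]
      using c by (simp add: power_mult_distrib power_divide)
  qed
  have "norm2 (\<lambda>z. norm z powr p *\<^sub>R quat_wigner f g z) = ennreal_powr (\<integral>\<^sup>+z. ennreal (1 / c\<^sup>2 * \<rho> z) \<partial>mu) (1/2)"
    unfolding norm2_def pt ..
  \<comment> \<open>One factor \<open>1 / c^2\<close> comes from \<open>mu\<close> on the space of
    dimension \<open>4 d\<close>, the other from the squared normalisation of the transform. They
    cancel \<open>(2 * pi)^(2 * d) = c^2\<close> in the moment bound and the two factors
    \<open>c\<close> carried by \<open>F\<close> and \<open>G\<close>.\<close>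
  also have "(\<integral>\<^sup>+z. ennreal (1 / c\<^sup>2 * \<rho> z) \<partial>mu) = ennreal (1 / c\<^sup>2) * (\<integral>\<^sup>+z. ennreal (1 / c\<^sup>2 * \<rho> z) \<partial>lborel)"
    unfolding c2[symmetric] by (rule nn_integral_mu) measurable
  also have "(\<integral>\<^sup>+z. ennreal (1 / c\<^sup>2 * \<rho> z) \<partial>lborel) = ennreal (1 / c\<^sup>2) * (\<integral>\<^sup>+z. ennreal (\<rho> z) \<partial>lborel)"
    by (subst ennreal_mult') (simp_all add: nn_integral_cmult)
  finally have n2: "norm2 (\<lambda>z. norm z powr p *\<^sub>R quat_wigner f g z) =
    ennreal_powr (ennreal (1 / c\<^sup>2) * (ennreal (1 / c\<^sup>2) * (\<integral>\<^sup>+z. ennreal (\<rho> z) \<partial>lborel))) (1/2)" .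
  define K where "K = moment_const (real CARD('d)) p * (F * G)"
  have K: "K \<ge> 0" using F(2) G(2) p moment_const_pos[of "real CARD('d)" p] by (simp add: K_def)
  have "ennreal (c\<^sup>2 * c\<^sup>2 * K) \<le> (\<integral>\<^sup>+z. ennreal (\<rho> z) \<partial>lborel)"
    using wigner_lborel_moment_ge[OF assms(1,2) F(1) _ G(1) _ p] F(2) G(2)
    by (simp add: \<rho>_def K_def c_def power_mult power2_eq_square power_mult_distrib mult_ac)
  then have "ennreal (1 / c\<^sup>2) * (ennreal (1 / c\<^sup>2) * ennreal (c\<^sup>2 * c\<^sup>2 * K)) \<le>
      ennreal (1 / c\<^sup>2) * (ennreal (1 / c\<^sup>2) * (\<integral>\<^sup>+z. ennreal (\<rho> z) \<partial>lborel))"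
    by (intro mult_left_mono) auto
  also have "ennreal (1 / c\<^sup>2) * (ennreal (1 / c\<^sup>2) * ennreal (c\<^sup>2 * c\<^sup>2 * K)) = ennreal K"
    using c K by (simp add: ennreal_mult'[symmetric])
  finally have "ennreal (K powr (1/2)) \<le> norm2 (\<lambda>z. norm z powr p *\<^sub>R quat_wigner f g z)"
    unfolding n2 using K by (intro ennreal_powr_ge) auto
  then have "ennreal ((K powr (1/2)) powr r) \<le> ennreal_powr (norm2 (\<lambda>z. norm z powr p *\<^sub>R quat_wigner f g z)) r"
    using r by (intro ennreal_powr_ge) auto
  then show ?thesis by (simp add: powr_powr K_def)
qed

theorem corollary13:
  fixes p q d :: real
  assumes "p > 0" and "q > 0" and d: "d = real CARD('d::finite)"
  shows "\<exists>E::real. E \<ge> 0 \<and>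
    E = inverse ((p / q) powr (q / (p + q)) + (q / p) powr (p / (p + q))) *
        exp (p * q * (2 * d * ln 2 +
               ln (2 powr (2 * d) * p * q * (Gamma d)\<^sup>2 / (Gamma (d / p) * Gamma (d / q)))) /
             (d * (p + q)) - 1) \<and>
    (\<forall>g :: (real^'d) \<times> (real^'d) \<Rightarrow> quat. \<forall>f :: (real^'d) \<times> (real^'d) \<Rightarrow> quat.
       quat_window g \<longrightarrow> f \<in> L2 \<longrightarrow>
       ennreal_powr (norm2 (\<lambda>z. norm z powr p *\<^sub>R quat_wigner f g z)) (q / (p + q)) *
       ennreal_powr (norm2 (\<lambda>z. norm z powr q *\<^sub>R quat_wigner f g z)) (p / (p + q))
       \<ge> ennreal (4 powr (- (p * q / (p + q))) * sqrt E) * norm2 f * norm2 g)"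
proof (intro exI conjI allI impI)
  define E where "E = inverse ((p / q) powr (q / (p + q)) + (q / p) powr (p / (p + q))) *
        exp (p * q * (2 * d * ln 2 +
               ln (2 powr (2 * d) * p * q * (Gamma d)\<^sup>2 / (Gamma (d / p) * Gamma (d / q)))) /
             (d * (p + q)) - 1)"
  show E_eq: "E = inverse ((p / q) powr (q / (p + q)) + (q / p) powr (p / (p + q))) *
        exp (p * q * (2 * d * ln 2 +
               ln (2 powr (2 * d) * p * q * (Gamma d)\<^sup>2 / (Gamma (d / p) * Gamma (d / q)))) /
             (d * (p + q)) - 1)"
    by (rule E_def)
  show E0: "E \<ge> 0" by (simp add: E_def)
  fix f g :: "(real^'d) \<times> (real^'d) \<Rightarrow> quat"
  assume "quat_window g" and fL2: "f \<in> L2"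
  then have gL2: "g \<in> L2" by (simp add: quat_window_def)
  obtain f' where f': "f' \<in> borel_measurable borel" "AE x in lborel. f x = f' x"
    using fL2 lebesgue_measurable_ex_borel[of f] by (auto simp: L2_def)
  obtain g' where g': "g' \<in> borel_measurable borel" "AE x in lborel. g x = g' x"
    using gL2 lebesgue_measurable_ex_borel[of g] by (auto simp: L2_def)
  obtain F where F: "F \<ge> 0" "norm2 f = ennreal (sqrt F)"
    "(\<integral>\<^sup>+x. ennreal ((norm (f' x))\<^sup>2) \<partial>lborel) = ennreal ((2 * pi) ^ CARD('d) * F)"
    using norm2_L2[OF f' fL2] by blast
  obtain G where G: "G \<ge> 0" "norm2 g = ennreal (sqrt G)"
    "(\<integral>\<^sup>+x. ennreal ((norm (g' x))\<^sup>2) \<partial>lborel) = ennreal ((2 * pi) ^ CARD('d) * G)"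
    using norm2_L2[OF g' gL2] by blast
  define a b where "a = moment_const d p" "b = moment_const d q"
  have d0: "d > 0" by (simp add: d)
  have ab: "a > 0" "b > 0" using moment_const_pos d0 assms by (auto simp: a_b_def)
  define \<theta> \<eta> where "\<theta> = q / (p + q)" "\<eta> = p / (p + q)"
  have \<theta>: "\<theta> > 0" "\<eta> > 0" using assms by (simp_all add: \<theta>_\<eta>_def)
  have sum1: "\<theta> + \<eta> = 1" using assms by (simp add: \<theta>_\<eta>_def add_divide_distrib[symmetric] add.commute)
  define s where "s = 4 powr (- (p * q / (p + q)))"
  have s: "s > 0" by (simp add: s_def)
  have const: "s\<^sup>2 * E \<le> a powr \<theta> * b powr \<eta>"
    unfolding s_def E_def a_b_def \<theta>_\<eta>_def by (rule constant_bound[OF assms(1,2) d0])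
  \<comment> \<open>Everything is compared under one square root because moments bound squared
    norms; this is also why \<open>const\<close> involves the square of the prefactor.\<close>
  have "s * sqrt E * (sqrt F * sqrt G) = sqrt (s\<^sup>2 * E) * sqrt (F * G)"
    using s by (simp add: real_sqrt_mult)
  also have "\<dots> \<le> sqrt (a powr \<theta> * b powr \<eta>) * sqrt (F * G)"
    using const F(1) G(1) by (intro mult_right_mono real_sqrt_le_mono) auto
  \<comment> \<open>The weights sum to 1, so the two powers of \<open>F * G\<close> recombine to its
    square root.\<close>
  also have "\<dots> = (a * (F * G)) powr (\<theta> / 2) * (b * (F * G)) powr (\<eta> / 2)"
  proof -
    have "(F * G) powr (\<theta> / 2) * (F * G) powr (\<eta> / 2) = (F * G) powr (1 / 2)"
      unfolding powr_add[symmetric] add_divide_distrib[symmetric] sum1 ..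
    also have "\<dots> = sqrt (F * G)" using F(1) G(1) by (simp add: powr_half_sqrt)
    finally have 1: "(F * G) powr (\<theta> / 2) * (F * G) powr (\<eta> / 2) = sqrt (F * G)" .
    have "sqrt (a powr \<theta> * b powr \<eta>) = (a powr \<theta>) powr (1/2) * (b powr \<eta>) powr (1/2)"
      by (simp add: powr_half_sqrt real_sqrt_mult)
    also have "\<dots> = a powr (\<theta> / 2) * b powr (\<eta> / 2)" by (simp add: powr_powr)
    finally show ?thesis unfolding 1[symmetric] using ab F(1) G(1) by (simp add: powr_mult mult_ac)
  qed
  finally have real: "s * sqrt E * (sqrt F * sqrt G) \<le> (a * (F * G)) powr (\<theta> / 2) * (b * (F * G)) powr (\<eta> / 2)" .
  have "ennreal (s * sqrt E) * norm2 f * norm2 g = ennreal (s * sqrt E * (sqrt F * sqrt G))"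
    using s E0 F(1) G(1) unfolding F(2) G(2) by (simp add: ennreal_mult'[symmetric] mult.assoc)
  also have "\<dots> \<le> ennreal ((a * (F * G)) powr (\<theta> / 2)) * ennreal ((b * (F * G)) powr (\<eta> / 2))"
    using real by (simp add: ennreal_mult'[symmetric] ennreal_leI)
  also have "\<dots> \<le> ennreal_powr (norm2 (\<lambda>z. norm z powr p *\<^sub>R quat_wigner f g z)) \<theta> *
       ennreal_powr (norm2 (\<lambda>z. norm z powr q *\<^sub>R quat_wigner f g z)) \<eta>"
    unfolding a_b_def d using assms \<theta>
    by (intro mult_mono norm2_wigner_moment_ge[OF f'(1) g'(1) f'(2) g'(2) F(3,1) G(3,1)]) auto
  finally show "ennreal (4 powr (- (p * q / (p + q))) * sqrt E) * norm2 f * norm2 g \<le>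
      ennreal_powr (norm2 (\<lambda>z. norm z powr p *\<^sub>R quat_wigner f g z)) (q / (p + q)) *
      ennreal_powr (norm2 (\<lambda>z. norm z powr q *\<^sub>R quat_wigner f g z)) (p / (p + q))"
    by (simp only: s_def \<theta>_\<eta>_def)
qed

end
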